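(* Consider the rigid body control system $$\dot R=R\hat\Omega,\qquad\dot\Omega=u,\qquad(R,\Omega)\in\operatorname{SO}(3)\times\mathbb R^3,\ u\in\mathbb R^3.$$ Let $(R_0(t),\Omega_0(t))\in\operatorname{SO}(3)\times\mathbb R^3$ and $u_0(t)\in\mathbb R^3$, $t\ge0$, be smooth with $\dot R_0=R_0\hat\Omega_0$, $\dot\Omega_0=u_0$, and assume $\Omega_0$ and $u_0$ are bounded on $[0,\infty)$. Put $\Delta\Omega=\Omega-\Omega_0(t)$ and $Z_k^\vee=\operatorname{Skew}(R_0^TR)^\vee$ (which equals $\operatorname{Skew}(R_0^T(R-R_0))^\vee$). Then the controller $u=u_0+\Delta u$, where $\Delta u$ is any one of the following, enables the system to track the reference trajectory $(R_0(t),\Omega_0(t))$ exponentially: (i) $\Delta u=-K_PZ_k^\vee-K_D(Z_k^\vee\times\Omega_0+\Delta\Omega)-(Z_k^\vee\times\Omega_0+\Delta\Omega)\times\Omega_0-Z_k^\vee\times u_0$, where $K_P,K_D\in\mathbb R^{3\times3}$ are such that $\begin{bmatrix}0&I\\-K_P&-K_D\end{bmatrix}$ is Hurwitz; (ii) $\Delta u=-K_PZ_k^\vee-K_D(Z_k^\vee\times\Omega_0+\Delta\Omega)-K_I\int_0^tZ_k^\vee(\tau)\,d\tau-(Z_k^\vee\times\Omega_0+\Delta\Omega)\times\Omega_0-Z_k^\vee\times u_0$, where $K_P,K_D,K_I\in\mathbb R^{3\times3}$ are such that the polynomial $\det(\lambda^3I+\lambda^2K_D+\lambda K_P+K_I)$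 is Hurwitz; (iii) $\Delta u=-k_PZ_k^\vee-K_D\Delta\Omega$, where $k_P>0$ and $K_D\in\mathbb R^{3\times3}$ is symmetric positive definite; (iv) $\Delta u=-k_PZ_k^\vee-K_D\Delta\Omega-\epsilon(Z_k^\vee\times\Omega_0)$, where $k_P>0$, $K_D\in\mathbb R^{3\times3}$ is symmetric positive definite and $0<\epsilon<\min\left\{\sqrt{k_P},\frac{4k_P\lambda_{\min}(K_D)}{4k_P+(\lambda_{\max}(K_D))^2}\right\}$; (v) $\Delta u=-k_RZ_k^\vee-k_\Omega\Delta\Omega+\Delta\Omega\times\Omega_0$, where $k_R>0$ and $k_\Omega>0$.
   Context: $\operatorname{Skew}(A)=\frac12(A-A^T)$. For $\Omega\in\mathbb R^3$, $\hat\Omega$ is the $3\times3$ skew-symmetric matrix with $\hat\Omega v=\Omega\times v$; $\vee$ is the inverse of the hat map. A matrix (polynomial) is Hurwitz if all its eigenvalues (roots) have negative real part; $\lambda_{\min},\lambda_{\max}$ denote smallest and largest eigenvalues. Norms are Frobenius/Euclidean. Tracking is understood locally: "tracks the reference exponentially" means that there are constants $\delta,C,\alpha>0$ such that whenever $\|R(0)-R_0(0)\|+\|\Omega(0)-\Omega_0(0)\|<\delta$, the closed-loop solution satisfies $\|R(t)-R_0(t)\|+\|\Omega(t)-\Omega_0(t)\|\le Ce^{-\alpha t}\big(\|R(0)-R_0(0)\|+\|\Omega(0)-\Omega_0(0)\|\big)$ for all $t\ge0$ (in (ii) the integral starts at $t=0$). *)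

theory Defs
  imports "HOL-Analysis.Analysis" "HOL-Computational_Algebra.Polynomial"
begin

unbundle cross3_syntax

definition skew_part :: "real^'n^'n \<Rightarrow> real^'n^'n"
  where "skew_part A = (1/2) *\<^sub>R (A - transpose A)"

definition hat :: "real^3 \<Rightarrow> real^3^3"
  where "hat w = matrix (\<lambda>v. w \<times> v)"

(* Only meaningful on skew-symmetric matrices, which form the range of hat. *)
definition vee :: "real^3^3 \<Rightarrow> real^3"
  where "vee = inv hat"

lemma hat_mult_vec: "hat w *v v = w \<times> v"
proof -
  have "linear (\<lambda>v. w \<times> v)"
    using bilinear_cross by (simp add: bilinear_def)
  then show ?thesis
    by (simp add: hat_def matrix_works)
qed

lemma inj_hat: "inj hat"
proof (rule injI)
  fix v w assume "hat v = hat w"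
  then have "\<And>x. v \<times> x = w \<times> x"
    by (metis hat_mult_vec)
  then have "v \<times> axis 1 1 = w \<times> axis 1 1" "v \<times> axis 2 1 = w \<times> axis 2 1"
    by blast+
  then show "v = w"
    by (simp add: cross3_def axis_def vec_eq_iff forall_3)
qed

lemma vee_hat [simp]: "vee (hat w) = w"
  by (simp add: vee_def inj_hat)

lemma hat_vee:
  assumes "transpose A = - A"
  shows "hat (vee A) = A"
proof -
  have a: "A $ i $ j = - A $ j $ i" for i j
  proof -
    have "A $ i $ j = transpose A $ j $ i"
      by (simp add: transpose_def)
    then show ?thesis
      unfolding assms by simp
  qed
  have d: "A $ i $ i = 0" for i
    using a[of i i] by simp
  have "hat (vector [A$3$2, A$1$3, A$2$1]) = A"
    using a[of 1 2] a[of 2 3] a[of 3 1]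
    by (simp add: vec_eq_iff forall_3 hat_def matrix_def cross3_def axis_def d)
  then show ?thesis
    by (metis vee_hat)
qed

lemma hat_vee_skew_part: "hat (vee (skew_part A)) = skew_part A"
  by (rule hat_vee)
    (auto simp: skew_part_def transpose_def vec_eq_iff diff_divide_distrib)

text \<open>
  The attitude error \<open>Z\<^sub>k\<^sup>\<or>\<close> along the trajectory \<open>R\<close>, as a function of time.
\<close>

definition att_err :: "(real \<Rightarrow> real^3^3) \<Rightarrow> (real \<Rightarrow> real^3^3) \<Rightarrow> real \<Rightarrow> real^3"
  where "att_err R0 R t = vee (skew_part (transpose (R0 t) ** R t))"

lemma att_err_alt:
  assumes "rotation_matrix (R0 t)"
  shows "att_err R0 R t = vee (skew_part (transpose (R0 t) ** (R t - R0 t)))"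
proof -
  have "transpose (R0 t) ** (R t - R0 t) = transpose (R0 t) ** R t - transpose (R0 t) ** R0 t"
    by (simp add: matrix_matrix_mult_def vec_eq_iff sum_subtractf Rings.right_diff_distrib)
  also have "\<dots> = transpose (R0 t) ** R t - mat 1"
    using assms by (simp add: rotation_matrix_def orthogonal_matrix_def)
  finally have "skew_part (transpose (R0 t) ** (R t - R0 t)) = skew_part (transpose (R0 t) ** R t)"
    by (simp add: skew_part_def transpose_def vec_eq_iff mat_def)
  then show ?thesis
    by (simp add: att_err_def)
qed

text \<open>One-sided derivatives are used at boundary points of \<open>S\<close>.\<close>

definition smooth_curve_on :: "real set \<Rightarrow> (real \<Rightarrow> 'a::real_normed_vector) \<Rightarrow> bool"
  where "smooth_curve_on S f \<longleftrightarrow>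
    (\<exists>D. D 0 = f \<and>
      (\<forall>n. \<forall>t\<in>S. (D n has_vector_derivative D (Suc n) t) (at t within S)))"

definition rigid_body_trajectory ::
    "(real \<Rightarrow> real^3^3) \<Rightarrow> (real \<Rightarrow> real^3) \<Rightarrow> (real \<Rightarrow> real^3) \<Rightarrow> bool"
  where "rigid_body_trajectory R \<Omega> u \<longleftrightarrow>
    (\<forall>t\<ge>0. rotation_matrix (R t) \<and>
      (R has_vector_derivative R t ** hat (\<Omega> t)) (at t within {0..}) \<and>
      (\<Omega> has_vector_derivative u t) (at t within {0..}))"

text \<open>
  The correction \<open>\<Delta>u\<close> maps the trajectory \<open>(R, \<Omega>)\<close> to a function of time, so that it may involve
  the past of the trajectory (integral action) and not only its current value. That the closed loop
  has a solution on the whole half-line for all nearby initial states is part of the definition, and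
  the estimate is required of every such solution.
\<close>

definition tracks_exponentially ::
    "(real \<Rightarrow> real^3^3) \<Rightarrow> (real \<Rightarrow> real^3) \<Rightarrow> (real \<Rightarrow> real^3) \<Rightarrow>
     ((real \<Rightarrow> real^3^3) \<Rightarrow> (real \<Rightarrow> real^3) \<Rightarrow> real \<Rightarrow> real^3) \<Rightarrow> bool"
  where "tracks_exponentially R0 \<Omega>0 u0 \<Delta>u \<longleftrightarrow>
    (\<exists>\<delta>>0. \<exists>C>0. \<exists>\<alpha>>0. \<forall>R1 \<Omega>1.
      rotation_matrix R1 \<and> norm (R1 - R0 0) + norm (\<Omega>1 - \<Omega>0 0) < \<delta> \<longrightarrow>
      (\<exists>R \<Omega>. rigid_body_trajectory R \<Omega> (\<lambda>t. u0 t + \<Delta>u R \<Omega> t) \<and> R 0 = R1 \<and> \<Omega> 0 = \<Omega>1) \<and>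
      (\<forall>R \<Omega>. rigid_body_trajectory R \<Omega> (\<lambda>t. u0 t + \<Delta>u R \<Omega> t) \<and> R 0 = R1 \<and> \<Omega> 0 = \<Omega>1 \<longrightarrow>
        (\<forall>t\<ge>0. norm (R t - R0 t) + norm (\<Omega> t - \<Omega>0 t)
          \<le> C * exp (- \<alpha> * t) * (norm (R1 - R0 0) + norm (\<Omega>1 - \<Omega>0 0)))))"

definition eigenvalue :: "'a::field^'n^'n \<Rightarrow> 'a \<Rightarrow> bool"
  where "eigenvalue A l \<longleftrightarrow> (\<exists>v. v \<noteq> 0 \<and> A *v v = l *s v)"

definition hurwitz_matrix :: "real^'n^'n \<Rightarrow> bool"
  where "hurwitz_matrix A \<longleftrightarrow>
    (\<forall>l. eigenvalue (map_matrix complex_of_real A) l \<longrightarrow> Re l < 0)"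

definition hurwitz_poly :: "real poly \<Rightarrow> bool"
  where "hurwitz_poly p \<longleftrightarrow> (\<forall>z. poly (map_poly complex_of_real p) z = 0 \<longrightarrow> Re z < 0)"

definition block_matrix ::
    "'a^'n^'m \<Rightarrow> 'a^'l^'m \<Rightarrow> 'a^'n^'k \<Rightarrow> 'a^'l^'k \<Rightarrow> 'a^('n + 'l)^('m + 'k)"
  where "block_matrix A B C D = (\<chi> i j.
    case i of
      Inl i' \<Rightarrow> (case j of Inl j' \<Rightarrow> A $ i' $ j' | Inr j' \<Rightarrow> B $ i' $ j')
    | Inr i' \<Rightarrow> (case j of Inl j' \<Rightarrow> C $ i' $ j' | Inr j' \<Rightarrow> D $ i' $ j'))"

text \<open>The polynomial \<open>det (\<lambda>\<^sup>3 I + \<lambda>\<^sup>2 A + \<lambda> B + C)\<close> in the indeterminate \<open>\<lambda>\<close>.\<close>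

definition cubic_pencil_poly :: "real^'n^'n \<Rightarrow> real^'n^'n \<Rightarrow> real^'n^'n \<Rightarrow> real poly"
  where "cubic_pencil_poly A B C = det (\<chi> i j.
    monom (mat 1 $ i $ j) 3 + monom (A $ i $ j) 2 + monom (B $ i $ j) 1 + monom (C $ i $ j) 0)"

definition sym_pos_def :: "real^'n^'n \<Rightarrow> bool"
  where "sym_pos_def A \<longleftrightarrow> transpose A = A \<and> (\<forall>x. x \<noteq> 0 \<longrightarrow> 0 < x \<bullet> (A *v x))"

text \<open>Only real eigenvalues enter; a symmetric matrix has no others.\<close>

definition lambda_min :: "real^'n^'n \<Rightarrow> real"
  where "lambda_min A = Min {l. eigenvalue A l}"

definition lambda_max :: "real^'n^'n \<Rightarrow> real"
  where "lambda_max A = Max {l. eigenvalue A l}"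

end

theory Submission
  imports Defs "HOL-Computational_Algebra.Fundamental_Theorem_Algebra"
begin

text \<open>
  Let \<open>E = R0\<^sup>T R\<close> be the relative attitude, \<open>z\<close> the attitude error, i.e. the axial vector of the skew part
  of \<open>E\<close>, let \<open>w = \<Omega> - \<Omega>0\<close> be the rate error and \<open>x\<close> the integral of \<open>z\<close> from time \<open>0\<close>. The attitude error
  satisfies \<open>z' = z \<times> \<Omega>0 + w + \<rho>\<close> with a remainder \<open>\<rho>\<close> bounded by a multiple of \<open>\<bar>E - I\<bar> \<bar>w\<bar>\<close>
  (\<open>att_err_derivative\<close>, \<open>attitude_error_bounds\<close>), and every controller gives \<open>w' = F t (z, w, x)\<close> with \<open>F t\<close>
  linear. So the error dynamics is a linear time-varying system, perturbed by \<open>\<rho>\<close> alone. Near \<open>E = I\<close> the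
  error \<open>z\<close> controls \<open>E - I\<close>, because \<open>E - I = hat z - (E - I)\<^sup>T (E - I) / 2\<close> for orthogonal \<open>E\<close>.

  A Lyapunov function that decays exponentially along the linear system therefore still decays along the closed
  loop, at half the rate, while the state is close to the reference; the decay in turn prevents the state from
  leaving that neighbourhood. This is \<open>lyapunov_tracking_criterion\<close>. Its existence part rests on the closed
  loop in which the rate in \<open>R' = R hat \<Omega>\<close> is truncated above the bound of \<open>\<Omega>0\<close>: it is globally
  Lipschitz, hence solvable for all times, and by the same estimate the truncation never becomes active.

  It remains to find Lyapunov functions. For (i) and (ii) the rate \<open>y = z \<times> \<Omega>0 + w\<close> makes the linear system
  time invariant, namely \<open>z' = y\<close> and \<open>y' = - K\<^sub>P z - K\<^sub>D y\<close>, respectively \<open>y' = - K\<^sub>I x - K\<^sub>P z - K\<^sub>D y\<close> with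
  \<open>x' = z\<close>. The hypotheses say that these systems are Hurwitz, and a Hurwitz operator has a quadratic Lyapunov
  function (\<open>lyapunov_form_exists\<close>). For (iii), (iv) and (v) the function \<open>k \<bar>z\<bar>\<^sup>2 + \<bar>w\<bar>\<^sup>2 + 2 \<eta> (z \<bullet> w)\<close> works:
  \<open>z \<times> \<Omega>0\<close> is orthogonal to \<open>z\<close>, so \<open>\<Omega>0\<close> enters only through terms of size \<open>\<eta>\<close>, and the derivative is negative
  definite once \<open>\<eta> (4 k + \<mu>\<^sup>2) < 4 k \<nu>\<close>, where \<open>\<nu>\<close> is the damping and \<open>\<eta> \<mu> \<bar>z\<bar> \<bar>w\<bar>\<close> bounds the cross terms
  (\<open>damped_exponential_lyapunov\<close>). In (iv) the cross terms containing \<open>\<Omega>0\<close> cancel for \<open>\<eta> = \<epsilon>\<close>, in (v) for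
  every \<open>\<eta>\<close>; in (iii) they are absorbed by a small \<open>\<eta>\<close>.
\<close>

section \<open>Rotations and the attitude error\<close>

definition axial :: "real^3^3 \<Rightarrow> real^3"
  where "axial A = vee (skew_part A)"

lemma att_err_eq_axial: "att_err R0 R t = axial (transpose (R0 t) ** R t)"
  by (simp add: att_err_def axial_def)

lemma hat_axial: "hat (axial A) = skew_part A"
  by (simp add: axial_def hat_vee_skew_part)

lemma hat_eq_vector:
  "hat w = vector [vector [0, - w$3, w$2], vector [w$3, 0, - w$1], vector [- w$2, w$1, 0]]"
  by (simp add: vec_eq_iff forall_3 hat_def matrix_def cross3_def axis_def)

lemma axial_eq_vector:
  "axial A = vector [(A$3$2 - A$2$3) / 2, (A$1$3 - A$3$1) / 2, (A$2$1 - A$1$2) / 2]"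
proof -
  have "hat (vector [(A$3$2 - A$2$3) / 2, (A$1$3 - A$3$1) / 2, (A$2$1 - A$1$2) / 2]) = skew_part A"
    by (simp add: hat_eq_vector skew_part_def transpose_def vec_eq_iff forall_3 field_simps)
  then show ?thesis
    by (metis axial_def vee_hat)
qed

lemma linear_axial: "linear axial"
  by (rule linearI) (simp_all add: axial_eq_vector vec_eq_iff forall_3 field_simps)

lemma linear_hat: "linear hat"
  by (rule linearI) (simp_all add: hat_eq_vector vec_eq_iff forall_3)

lemma axial_hat: "axial (hat w) = w"
  by (simp add: axial_eq_vector hat_eq_vector vec_eq_iff forall_3)

lemma transpose_hat: "transpose (hat w) = - hat w"
  by (simp add: hat_eq_vector vec_eq_iff forall_3 transpose_def)

lemma axial_mat_1: "axial (mat 1) = 0"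
  by (simp add: axial_eq_vector vec_eq_iff forall_3 mat_def)

lemma linear_transpose: "linear (transpose :: real^'n^'m \<Rightarrow> real^'m^'n)"
  by (rule linearI) (simp_all add: transpose_def vec_eq_iff)

lemma bounded_bilinear_matrix_mult:
  "bounded_bilinear ((**) :: real^'n^'m \<Rightarrow> real^'l^'n \<Rightarrow> real^'l^'m)"
proof -
  have "bilinear ((**) :: real^'n^'m \<Rightarrow> real^'l^'n \<Rightarrow> real^'l^'m)"
    unfolding bilinear_def
    by (auto intro!: linearI simp: matrix_matrix_mult_def vec_eq_iff algebra_simps sum.distrib sum_distrib_left)
  then show ?thesis
    by (simp add: bilinear_conv_bounded_bilinear)
qed

lemma matrix_mult_norm_bound: "\<exists>m>0. \<forall>A B. norm ((A :: real^3^3) ** (B :: real^3^3)) \<le> norm A * norm B * m"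
  by (rule bounded_bilinear.pos_bounded[OF bounded_bilinear_matrix_mult])

lemmas has_vector_derivative_matrix_mult = bounded_bilinear.has_vector_derivative[OF bounded_bilinear_matrix_mult]

text \<open>
  The map \<open>axial\<close> turns the commutator with \<open>hat a\<close> into the cross product with \<open>a\<close>; the reference rate therefore
  enters the attitude error equation as \<open>z \<times> a\<close> without any remainder.
\<close>

lemma axial_error_identity:
  "axial (E ** hat b - hat a ** E) = axial E \<times> a + axial (E ** hat (b - a))"
  by (simp add: axial_eq_vector hat_eq_vector cross3_def matrix_matrix_mult_def sum_3 vec_eq_iff forall_3 field_simps)

lemma att_err_derivative:
  assumes R0: "(R0 has_vector_derivative R0 t ** hat a) (at t within S)"
    and R: "(R has_vector_derivative R t ** hat b) (at t within S)"
  shows "(att_err R0 R has_vector_derivative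
    att_err R0 R t \<times> a + axial (transpose (R0 t) ** R t ** hat (b - a))) (at t within S)"
proof -
  let ?E = "transpose (R0 t) ** R t"
  have "((\<lambda>t. transpose (R0 t)) has_vector_derivative transpose (R0 t ** hat a)) (at t within S)"
    using bounded_linear.has_vector_derivative[OF linear_conv_bounded_linear[THEN iffD1, OF linear_transpose] R0] .
  from has_vector_derivative_matrix_mult[OF this R]
  have "((\<lambda>t. transpose (R0 t) ** R t) has_vector_derivative
      transpose (R0 t) ** (R t ** hat b) + transpose (R0 t ** hat a) ** R t) (at t within S)" .
  also have "transpose (R0 t ** hat a) ** R t = - (hat a ** ?E)"
    by (simp add: matrix_transpose_mul transpose_hat matrix_mul_assoc
        bounded_bilinear.minus_left[OF bounded_bilinear_matrix_mult])
  finally have "((\<lambda>t. axial (transpose (R0 t) ** R t)) has_vector_derivative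
      axial (?E ** hat b - hat a ** ?E)) (at t within S)"
    by (intro bounded_linear.has_vector_derivative[OF linear_conv_bounded_linear[THEN iffD1, OF linear_axial]])
      (simp add: matrix_mul_assoc)
  then show ?thesis
    unfolding att_err_eq_axial[abs_def] axial_error_identity .
qed

lemma rotation_matrix_norm_le:
  fixes Q :: "real^3^3"
  assumes "rotation_matrix Q"
  shows "norm Q \<le> 3"
proof -
  have "norm (Q $ i) = 1" for i
    using assms orthogonal_matrix_orthonormal_rows[of Q] by (simp add: rotation_matrix_def row_def vec_nth_inverse)
  moreover have "norm Q \<le> (\<Sum>i\<in>UNIV. norm (Q $ i))"
    unfolding norm_vec_def by (rule L2_set_le_sum) simp
  ultimately show ?thesis by simp
qed

text \<open>
  Since \<open>E\<^sup>T E = 1\<close>, the symmetric part of \<open>E - 1\<close> is quadratic in \<open>E - 1\<close>. This is what makes the skew part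
  \<open>axial E\<close> a local coordinate at the identity; it says nothing about rotations by the angle \<open>\<pi>\<close>, where
  \<open>axial E = 0\<close> as well.
\<close>

lemma orthogonal_minus_one:
  fixes E :: "real^3^3"
  assumes "orthogonal_matrix E"
  shows "E - mat 1 = hat (axial E) - (1/2) *\<^sub>R (transpose (E - mat 1) ** (E - mat 1))"
proof -
  have "transpose (E - mat 1) ** (E - mat 1) = transpose E ** E - transpose E - E + mat 1"
    by (simp add: linear_diff[OF linear_transpose] bounded_bilinear.diff_left[OF bounded_bilinear_matrix_mult]
        bounded_bilinear.diff_right[OF bounded_bilinear_matrix_mult] transpose_mat)
  also have "\<dots> = 2 *\<^sub>R mat 1 - transpose E - E"
    using assms by (simp add: orthogonal_matrix_def scaleR_2)
  finally show ?thesis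
    by (simp add: hat_axial skew_part_def vec_eq_iff field_simps)
qed

text \<open>
  The three estimates between group and error coordinates: the attitude error is bounded by the distance to the
  reference, controls it within the distance \<open>d\<close>, and its equation of motion differs from the linear one by a
  term that is small relative to \<open>w\<close>.
\<close>

lemma attitude_error_bounds:
  obtains K d :: real where "K > 0" "d > 0"
    "\<And>Q0 Q. rotation_matrix Q0 \<Longrightarrow> rotation_matrix Q \<Longrightarrow> norm (axial (transpose Q0 ** Q)) \<le> K * norm (Q - Q0)"
    "\<And>Q0 Q. rotation_matrix Q0 \<Longrightarrow> rotation_matrix Q \<Longrightarrow> norm (Q - Q0) \<le> d \<Longrightarrow>
       norm (Q - Q0) \<le> K * norm (axial (transpose Q0 ** Q))"
    "\<And>Q0 Q w. rotation_matrix Q0 \<Longrightarrow> rotation_matrix Q \<Longrightarrow>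
       norm (axial (transpose Q0 ** Q ** hat w) - w) \<le> K * norm (Q - Q0) * norm w"
proof -
  obtain a where a: "a > 0" "\<And>A. norm (axial A) \<le> a * norm A"
    using linear_bounded_pos[OF linear_axial] by blast
  obtain h where h: "h > 0" "\<And>w. norm (hat w) \<le> h * norm w"
    using linear_bounded_pos[OF linear_hat] by blast
  obtain \<tau> where \<tau>: "\<tau> > 0" "\<And>A. norm (transpose A) \<le> \<tau> * norm (A :: real^3^3)"
    using linear_bounded_pos[OF linear_transpose] by blast
  obtain m where m: "m > 0" "\<And>A B. norm ((A :: real^3^3) ** (B :: real^3^3)) \<le> norm A * norm B * m"
    using matrix_mult_norm_bound by metis
  define M where "M = 3 * \<tau> * m + 3 * m"
  have M: "M > 0"
    using \<tau> m by (simp add: M_def add_pos_pos)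
  have E1: "norm (E - mat 1) \<le> M * norm (Q - Q0)" and E2: "norm (Q - Q0) \<le> M * norm (E - mat 1)"
    if Q: "rotation_matrix Q0" "rotation_matrix Q" and E: "E = transpose Q0 ** Q" for Q0 Q E :: "real^3^3"
  proof -
    have o: "transpose Q0 ** Q0 = mat 1" "Q0 ** transpose Q0 = mat 1"
      using Q(1) by (auto simp: rotation_matrix_def orthogonal_matrix_def)
    have "E - mat 1 = transpose Q0 ** (Q - Q0)"
      by (simp add: E o bounded_bilinear.diff_right[OF bounded_bilinear_matrix_mult])
    then have "norm (E - mat 1) \<le> norm (transpose Q0) * norm (Q - Q0) * m"
      using m(2)[of "transpose Q0" "Q - Q0"] by simp
    also have "\<dots> \<le> (3 * \<tau>) * norm (Q - Q0) * m"
    proof -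
      have "\<tau> * norm Q0 \<le> \<tau> * 3"
        using rotation_matrix_norm_le[OF Q(1)] \<tau>(1) by (intro mult_left_mono) auto
      then have "norm (transpose Q0) \<le> 3 * \<tau>"
        using \<tau>(2)[of Q0] by linarith
      then show ?thesis
        using m(1) by (intro mult_right_mono) auto
    qed
    also have "\<dots> \<le> M * norm (Q - Q0)"
      using m(1) by (simp add: M_def algebra_simps)
    finally show "norm (E - mat 1) \<le> M * norm (Q - Q0)" .
    have "Q - Q0 = Q0 ** (E - mat 1)"
      by (simp add: E o matrix_mul_assoc bounded_bilinear.diff_right[OF bounded_bilinear_matrix_mult])
    then have "norm (Q - Q0) \<le> norm Q0 * norm (E - mat 1) * m"
      using m(2)[of Q0 "E - mat 1"] by simp
    also have "\<dots> \<le> 3 * norm (E - mat 1) * m"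
      using rotation_matrix_norm_le[OF Q(1)] m(1) by (intro mult_right_mono) auto
    also have "\<dots> \<le> M * norm (E - mat 1)"
      using m(1) \<tau>(1) by (simp add: M_def algebra_simps)
    finally show "norm (Q - Q0) \<le> M * norm (E - mat 1)" .
  qed
  \<comment> \<open>This radius makes the quadratic term of \<open>orthogonal_minus_one\<close> at most half of \<open>norm (E - mat 1)\<close>.\<close>
  define d where "d = 1 / (\<tau> * m * M)"
  have d: "d > 0"
    using \<tau> m M by (simp add: d_def)
  have E3: "norm (E - mat 1) \<le> 2 * h * norm (axial E)"
    if "orthogonal_matrix E" and small: "norm (E - mat 1) \<le> 1 / (\<tau> * m)" for E
  proof -
    let ?A = "E - mat 1"
    have "norm ?A \<le> norm (hat (axial E)) + norm ((1/2) *\<^sub>R (transpose ?A ** ?A))"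
      using norm_triangle_ineq4[of "hat (axial E)" "(1/2) *\<^sub>R (transpose ?A ** ?A)"]
        orthogonal_minus_one[OF that(1)] by simp
    also have "\<dots> \<le> h * norm (axial E) + (1/2) * norm ?A"
    proof -
      have "norm (transpose ?A ** ?A) \<le> norm (transpose ?A) * norm ?A * m"
        by (rule m(2))
      also have "\<dots> \<le> (\<tau> * norm ?A) * norm ?A * m"
        using \<tau>(2)[of ?A] m(1) by (intro mult_right_mono) auto
      also have "\<dots> = ((\<tau> * m) * norm ?A) * norm ?A"
        by (simp add: algebra_simps)
      also have "\<dots> \<le> 1 * norm ?A"
        using small \<tau>(1) m(1) by (intro mult_right_mono) (auto simp: field_simps)
      finally show ?thesis
        using h(2)[of "axial E"] by simp
    qed
    finally show ?thesis by simp
  qed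
  define K where "K = a * M + M * (2 * h) + a * (m * h * M)"
  have K: "a * M \<le> K" "M * (2 * h) \<le> K" "a * (m * h * M) \<le> K" "K > 0"
    using a(1) h(1) m(1) M by (auto simp: K_def add_pos_pos intro: add_nonneg_nonneg)
  show thesis
  proof (rule that[OF K(4) d])
    fix Q0 Q :: "real^3^3" assume Q: "rotation_matrix Q0" "rotation_matrix Q"
    define E where "E = transpose Q0 ** Q"
    have oE: "orthogonal_matrix E"
      using Q by (simp add: E_def rotation_matrix_def orthogonal_matrix_mul orthogonal_matrix_transpose)
    have "norm (axial E) = norm (axial (E - mat 1))"
      by (simp add: linear_diff[OF linear_axial] axial_mat_1)
    also have "\<dots> \<le> a * norm (E - mat 1)"
      by (rule a(2))
    also have "\<dots> \<le> a * (M * norm (Q - Q0))"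
      using E1[OF Q E_def] a(1) by (intro mult_left_mono) auto
    also have "\<dots> \<le> K * norm (Q - Q0)"
      using mult_right_mono[OF K(1), of "norm (Q - Q0)"] by (simp add: mult.assoc)
    finally show "norm (axial (transpose Q0 ** Q)) \<le> K * norm (Q - Q0)"
      by (simp add: E_def)
    show "norm (Q - Q0) \<le> K * norm (axial (transpose Q0 ** Q))" if "norm (Q - Q0) \<le> d"
    proof -
      have "norm (E - mat 1) \<le> M * d"
        using E1[OF Q E_def] mult_left_mono[OF that, of M] M by linarith
      also have "\<dots> = 1 / (\<tau> * m)"
        using M by (simp add: d_def)
      finally have "norm (E - mat 1) \<le> 2 * h * norm (axial E)"
        by (rule E3[OF oE])
      then have "M * norm (E - mat 1) \<le> M * (2 * h) * norm (axial E)"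
        using M by simp
      also have "\<dots> \<le> K * norm (axial E)"
        by (rule mult_right_mono[OF K(2)]) simp
      finally show ?thesis
        using E2[OF Q E_def] by (simp add: E_def)
    qed
    show "norm (axial (transpose Q0 ** Q ** hat w) - w) \<le> K * norm (Q - Q0) * norm w" for w
    proof -
      have "axial (E ** hat w) - w = axial ((E - mat 1) ** hat w)"
        by (simp add: bounded_bilinear.diff_left[OF bounded_bilinear_matrix_mult] linear_diff[OF linear_axial] axial_hat)
      then have "norm (axial (E ** hat w) - w) \<le> a * norm ((E - mat 1) ** hat w)"
        using a(2) by simp
      also have "\<dots> \<le> a * (norm (E - mat 1) * norm (hat w) * m)"
        using a(1) m(2) by (intro mult_left_mono) auto
      also have "\<dots> \<le> a * ((M * norm (Q - Q0)) * (h * norm w) * m)"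
        using a(1) m(1) h M E1[OF Q E_def]
        by (intro mult_left_mono mult_right_mono mult_mono) auto
      also have "\<dots> = a * (m * h * M) * (norm (Q - Q0) * norm w)"
        by (simp add: algebra_simps)
      also have "\<dots> \<le> K * (norm (Q - Q0) * norm w)"
        by (rule mult_right_mono[OF K(3)]) simp
      finally show ?thesis
        by (simp add: E_def mult.assoc)
    qed
  qed
qed

section \<open>Global solutions of Lipschitz differential equations\<close>

lemma at_within_atLeastAtMost_eq:
  fixes t :: real
  assumes "0 \<le> t" "t < b"
  shows "at t within {0..b} = at t within {0..}"
  by (rule at_within_nhd[where S = "{..<b}"]) (use assms in auto)

lemma continuous_on_atLeast:
  fixes \<Phi> :: "real \<Rightarrow> 'a::topological_space"
  assumes "\<And>t. continuous_on {0..t} \<Phi>"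
  shows "continuous_on {0..} \<Phi>"
  unfolding continuous_on_def
proof
  fix t :: real assume t: "t \<in> {0..}"
  then have "(\<Phi> \<longlongrightarrow> \<Phi> t) (at t within {0..t + 1})"
    using assms[of "t + 1"] by (simp add: continuous_on_def)
  then show "(\<Phi> \<longlongrightarrow> \<Phi> t) (at t within {0..})"
    using at_within_atLeastAtMost_eq[of t "t + 1"] t by simp
qed

text \<open>
  In the norm weighted by \<open>exp (- k t)\<close>, integration over the whole half-line has operator norm at most \<open>1 / k\<close>.
\<close>

lemma integral_exp_bound:
  fixes u :: "real \<Rightarrow> 'a::banach"
  assumes t: "0 \<le> t" and u: "continuous_on {0..t} u" and k: "k > 0" and c: "0 \<le> c"
    and bound: "\<And>s. s \<in> {0..t} \<Longrightarrow> norm (u s) \<le> c * exp (k * s)"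
  shows "exp (- k * t) * norm (integral {0..t} u) \<le> c / k"
proof -
  have i: "((\<lambda>s. c * exp (k * s)) has_integral (c * exp (k * t) / k - c * exp (k * 0) / k)) {0..t}"
    by (rule fundamental_theorem_of_calculus[OF t])
      (use k in \<open>auto intro!: derivative_eq_intros simp: has_real_derivative_iff_has_vector_derivative[symmetric]\<close>)
  have "norm (integral {0..t} u) \<le> integral {0..t} (\<lambda>s. c * exp (k * s))"
    by (rule integral_norm_bound_integral)
      (use i u bound in \<open>auto intro: integrable_continuous_real\<close>)
  also have "\<dots> = c * exp (k * t) / k - c / k"
    using integral_unique[OF i] by simp
  also have "\<dots> \<le> exp (k * t) * (c / k)"
    using k c by (simp add: mult.commute)
  finally have "exp (- k * t) * norm (integral {0..t} u) \<le> exp (- k * t) * (exp (k * t) * (c / k))"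
    by (rule mult_left_mono) simp
  also have "\<dots> = c / k"
    by (simp flip: mult.assoc exp_add)
  finally show ?thesis .
qed

lemma continuous_on_lipschitz_compose:
  fixes f :: "real \<Rightarrow> 'a::real_normed_vector \<Rightarrow> 'b::real_normed_vector"
  assumes cont: "\<And>x. continuous_on S (\<lambda>t. f t x)"
    and lip: "\<And>t x y. t \<in> S \<Longrightarrow> norm (f t x - f t y) \<le> L * norm (x - y)"
    and \<psi>: "continuous_on S \<psi>"
  shows "continuous_on S (\<lambda>t. f t (\<psi> t))"
  unfolding continuous_on_def
proof
  fix s assume s: "s \<in> S"
  have "((\<lambda>t. f t (\<psi> t) - f t (\<psi> s)) \<longlongrightarrow> 0) (at s within S)"
  proof (rule Lim_null_comparison)
    show "\<forall>\<^sub>F t in at s within S. norm (f t (\<psi> t) - f t (\<psi> s)) \<le> L * norm (\<psi> t - \<psi> s)"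
      by (auto simp: eventually_at_filter lip)
    have "(\<psi> \<longlongrightarrow> \<psi> s) (at s within S)"
      using \<psi> s by (auto simp: continuous_on_def)
    then show "((\<lambda>t. L * norm (\<psi> t - \<psi> s)) \<longlongrightarrow> 0) (at s within S)"
      by (intro tendsto_eq_intros) auto
  qed
  moreover have "((\<lambda>t. f t (\<psi> s)) \<longlongrightarrow> f s (\<psi> s)) (at s within S)"
    using cont s by (auto simp: continuous_on_def)
  ultimately show "((\<lambda>t. f t (\<psi> t)) \<longlongrightarrow> f s (\<psi> s)) (at s within S)"
    by (auto dest: tendsto_add)
qed

text \<open>
  Picard iteration on the whole half-line at once: for weight \<open>exp (- k t)\<close> with \<open>k\<close> twice the Lipschitz
  constant, the integral operator is a contraction of the bounded continuous functions. The unknown \<open>y\<close> of the fixed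
  point equation is the solution multiplied by the weight, and times are replaced by \<open>max 0 t\<close> because the bounded
  continuous functions live on the entire line.
\<close>

theorem lipschitz_ode_global_solution:
  fixes f :: "real \<Rightarrow> 'a::banach \<Rightarrow> 'a"
  assumes cont: "\<And>x. continuous_on {0..} (\<lambda>t. f t x)"
    and lip: "\<And>t x y. t \<ge> 0 \<Longrightarrow> norm (f t x - f t y) \<le> L * norm (x - y)"
    and bdd: "\<And>t. t \<ge> 0 \<Longrightarrow> norm (f t 0) \<le> B"
  shows "\<exists>\<phi>. \<phi> 0 = x0 \<and> (\<forall>t\<ge>0. (\<phi> has_vector_derivative f t (\<phi> t)) (at t within {0..}))"
proof -
  define l where "l = max L 1"
  define k where "k = 2 * l"
  have l: "l > 0" and k: "k > 0" and kl: "l / k = 1 / 2"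
    by (auto simp: l_def k_def)
  have lip': "norm (f t x - f t y) \<le> l * norm (x - y)" if "t \<ge> 0" for t x y
    using lip[OF that, of x y] by (rule order_trans) (auto simp: l_def intro: mult_right_mono)
  have B: "B \<ge> 0"
    using bdd[of 0] norm_ge_zero[of "f 0 0"] by linarith
  define \<psi> where "\<psi> y s = exp (k * s) *\<^sub>R apply_bcontfun y s" for y :: "real \<Rightarrow>\<^sub>C 'a" and s
  have \<psi>c: "continuous_on S (\<psi> y)" for y S
    unfolding \<psi>_def by (intro continuous_intros) auto
  have fc: "continuous_on {0..} (\<lambda>s. f s (\<psi> y s))" for y
    by (rule continuous_on_lipschitz_compose[where L = l]) (use cont lip' \<psi>c in auto)
  then have fct: "continuous_on {0..t} (\<lambda>s. f s (\<psi> y s))" for y t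
    by (rule continuous_on_subset) auto
  define G where "G y t = exp (- k * max 0 t) *\<^sub>R (x0 + integral {0..max 0 t} (\<lambda>s. f s (\<psi> y s)))" for y t
  have G_bcontfun: "G y \<in> bcontfun" for y
  proof (rule bcontfun_normI)
    have "continuous_on {0..t} (\<lambda>t. integral {0..t} (\<lambda>s. f s (\<psi> y s)))" for t
      by (intro indefinite_integral_continuous_1 integrable_continuous_real fct)
    then have "continuous_on {0..} (\<lambda>t. integral {0..t} (\<lambda>s. f s (\<psi> y s)))"
      by (rule continuous_on_atLeast)
    then have "continuous_on UNIV (\<lambda>t. integral {0..max 0 t} (\<lambda>s. f s (\<psi> y s)))"
      by (rule continuous_on_compose2) (auto intro!: continuous_intros)
    then show "continuous_on UNIV (G y)"
      unfolding G_def by (intro continuous_intros)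
    show "norm (G y t) \<le> norm x0 + (B + l * norm y) / k" for t
    proof -
      define \<tau> where "\<tau> = max 0 t"
      have \<tau>: "\<tau> \<ge> 0"
        by (simp add: \<tau>_def)
      have "norm (f s (\<psi> y s)) \<le> (B + l * norm y) * exp (k * s)" if "s \<in> {0..\<tau>}" for s
      proof -
        have e: "1 \<le> exp (k * s)"
          using k that by simp
        have "norm (f s (\<psi> y s)) \<le> norm (f s 0) + norm (f s (\<psi> y s) - f s 0)"
          using norm_triangle_ineq[of "f s 0" "f s (\<psi> y s) - f s 0"] by simp
        also have "\<dots> \<le> B + l * norm (\<psi> y s)"
          using bdd[of s] lip'[of s "\<psi> y s" 0] that by auto
        also have "\<dots> \<le> B * exp (k * s) + l * (exp (k * s) * norm y)"
          using e B l norm_bounded[of y s]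
          by (intro add_mono mult_left_mono) (auto simp: \<psi>_def mult_le_cancel_left1)
        finally show ?thesis
          by (simp add: algebra_simps)
      qed
      then have "exp (- k * \<tau>) * norm (integral {0..\<tau>} (\<lambda>s. f s (\<psi> y s))) \<le> (B + l * norm y) / k"
        using B l by (intro integral_exp_bound \<tau> fct k) auto
      moreover have "norm (G y t) \<le> exp (- k * \<tau>) * (norm x0 + norm (integral {0..\<tau>} (\<lambda>s. f s (\<psi> y s))))"
        by (simp add: G_def \<tau>_def norm_triangle_ineq)
      moreover have "exp (- k * \<tau>) * norm x0 \<le> 1 * norm x0"
        using k \<tau> by (intro mult_right_mono) auto
      ultimately show ?thesis
        by (simp add: distrib_left)
    qed
  qed
  have appG: "apply_bcontfun (Bcontfun (G y)) = G y" for y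
    by (rule Bcontfun_inverse[OF G_bcontfun])
  have "dist (Bcontfun (G y)) (Bcontfun (G z)) \<le> 1 / 2 * dist y z" for y z
  proof (rule dist_bound)
    fix t :: real
    define \<tau> where "\<tau> = max 0 t"
    have \<tau>: "\<tau> \<ge> 0"
      by (simp add: \<tau>_def)
    have "norm (f s (\<psi> y s) - f s (\<psi> z s)) \<le> (l * dist y z) * exp (k * s)" if "s \<in> {0..\<tau>}" for s
    proof -
      have "norm (f s (\<psi> y s) - f s (\<psi> z s)) \<le> l * norm (\<psi> y s - \<psi> z s)"
        using lip' that by auto
      also have "norm (\<psi> y s - \<psi> z s) = exp (k * s) * dist (apply_bcontfun y s) (apply_bcontfun z s)"
        by (simp add: \<psi>_def dist_norm flip: scaleR_diff_right)
      also have "\<dots> \<le> exp (k * s) * dist y z"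
        by (intro mult_left_mono dist_bounded) auto
      finally show ?thesis
        using l by (simp add: mult.assoc mult.commute[of "exp (k * s)"])
    qed
    then have "exp (- k * \<tau>) * norm (integral {0..\<tau>} (\<lambda>s. f s (\<psi> y s) - f s (\<psi> z s))) \<le> (l * dist y z) / k"
      using l by (intro integral_exp_bound \<tau> k continuous_intros fct) auto
    also have "integral {0..\<tau>} (\<lambda>s. f s (\<psi> y s) - f s (\<psi> z s))
        = integral {0..\<tau>} (\<lambda>s. f s (\<psi> y s)) - integral {0..\<tau>} (\<lambda>s. f s (\<psi> z s))"
      by (intro integral_diff integrable_continuous_real fct)
    also have "(l * dist y z) / k = 1 / 2 * dist y z"
      using kl by (metis times_divide_eq_left)
    finally show "dist (apply_bcontfun (Bcontfun (G y)) t) (apply_bcontfun (Bcontfun (G z)) t) \<le> 1 / 2 * dist y z"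
      by (simp add: appG G_def \<tau>_def dist_norm flip: scaleR_diff_right)
  qed
  then have "\<exists>!y. Bcontfun (G y) = y"
    by (intro banach_fix_type[where c = "1 / 2"]) auto
  then obtain y where y: "Bcontfun (G y) = y"
    by blast
  have \<psi>y: "\<psi> y t = x0 + integral {0..t} (\<lambda>s. f s (\<psi> y s))" if "t \<ge> 0" for t
  proof -
    have "apply_bcontfun y t = G y t"
      using appG[of y] y by simp
    then have "\<psi> y t = exp (k * t) *\<^sub>R G y t"
      by (simp add: \<psi>_def)
    also have "\<dots> = (exp (k * t) * exp (- k * t)) *\<^sub>R (x0 + integral {0..t} (\<lambda>s. f s (\<psi> y s)))"
      using that by (simp add: G_def)
    also have "exp (k * t) * exp (- k * t) = 1"
      by (simp flip: exp_add)
    finally show ?thesis by simp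
  qed
  show ?thesis
  proof (intro exI[of _ "\<psi> y"] conjI allI impI)
    show "\<psi> y 0 = x0"
      using \<psi>y[of 0] by simp
    fix t :: real assume t: "0 \<le> t"
    have "((\<lambda>t. x0 + integral {0..t} (\<lambda>s. f s (\<psi> y s))) has_vector_derivative 0 + f t (\<psi> y t)) (at t within {0..t + 1})"
      by (intro has_vector_derivative_add has_vector_derivative_const integral_has_vector_derivative fct)
        (use t in auto)
    then have "((\<lambda>t. x0 + integral {0..t} (\<lambda>s. f s (\<psi> y s))) has_vector_derivative f t (\<psi> y t)) (at t within {0..})"
      using at_within_atLeastAtMost_eq[of t "t + 1"] t by simp
    then show "(\<psi> y has_vector_derivative f t (\<psi> y t)) (at t within {0..})"
      by (rule has_vector_derivative_transform[rotated 2]) (use t \<psi>y in auto)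
  qed
qed

section \<open>Bounded families of linear feedback maps\<close>

definition bounded_linear_family :: "(real \<Rightarrow> 'a::real_normed_vector \<Rightarrow> 'b::real_normed_vector) \<Rightarrow> bool"
  where "bounded_linear_family F \<longleftrightarrow> (\<forall>t\<ge>0. linear (F t)) \<and>
    (\<exists>L. \<forall>t\<ge>0. \<forall>s. norm (F t s) \<le> L * norm s) \<and> (\<forall>s. continuous_on {0..} (\<lambda>t. F t s))"

lemma bounded_linear_familyE:
  assumes "bounded_linear_family G"
  obtains L where "L \<ge> 0" "\<And>t s. t \<ge> 0 \<Longrightarrow> norm (G t s) \<le> L * norm s"
proof -
  obtain L where L: "\<And>t s. t \<ge> 0 \<Longrightarrow> norm (G t s) \<le> L * norm s"
    using assms unfolding bounded_linear_family_def by blast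
  have "norm (G t s) \<le> max L 0 * norm s" if "t \<ge> 0" for t s
    using L[OF that, of s] by (rule order_trans) (auto intro: mult_right_mono)
  then show thesis
    using that[of "max L 0"] by auto
qed

lemma bounded_linear_familyI:
  assumes "\<And>t. t \<ge> 0 \<Longrightarrow> linear (F t)" "\<And>t s. t \<ge> 0 \<Longrightarrow> norm (F t s) \<le> L * norm s"
    "\<And>s. continuous_on {0..} (\<lambda>t. F t s)"
  shows "bounded_linear_family F"
  using assms unfolding bounded_linear_family_def by blast

lemma bounded_linear_family_compose:
  assumes "bounded_linear_family F" and "continuous_on {0..} s"
  shows "continuous_on {0..} (\<lambda>t. F t (s t))"
proof -
  obtain L where L: "\<And>t s. t \<ge> 0 \<Longrightarrow> norm (F t s) \<le> L * norm s"
    using assms(1) unfolding bounded_linear_family_def by blast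
  show ?thesis
    by (rule continuous_on_lipschitz_compose[where L = L])
      (use assms L in \<open>auto simp: bounded_linear_family_def simp flip: linear_diff\<close>)
qed

lemma bounded_bilinear_cross3: "bounded_bilinear (\<times>)"
  using bilinear_cross by (simp add: bilinear_conv_bounded_bilinear)

lemma bounded_linear_family_const: "bounded_linear f \<Longrightarrow> bounded_linear_family (\<lambda>t. f)"
  by (rule bounded_linear_familyI[where L = "onorm f"])
    (auto intro: bounded_linear.linear onorm)

lemma bounded_linear_family_add:
  assumes F: "bounded_linear_family F" and G: "bounded_linear_family G"
  shows "bounded_linear_family (\<lambda>t s. F t s + G t s)"
proof -
  obtain L where L: "L \<ge> 0" "\<And>t s. t \<ge> 0 \<Longrightarrow> norm (F t s) \<le> L * norm s"
    using F by (rule bounded_linear_familyE) blast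
  obtain M where M: "M \<ge> 0" "\<And>t s. t \<ge> 0 \<Longrightarrow> norm (G t s) \<le> M * norm s"
    using G by (rule bounded_linear_familyE) blast
  show ?thesis
  proof (rule bounded_linear_familyI)
    show "norm (F t s + G t s) \<le> (L + M) * norm s" if "t \<ge> 0" for t s
      using norm_triangle_ineq[of "F t s" "G t s"] L(2)[OF that, of s] M(2)[OF that, of s]
      by (simp add: distrib_right)
  qed (use F G in \<open>auto simp: bounded_linear_family_def intro!: linear_compose_add continuous_intros\<close>)
qed

lemma bounded_linear_family_linear:
  assumes f: "bounded_linear f" and G: "bounded_linear_family G"
  shows "bounded_linear_family (\<lambda>t s. f (G t s))"
proof -
  obtain L where L: "L \<ge> 0" "\<And>t s. t \<ge> 0 \<Longrightarrow> norm (G t s) \<le> L * norm s"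
    using G by (rule bounded_linear_familyE) blast
  show ?thesis
  proof (rule bounded_linear_familyI)
    show "norm (f (G t s)) \<le> (onorm f * L) * norm s" if "t \<ge> 0" for t s
      using order_trans[OF onorm[OF f] mult_left_mono[OF L(2)[OF that] onorm_pos_le[OF f]]]
      by (simp add: mult.assoc)
    show "linear (\<lambda>s. f (G t s))" if "t \<ge> 0" for t
      using linear_compose[of "G t" f] G f that
      by (auto simp: bounded_linear_family_def o_def bounded_linear.linear)
    show "continuous_on {0..} (\<lambda>t. f (G t s))" for s
      using G by (auto simp: bounded_linear_family_def intro: bounded_linear.continuous_on[OF f])
  qed
qed

lemma bounded_linear_family_minus:
  "bounded_linear_family G \<Longrightarrow> bounded_linear_family (\<lambda>t s. - G t s)"
  by (rule bounded_linear_family_linear[where f = uminus])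
    (simp add: bounded_linear_minus bounded_linear_ident)

lemma bounded_linear_family_diff:
  "bounded_linear_family F \<Longrightarrow> bounded_linear_family G \<Longrightarrow> bounded_linear_family (\<lambda>t s. F t s - G t s)"
  using bounded_linear_family_add[of F "\<lambda>t s. - G t s"] bounded_linear_family_minus[of G] by simp

lemma bounded_linear_family_scaleR:
  "bounded_linear_family G \<Longrightarrow> bounded_linear_family (\<lambda>t s. c *\<^sub>R G t s)"
  by (rule bounded_linear_family_linear[OF bounded_linear_scaleR_right])

lemma bounded_linear_family_matrix:
  "bounded_linear_family G \<Longrightarrow> bounded_linear_family (\<lambda>t s. K *v G t s)" for K :: "real^3^3"
  by (rule bounded_linear_family_linear[OF matrix_vector_mul_bounded_linear])

lemma bounded_linear_family_cross:
  assumes G: "bounded_linear_family G" and a: "continuous_on {0..} a" "bounded (a ` {0..})"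
  shows "bounded_linear_family (\<lambda>t s. G t s \<times> a t)"
proof -
  obtain L where L: "L \<ge> 0" "\<And>t s. t \<ge> 0 \<Longrightarrow> norm (G t s) \<le> L * norm s"
    using G by (rule bounded_linear_familyE) blast
  obtain B where B: "\<And>t. t \<ge> 0 \<Longrightarrow> norm (a t) \<le> B"
    using a(2) by (auto simp: bounded_iff)
  obtain k where k: "k > 0" "\<And>x y. norm (x \<times> y) \<le> norm x * norm y * k"
    using bounded_bilinear.pos_bounded[OF bounded_bilinear_cross3] by blast
  show ?thesis
  proof (rule bounded_linear_familyI)
    show "norm (G t s \<times> a t) \<le> (L * B * k) * norm s" if "t \<ge> 0" for t s
    proof -
      have "norm (G t s) * norm (a t) * k \<le> (L * norm s) * B * k"
        using L(2)[OF that] B[OF that] L(1) k(1) by (intro mult_mono mult_right_mono) auto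
      then show ?thesis
        using k(2)[of "G t s" "a t"] by (simp add: algebra_simps)
    qed
    show "linear (\<lambda>s. G t s \<times> a t)" if "t \<ge> 0" for t
    proof (rule linearI)
      have G: "linear (G t)"
        using G that by (simp add: bounded_linear_family_def)
      show "G t (s + s') \<times> a t = G t s \<times> a t + G t s' \<times> a t" for s s'
        by (simp add: linear_add[OF G] cross_add_left)
      show "G t (r *\<^sub>R s) \<times> a t = r *\<^sub>R (G t s \<times> a t)" for r s
        by (simp add: linear_cmul[OF G] cross_mult_left)
    qed
    show "continuous_on {0..} (\<lambda>t. G t s \<times> a t)" for s
      using G a(1) by (auto simp: bounded_linear_family_def intro: bounded_bilinear.continuous_on[OF bounded_bilinear_cross3])
  qed
qed

lemmas bounded_linear_family_intros =
  bounded_linear_family_diff bounded_linear_family_add bounded_linear_family_minus bounded_linear_family_scaleR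
  bounded_linear_family_matrix bounded_linear_family_cross

lemma bounded_linear_family_components:
  "bounded_linear_family (\<lambda>t. fst)" "bounded_linear_family (\<lambda>t s. fst (snd s))" "bounded_linear_family (\<lambda>t s. snd (snd s))"
  by (auto intro!: bounded_linear_family_const bounded_linear_fst bounded_linear_compose[OF bounded_linear_fst bounded_linear_snd]
      bounded_linear_compose[OF bounded_linear_snd bounded_linear_snd])

section \<open>The closed loop with truncated rate\<close>

text \<open>
  The radial retraction onto the ball of radius \<open>\<rho>\<close>. It rescales its argument, so that truncated factors in
  \<open>R hat \<Omega>\<close> still yield a right-hand side of the form \<open>R hat v\<close>, tangent to the rotation group.
\<close>

definition truncate :: "real \<Rightarrow> 'a::real_normed_vector \<Rightarrow> 'a"
  where "truncate \<rho> v = (\<rho> / max \<rho> (norm v)) *\<^sub>R v"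

lemma truncate_eq_self: "\<rho> > 0 \<Longrightarrow> norm v \<le> \<rho> \<Longrightarrow> truncate \<rho> v = v"
  by (simp add: truncate_def max_def)

lemma norm_truncate_le: "\<rho> > 0 \<Longrightarrow> norm (truncate \<rho> v) \<le> \<rho>"
  by (auto simp: truncate_def max_def field_simps)

lemma truncate_lipschitz:
  assumes \<rho>: "\<rho> > 0"
  shows "norm (truncate \<rho> v - truncate \<rho> w) \<le> 2 * norm (v - w)"
proof -
  define m where "m u = max \<rho> (norm u)" for u :: 'a
  have m: "\<rho> \<le> m u" "norm u \<le> m u" "m u > 0" for u
    using \<rho> by (auto simp: m_def)
  have "truncate \<rho> v - truncate \<rho> w = (\<rho> / m v) *\<^sub>R (v - w) + (\<rho> / m v - \<rho> / m w) *\<^sub>R w"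
    by (simp add: truncate_def m_def algebra_simps)
  also have "norm \<dots> \<le> norm ((\<rho> / m v) *\<^sub>R (v - w)) + norm ((\<rho> / m v - \<rho> / m w) *\<^sub>R w)"
    by (rule norm_triangle_ineq)
  also have "norm ((\<rho> / m v) *\<^sub>R (v - w)) \<le> 1 * norm (v - w)"
    unfolding norm_scaleR using \<rho> m[of v] by (intro mult_right_mono) auto
  also have "norm ((\<rho> / m v - \<rho> / m w) *\<^sub>R w) \<le> 1 * norm (v - w)"
  proof -
    have "\<rho> / m v - \<rho> / m w = (\<rho> / m v) * ((m w - m v) / m w)"
      using m(3)[of v] m(3)[of w] by (simp add: field_simps)
    then have "norm ((\<rho> / m v - \<rho> / m w) *\<^sub>R w) = (\<rho> / m v) * (\<bar>m w - m v\<bar> * (norm w / m w))"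
      using \<rho> m(3)[of v] m(3)[of w] by (simp add: abs_mult)
    also have "\<dots> \<le> 1 * (\<bar>m w - m v\<bar> * 1)"
      using \<rho> m by (intro mult_mono) (auto simp: divide_le_eq intro!: divide_nonneg_nonneg mult_nonneg_nonneg less_imp_le[OF m(3)])
    also have "\<bar>m w - m v\<bar> \<le> \<bar>norm v - norm w\<bar>"
      by (auto simp: m_def)
    also have "\<dots> \<le> norm (v - w)"
      by (rule norm_triangle_ineq3)
    finally show ?thesis by simp
  qed
  finally show ?thesis by simp
qed

lemma truncated_product_lipschitz:
  assumes \<rho>: "\<rho> > 0"
  obtains L where "L \<ge> 0" "\<And>(Q :: real^3^3) Q' w w'. norm (truncate 3 Q ** hat (truncate \<rho> w) - truncate 3 Q' ** hat (truncate \<rho> w'))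
    \<le> L * (norm (Q - Q') + norm (w - w'))"
proof -
  obtain h where h: "h > 0" "\<And>w. norm (hat w) \<le> h * norm w"
    using linear_bounded_pos[OF linear_hat] by blast
  obtain m where m: "m > 0" "\<And>A B. norm ((A :: real^3^3) ** (B :: real^3^3)) \<le> norm A * norm B * m"
    using matrix_mult_norm_bound by metis
  define L where "L = 2 * (h * \<rho>) * m + 3 * (h * 2) * m"
  have L: "2 * (h * \<rho>) * m \<le> L" "3 * (h * 2) * m \<le> L" "L \<ge> 0"
    using h m \<rho> by (auto simp: L_def)
  have "norm (truncate 3 Q ** hat (truncate \<rho> w) - truncate 3 Q' ** hat (truncate \<rho> w'))
    \<le> L * (norm (Q - Q') + norm (w - w'))" for Q Q' :: "real^3^3" and w w'
  proof -
    have "norm (truncate 3 Q ** hat (truncate \<rho> w) - truncate 3 Q' ** hat (truncate \<rho> w'))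
      = norm ((truncate 3 Q - truncate 3 Q') ** hat (truncate \<rho> w) + truncate 3 Q' ** hat (truncate \<rho> w - truncate \<rho> w'))"
      by (simp add: linear_diff[OF linear_hat] bounded_bilinear.diff_left[OF bounded_bilinear_matrix_mult]
          bounded_bilinear.diff_right[OF bounded_bilinear_matrix_mult])
    also have "\<dots> \<le> norm (truncate 3 Q - truncate 3 Q') * norm (hat (truncate \<rho> w)) * m
        + norm (truncate 3 Q') * norm (hat (truncate \<rho> w - truncate \<rho> w')) * m"
      by (intro order_trans[OF norm_triangle_ineq] add_mono m(2))
    also have "\<dots> \<le> (2 * norm (Q - Q')) * (h * \<rho>) * m + 3 * (h * (2 * norm (w - w'))) * m"
    proof -
      have "norm (hat (truncate \<rho> w)) \<le> h * \<rho>"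
        using h(2)[of "truncate \<rho> w"] mult_left_mono[OF norm_truncate_le[OF \<rho>], of h w] h(1) by linarith
      moreover have "norm (hat (truncate \<rho> w - truncate \<rho> w')) \<le> h * (2 * norm (w - w'))"
        using h(2)[of "truncate \<rho> w - truncate \<rho> w'"] mult_left_mono[OF truncate_lipschitz[OF \<rho>], of h w w'] h(1)
        by linarith
      ultimately show ?thesis
        using m(1) h(1) \<rho> truncate_lipschitz[of 3 Q Q'] norm_truncate_le[of 3 Q']
        by (intro add_mono mult_mono mult_right_mono) auto
    qed
    also have "\<dots> = 2 * (h * \<rho>) * m * norm (Q - Q') + 3 * (h * 2) * m * norm (w - w')"
      by (simp add: algebra_simps)
    also have "\<dots> \<le> L * norm (Q - Q') + L * norm (w - w')"
      using L by (intro add_mono mult_right_mono) auto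
    finally show ?thesis
      by (simp add: distrib_left)
  qed
  then show thesis
    using that L(3) by blast
qed

lemma axial_frame_bound:
  obtains K where "K \<ge> 0" "\<And>Q A. rotation_matrix Q \<Longrightarrow> norm (axial (transpose Q ** A)) \<le> K * norm A"
proof -
  obtain a where a: "a > 0" "\<And>A. norm (axial A) \<le> a * norm A"
    using linear_bounded_pos[OF linear_axial] by blast
  obtain m where m: "m > 0" "\<And>A B. norm ((A :: real^3^3) ** (B :: real^3^3)) \<le> norm A * norm B * m"
    using matrix_mult_norm_bound by metis
  have "norm (axial (transpose Q ** A)) \<le> (a * (3 * m)) * norm A" if "rotation_matrix Q" for Q A
  proof -
    have "rotation_matrix (transpose Q)"
      using that by (simp add: rotation_matrix_def orthogonal_matrix_transpose det_transpose)
    then have "norm (transpose Q) * norm A * m \<le> 3 * norm A * m"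
      using m(1) rotation_matrix_norm_le by (intro mult_right_mono) auto
    then have "norm (transpose Q ** A) \<le> 3 * norm A * m"
      using m(2)[of "transpose Q" A] by linarith
    then have "a * norm (transpose Q ** A) \<le> a * (3 * norm A * m)"
      using a(1) by (intro mult_left_mono) auto
    then show ?thesis
      using a(2)[of "transpose Q ** A"] by (simp add: algebra_simps)
  qed
  then show thesis
    using that[of "a * (3 * m)"] a m by simp
qed

lemma continuous_on_det_3:
  fixes R :: "real \<Rightarrow> real^3^3"
  assumes "continuous_on S R"
  shows "continuous_on S (\<lambda>t. det (R t))"
  unfolding det_3 by (intro continuous_intros assms)

text \<open>
  \<open>R R\<^sup>T\<close> has derivative \<open>R (hat v + (hat v)\<^sup>T) R\<^sup>T = 0\<close>, and by continuity the determinant cannot jump from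
  \<open>1\<close> to \<open>-1\<close>.
\<close>

lemma rotation_matrix_invariant:
  fixes R :: "real \<Rightarrow> real^3^3"
  assumes R: "\<And>t. t \<ge> 0 \<Longrightarrow> (R has_vector_derivative R t ** hat (v t)) (at t within {0..})"
    and R0: "rotation_matrix (R 0)" and t: "t \<ge> 0"
  shows "rotation_matrix (R t)"
proof -
  have "((\<lambda>t. R t ** transpose (R t)) has_vector_derivative 0) (at t within {0..})" if "t \<in> {0..}" for t
  proof -
    have "((\<lambda>t. transpose (R t)) has_vector_derivative transpose (R t ** hat (v t))) (at t within {0..})"
      using bounded_linear.has_vector_derivative[OF linear_conv_bounded_linear[THEN iffD1, OF linear_transpose] R] that
      by auto
    from has_vector_derivative_matrix_mult[OF R this] that
    have "((\<lambda>t. R t ** transpose (R t)) has_vector_derivative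
        R t ** transpose (R t ** hat (v t)) + R t ** hat (v t) ** transpose (R t)) (at t within {0..})"
      by simp
    moreover have "R t ** transpose (R t ** hat (v t)) + R t ** hat (v t) ** transpose (R t) = 0"
      by (simp add: matrix_transpose_mul transpose_hat matrix_mul_assoc
          bounded_bilinear.minus_left[OF bounded_bilinear_matrix_mult]
          bounded_bilinear.minus_right[OF bounded_bilinear_matrix_mult])
    ultimately show ?thesis by simp
  qed
  then obtain c where c: "\<And>t. t \<in> {0..} \<Longrightarrow> R t ** transpose (R t) = c"
    using has_vector_derivative_zero_constant[of "{0..}" "\<lambda>t. R t ** transpose (R t)"] by auto
  have "c = mat 1"
    using c[of 0] R0 by (simp add: rotation_matrix_def orthogonal_matrix_def)
  then have orth: "orthogonal_matrix (R s)" if "s \<ge> 0" for s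
    using c[of s] that by (simp add: orthogonal_matrix_def matrix_left_right_inverse)
  have cont: "continuous_on {0..} R"
    using R by (auto simp: continuous_on_eq_continuous_within intro: has_vector_derivative_continuous)
  have "det (R t) = 1"
  proof (rule ccontr)
    assume "det (R t) \<noteq> 1"
    then have "det (R t) = -1"
      using det_orthogonal_matrix[OF orth[OF t]] by blast
    then have "\<exists>s\<ge>0. s \<le> t \<and> det (R s) = 0"
      using R0 t continuous_on_subset[OF continuous_on_det_3[OF cont], of "{0..t}"]
      by (intro IVT2') (auto simp: rotation_matrix_def)
    then show False
      using det_orthogonal_matrix orth by fastforce
  qed
  then show ?thesis
    using orth[OF t] by (simp add: rotation_matrix_def)
qed

text \<open>
  Truncating both factors of \<open>R hat \<Omega>\<close> makes the closed loop globally Lipschitz, uniformly in time, since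
  everything else is linear with bounded coefficients. The truncation of \<open>R\<close> at radius \<open>3\<close> disappears afterwards:
  the solution stays in the rotation group, whose elements have norm at most \<open>3\<close>.
\<close>

lemma truncated_closed_loop_solution:
  assumes traj: "rigid_body_trajectory R0 \<Omega>0 u0"
    and B: "\<And>t. t \<ge> 0 \<Longrightarrow> norm (\<Omega>0 t) \<le> B" "\<And>t. t \<ge> 0 \<Longrightarrow> norm (u0 t) \<le> B"
    and u0: "continuous_on {0..} u0"
    and F: "bounded_linear_family F"
    and \<rho>: "\<rho> > 0" and R1: "rotation_matrix R1"
  shows "\<exists>R \<Omega> x. R 0 = R1 \<and> \<Omega> 0 = \<Omega>1 \<and> x 0 = 0 \<and>
    (\<forall>t\<ge>0. rotation_matrix (R t) \<and>
      (R has_vector_derivative R t ** hat (truncate \<rho> (\<Omega> t))) (at t within {0..}) \<and>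
      (\<Omega> has_vector_derivative u0 t + F t (att_err R0 R t, \<Omega> t - \<Omega>0 t, x t)) (at t within {0..}) \<and>
      (x has_vector_derivative att_err R0 R t) (at t within {0..}))"
proof -
  obtain LF where LF: "\<And>t s. t \<ge> 0 \<Longrightarrow> norm (F t s) \<le> LF * norm s" "LF \<ge> 0"
    using F by (rule bounded_linear_familyE) blast
  have linF: "linear (F t)" if "t \<ge> 0" for t
    using F that by (auto simp: bounded_linear_family_def)
  obtain L where L: "L \<ge> 0" "\<And>(Q :: real^3^3) Q' w w'. norm (truncate 3 Q ** hat (truncate \<rho> w) - truncate 3 Q' ** hat (truncate \<rho> w'))
      \<le> L * (norm (Q - Q') + norm (w - w'))"
    using truncated_product_lipschitz[OF \<rho>] by blast
  obtain K where K: "K \<ge> 0" "\<And>Q A. rotation_matrix Q \<Longrightarrow> norm (axial (transpose Q ** A)) \<le> K * norm A"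
    using axial_frame_bound by blast
  have rot0: "rotation_matrix (R0 t)" if "t \<ge> 0" for t
    using traj that by (simp add: rigid_body_trajectory_def)
  have cR0: "continuous_on {0..} R0" and c\<Omega>0: "continuous_on {0..} \<Omega>0"
    using traj unfolding rigid_body_trajectory_def continuous_on_eq_continuous_within
    by (auto intro: has_vector_derivative_continuous)
  have B0: "B \<ge> 0"
    using order_trans[OF norm_ge_zero B(1)[of 0]] by simp
  define Z where "Z t Q = axial (transpose (R0 t) ** Q)" for t Q
  have Zdiff: "Z t Q - Z t Q' = Z t (Q - Q')" for t Q Q'
    by (simp add: Z_def linear_diff[OF linear_axial] bounded_bilinear.diff_right[OF bounded_bilinear_matrix_mult])
  have Zb: "norm (Z t Q) \<le> K * norm Q" if "t \<ge> 0" for t Q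
    using K(2)[OF rot0[OF that]] by (simp add: Z_def)
  have Zc: "continuous_on {0..} (\<lambda>t. Z t Q)" for Q
  proof -
    have "continuous_on {0..} (\<lambda>t. transpose (R0 t))"
      using bounded_linear.continuous_on[OF linear_conv_bounded_linear[THEN iffD1, OF linear_transpose] cR0] .
    then have "continuous_on {0..} (\<lambda>t. transpose (R0 t) ** Q)"
      by (rule bounded_bilinear.continuous_on[OF bounded_bilinear_matrix_mult]) (rule continuous_on_const)
    then show ?thesis
      unfolding Z_def
      by (rule bounded_linear.continuous_on[OF linear_conv_bounded_linear[THEN iffD1, OF linear_axial]])
  qed
  define f where "f t s = (case s of (Q, w, x) \<Rightarrow>
    (truncate 3 Q ** hat (truncate \<rho> w), u0 t + F t (Z t Q, w - \<Omega>0 t, x), Z t Q))" for t s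
  have "\<exists>\<phi>. \<phi> 0 = (R1, \<Omega>1, 0) \<and> (\<forall>t\<ge>0. (\<phi> has_vector_derivative f t (\<phi> t)) (at t within {0..}))"
  proof (rule lipschitz_ode_global_solution)
    show "continuous_on {0..} (\<lambda>t. f t s)" for s
      unfolding f_def case_prod_unfold
      by (intro continuous_intros u0 Zc c\<Omega>0 bounded_linear_family_compose[OF F])
    show "norm (f t 0) \<le> B + LF * B" if t: "t \<ge> 0" for t
    proof -
      have "f t 0 = (0, u0 t + F t (0, - \<Omega>0 t, 0), 0)"
        by (simp add: f_def zero_prod_def truncate_def Z_def linear_0[OF linear_axial])
      then have "norm (f t 0) \<le> norm (u0 t) + norm (F t (0, - \<Omega>0 t, 0))"
        by (simp add: norm_Pair norm_triangle_ineq)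
      also have "norm (F t (0, - \<Omega>0 t, 0)) \<le> LF * norm (\<Omega>0 t)"
        using LF(1)[OF t, of "(0, - \<Omega>0 t, 0)"] by (simp add: norm_Pair)
      also have "\<dots> \<le> LF * B"
        using B(1)[OF t] LF(2) by (rule mult_left_mono)
      finally show ?thesis
        using B(2)[OF t] by simp
    qed
    show "norm (f t s - f t s') \<le> (2 * L + LF * (K + 2) + K) * norm (s - s')" if t: "t \<ge> 0" for t s s'
    proof -
      obtain Q w x where s: "s = (Q, w, x)"
        by (cases s)
      obtain Q' w' x' where s': "s' = (Q', w', x')"
        by (cases s')
      define n where "n = norm (s - s')"
      have n: "norm (Q - Q') \<le> n" "norm (w - w') \<le> n" "norm (x - x') \<le> n"
      proof -
        have n_Pair: "n = norm (Q - Q', w - w', x - x')"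
          by (simp add: n_def s s')
        show "norm (Q - Q') \<le> n"
          unfolding n_Pair by (rule norm_fst_le)
        have "norm (w - w', x - x') \<le> n"
          unfolding n_Pair by (rule norm_snd_le)
        then show "norm (w - w') \<le> n" "norm (x - x') \<le> n"
          using norm_fst_le[of "w - w'" "x - x'"] norm_snd_le[of "x - x'" "w - w'"] by linarith+
      qed
      have ZQ: "norm (Z t Q - Z t Q') \<le> K * n"
        using Zb[OF t, of "Q - Q'"] mult_left_mono[OF n(1) K(1)] by (simp add: Zdiff)
      have "norm (f t s - f t s') \<le> norm (truncate 3 Q ** hat (truncate \<rho> w) - truncate 3 Q' ** hat (truncate \<rho> w'))
          + (norm (F t (Z t Q, w - \<Omega>0 t, x) - F t (Z t Q', w' - \<Omega>0 t, x')) + norm (Z t Q - Z t Q'))"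
        unfolding s s' f_def prod.case diff_Pair
        by (intro order_trans[OF norm_Pair_le] add_mono order_refl) simp
      also have "F t (Z t Q, w - \<Omega>0 t, x) - F t (Z t Q', w' - \<Omega>0 t, x') = F t (Z t Q - Z t Q', w - w', x - x')"
        by (simp flip: linear_diff[OF linF[OF t]])
      also have "norm \<dots> \<le> LF * (K * n + (n + n))"
      proof -
        have "norm (Z t Q - Z t Q', w - w', x - x') \<le> K * n + (n + n)"
          using ZQ n by (intro order_trans[OF norm_Pair_le] add_mono)
        then show ?thesis
          using LF(1)[OF t, of "(Z t Q - Z t Q', w - w', x - x')"] LF(2) by (meson mult_left_mono order_trans)
      qed
      also have "norm (truncate 3 Q ** hat (truncate \<rho> w) - truncate 3 Q' ** hat (truncate \<rho> w')) \<le> L * (n + n)"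
        by (intro order_trans[OF L(2)] mult_left_mono add_mono n L(1))
      also note ZQ
      finally show ?thesis
        by (simp add: n_def algebra_simps)
    qed
  qed
  then obtain \<phi> where \<phi>: "\<phi> 0 = (R1, \<Omega>1, 0)"
    "\<And>t. t \<ge> 0 \<Longrightarrow> (\<phi> has_vector_derivative f t (\<phi> t)) (at t within {0..})"
    by blast
  define R \<Omega> x where "R t = fst (\<phi> t)" and "\<Omega> t = fst (snd (\<phi> t))" and "x t = snd (snd (\<phi> t))" for t
  have der: "(R has_vector_derivative truncate 3 (R t) ** hat (truncate \<rho> (\<Omega> t))) (at t within {0..})"
    "(\<Omega> has_vector_derivative u0 t + F t (att_err R0 R t, \<Omega> t - \<Omega>0 t, x t)) (at t within {0..})"
    "(x has_vector_derivative att_err R0 R t) (at t within {0..})" if t: "t \<ge> 0" for t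
  proof -
    have f: "fst (f t (\<phi> t)) = truncate 3 (R t) ** hat (truncate \<rho> (\<Omega> t))"
      "fst (snd (f t (\<phi> t))) = u0 t + F t (att_err R0 R t, \<Omega> t - \<Omega>0 t, x t)"
      "snd (snd (f t (\<phi> t))) = att_err R0 R t"
      by (simp_all add: f_def case_prod_unfold R_def \<Omega>_def x_def Z_def att_err_eq_axial)
    note fs = bounded_linear.has_vector_derivative[OF bounded_linear_fst]
      and sn = bounded_linear.has_vector_derivative[OF bounded_linear_snd]
    show "(R has_vector_derivative truncate 3 (R t) ** hat (truncate \<rho> (\<Omega> t))) (at t within {0..})"
      using fs[OF \<phi>(2)[OF t]] unfolding f R_def[abs_def, symmetric] .
    show "(\<Omega> has_vector_derivative u0 t + F t (att_err R0 R t, \<Omega> t - \<Omega>0 t, x t)) (at t within {0..})"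
      using fs[OF sn[OF \<phi>(2)[OF t]]] unfolding f \<Omega>_def[abs_def, symmetric] .
    show "(x has_vector_derivative att_err R0 R t) (at t within {0..})"
      using sn[OF sn[OF \<phi>(2)[OF t]]] unfolding f x_def[abs_def, symmetric] .
  qed
  have init: "R 0 = R1" "\<Omega> 0 = \<Omega>1" "x 0 = 0"
    using \<phi>(1) by (simp_all add: R_def \<Omega>_def x_def)
  define v where "v t = (3 / max 3 (norm (R t))) *\<^sub>R truncate \<rho> (\<Omega> t)" for t
  have "truncate 3 (R t) ** hat (truncate \<rho> (\<Omega> t)) = R t ** hat (v t)" for t
    unfolding v_def truncate_def[of 3] linear_cmul[OF linear_hat]
      bounded_bilinear.scaleR_left[OF bounded_bilinear_matrix_mult]
      bounded_bilinear.scaleR_right[OF bounded_bilinear_matrix_mult] ..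
  then have rot: "rotation_matrix (R t)" if "t \<ge> 0" for t
    using rotation_matrix_invariant[of R v] der(1) init(1) R1 that by simp
  then have "truncate 3 (R t) = R t" if "t \<ge> 0" for t
    using that by (intro truncate_eq_self rotation_matrix_norm_le) auto
  then have "(R has_vector_derivative R t ** hat (truncate \<rho> (\<Omega> t))) (at t within {0..})" if "t \<ge> 0" for t
    using der(1)[OF that] that by simp
  note sol = rot this der(2,3)
  show ?thesis
    by (rule exI[of _ R], rule exI[of _ \<Omega>], rule exI[of _ x])
      (intro conjI allI impI init sol; assumption)
qed

section \<open>A Lyapunov criterion for exponential tracking\<close>

lemma exponential_decay:
  fixes V :: "real \<Rightarrow> real"
  assumes T: "0 \<le> T"
    and V: "\<And>t. t \<in> {0..T} \<Longrightarrow> \<exists>D. (V has_real_derivative D) (at t within {0..}) \<and> D \<le> - k * V t"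
  shows "V T \<le> V 0 * exp (- k * T)"
proof (cases "T = 0")
  case False
  define g where "g t = exp (k * t) * V t" for t
  obtain D where D: "\<And>t. t \<in> {0..T} \<Longrightarrow> (V has_real_derivative D t) (at t within {0..})"
    "\<And>t. t \<in> {0..T} \<Longrightarrow> D t \<le> - k * V t"
    using V by metis
  have g: "(g has_real_derivative exp (k * t) * (D t + k * V t)) (at t within {0..T})" if "t \<in> {0..T}" for t
  proof -
    have "(V has_real_derivative D t) (at t within {0..T})"
      using D(1)[OF that] by (rule DERIV_subset) auto
    then show ?thesis
      unfolding g_def by (auto intro!: derivative_eq_intros simp: algebra_simps)
  qed
  then obtain \<xi> where \<xi>: "\<xi> \<in> {0<..<T}" "g T - g 0 = (exp (k * \<xi>) * (D \<xi> + k * V \<xi>)) * (T - 0)"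
    using mvt_simple[of 0 T g "\<lambda>t. (*) (exp (k * t) * (D t + k * V t))"] T False
    by (force simp: has_field_derivative_def)
  have "(exp (k * \<xi>) * (D \<xi> + k * V \<xi>)) * (T - 0) \<le> 0"
    using D(2)[of \<xi>] \<xi>(1) by (intro mult_nonpos_nonneg mult_nonneg_nonpos) auto
  then have "exp (k * T) * V T \<le> V 0"
    using \<xi>(2) by (simp add: g_def)
  then have "exp (- k * T) * (exp (k * T) * V T) \<le> exp (- k * T) * V 0"
    by (rule mult_left_mono) simp
  also have "exp (- k * T) * (exp (k * T) * V T) = V T"
    by (simp flip: mult.assoc exp_add)
  finally show ?thesis
    by (simp only: mult.commute[of "V 0"])
qed simp

text \<open>
  A continuity argument: at the first time where \<open>h\<close> reaches \<open>r\<close>, the bound \<open>h \<le> r\<close> holds up to that time, and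
  \<open>trap\<close> gives a contradiction.
\<close>

lemma trapped_below:
  fixes h :: "real \<Rightarrow> real"
  assumes cont: "continuous_on {0..} h" and h0: "h 0 < r"
    and trap: "\<And>T. 0 \<le> T \<Longrightarrow> (\<And>t. t \<in> {0..T} \<Longrightarrow> h t \<le> r) \<Longrightarrow> h T < r"
    and t: "0 \<le> t"
  shows "h t < r"
proof (rule ccontr)
  assume "\<not> h t < r"
  have hits: "\<exists>s\<in>{0..t'}. h s = r" if "0 \<le> t'" "r \<le> h t'" for t'
  proof -
    have "continuous_on {0..t'} h"
      using cont by (rule continuous_on_subset) auto
    then have "\<exists>s\<ge>0. s \<le> t' \<and> h s = r"
      using that h0 by (intro IVT') auto
    then show ?thesis by auto
  qed
  define S where "S = {s \<in> {0..t}. h s = r}"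
  have "compact S"
  proof -
    have "closed S"
      unfolding S_def
      by (rule continuous_closed_preimage_constant) (auto intro: continuous_on_subset[OF cont])
    moreover have "bounded S"
      unfolding S_def by (rule bounded_subset[of "{0..t}"]) auto
    ultimately show ?thesis
      by (simp add: compact_eq_bounded_closed)
  qed
  moreover have "S \<noteq> {}"
    using hits[of t] t \<open>\<not> h t < r\<close> by (auto simp: S_def)
  ultimately obtain T where T: "T \<in> S" "\<And>s. s \<in> S \<Longrightarrow> T \<le> s"
    using compact_attains_inf[of S] by auto
  have "h s \<le> r" if s: "s \<in> {0..T}" for s
  proof (rule ccontr)
    assume "\<not> h s \<le> r"
    then obtain s' where "s' \<in> {0..s}" "h s' = r"
      using hits[of s] s by auto
    then have "s' \<in> S"
      using s T(1) by (auto simp: S_def)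
    then have "s' = s"
      using T(2)[of s'] \<open>s' \<in> {0..s}\<close> s by auto
    then show False
      using \<open>\<not> h s \<le> r\<close> \<open>h s' = r\<close> by simp
  qed
  then have "h T < r"
    using T(1) by (intro trap) (auto simp: S_def)
  then show False
    using T(1) by (simp add: S_def)
qed

text \<open>
  The estimate demanded from a Lyapunov function \<open>V\<close>, in terms of arbitrary differentiable curves. The vector \<open>\<rho>\<close>
  is the deviation of \<open>z'\<close> at time \<open>t\<close> from the linear error system; for the closed loop it is the
  remainder of the attitude error equation.
\<close>

definition dissipation_inequality ::
    "(real \<Rightarrow> real^3) \<Rightarrow> (real \<Rightarrow> (real^3) \<times> (real^3) \<times> (real^3) \<Rightarrow> real^3) \<Rightarrow>
     (real \<Rightarrow> real^3 \<Rightarrow> real^3 \<Rightarrow> real^3 \<Rightarrow> real) \<Rightarrow> real \<Rightarrow> real \<Rightarrow> bool"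
  where "dissipation_inequality \<Omega>0 F V c e \<longleftrightarrow> (\<forall>z w x t \<rho>. t \<ge> 0 \<longrightarrow>
      (z has_vector_derivative z t \<times> \<Omega>0 t + w t + \<rho>) (at t within {0..}) \<longrightarrow>
      (w has_vector_derivative F t (z t, w t, x t)) (at t within {0..}) \<longrightarrow>
      (x has_vector_derivative z t) (at t within {0..}) \<longrightarrow>
      (\<exists>D. ((\<lambda>t. V t (z t) (w t) (x t)) has_real_derivative D) (at t within {0..}) \<and>
        D \<le> - c * V t (z t) (w t) (x t) + e * sqrt (V t (z t) (w t) (x t)) * norm \<rho>))"

text \<open>
  Bounds are required in \<open>z\<close> and \<open>w\<close> only, and the upper one only at time \<open>0\<close> and \<open>x = 0\<close>, which is where the
  integral starts. Controllers without integral action are thus covered by functions \<open>V\<close> that ignore \<open>x\<close>.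
\<close>

definition exponential_lyapunov ::
    "(real \<Rightarrow> real^3) \<Rightarrow> (real \<Rightarrow> (real^3) \<times> (real^3) \<times> (real^3) \<Rightarrow> real^3) \<Rightarrow>
     (real \<Rightarrow> real^3 \<Rightarrow> real^3 \<Rightarrow> real^3 \<Rightarrow> real) \<Rightarrow> bool"
  where "exponential_lyapunov \<Omega>0 F V \<longleftrightarrow>
    (\<exists>a>0. \<forall>t\<ge>0. \<forall>z w x. a * ((norm z)\<^sup>2 + (norm w)\<^sup>2) \<le> V t z w x) \<and>
    (\<exists>b. \<forall>z w. V 0 z w 0 \<le> b * ((norm z)\<^sup>2 + (norm w)\<^sup>2)) \<and>
    (\<exists>c>0. \<exists>e\<ge>0. dissipation_inequality \<Omega>0 F V c e)"

lemma sqrt_mult_le_sqrt: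
  assumes "a * p\<^sup>2 \<le> v" "0 \<le> p"
  shows "sqrt a * p \<le> sqrt v"
  using real_sqrt_le_mono[OF assms(1)] assms(2) by (simp add: real_sqrt_mult)

text \<open>
  The kinematic equation is assumed with a rate \<open>\<Omega>'\<close> that has to agree with \<open>\<Omega>\<close> only while the rate error is at
  most \<open>1\<close>. So the estimate applies to the closed loop and to its truncated version, and shows for the latter
  that the truncation is inactive.
\<close>

lemma local_exponential_estimate:
  assumes traj: "rigid_body_trajectory R0 \<Omega>0 u0" and V: "exponential_lyapunov \<Omega>0 F V"
  obtains \<delta> C \<alpha> :: real where "\<delta> > 0" "C > 0" "\<alpha> > 0"
    "\<And>R \<Omega> \<Omega>' x t. (\<And>t. t \<ge> 0 \<Longrightarrow> rotation_matrix (R t) \<and>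
        (R has_vector_derivative R t ** hat (\<Omega>' t)) (at t within {0..}) \<and>
        (norm (\<Omega> t - \<Omega>0 t) \<le> 1 \<longrightarrow> \<Omega>' t = \<Omega> t) \<and>
        (\<Omega> has_vector_derivative u0 t + F t (att_err R0 R t, \<Omega> t - \<Omega>0 t, x t)) (at t within {0..}) \<and>
        (x has_vector_derivative att_err R0 R t) (at t within {0..})) \<Longrightarrow> x 0 = 0 \<Longrightarrow>
      norm (R 0 - R0 0) + norm (\<Omega> 0 - \<Omega>0 0) < \<delta> \<Longrightarrow> t \<ge> 0 \<Longrightarrow>
      norm (R t - R0 t) + norm (\<Omega> t - \<Omega>0 t)
        \<le> C * exp (- \<alpha> * t) * (norm (R 0 - R0 0) + norm (\<Omega> 0 - \<Omega>0 0)) \<and>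
      norm (\<Omega> t - \<Omega>0 t) \<le> 1"
proof -
  obtain K d where K: "K > 0" "d > 0"
    "\<And>Q0 Q. rotation_matrix Q0 \<Longrightarrow> rotation_matrix Q \<Longrightarrow> norm (axial (transpose Q0 ** Q)) \<le> K * norm (Q - Q0)"
    "\<And>Q0 Q. rotation_matrix Q0 \<Longrightarrow> rotation_matrix Q \<Longrightarrow> norm (Q - Q0) \<le> d \<Longrightarrow>
       norm (Q - Q0) \<le> K * norm (axial (transpose Q0 ** Q))"
    "\<And>Q0 Q w. rotation_matrix Q0 \<Longrightarrow> rotation_matrix Q \<Longrightarrow>
       norm (axial (transpose Q0 ** Q ** hat w) - w) \<le> K * norm (Q - Q0) * norm w"
    by (rule attitude_error_bounds) blast
  obtain a where a: "a > 0" "\<And>t z w x. t \<ge> 0 \<Longrightarrow> a * ((norm z)\<^sup>2 + (norm w)\<^sup>2) \<le> V t z w x"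
    using V unfolding exponential_lyapunov_def by blast
  obtain b0 where b0: "\<And>z w. V 0 z w 0 \<le> b0 * ((norm z)\<^sup>2 + (norm w)\<^sup>2)"
    using V unfolding exponential_lyapunov_def by blast
  obtain c e where c: "c > 0" "e \<ge> 0" and diss: "dissipation_inequality \<Omega>0 F V c e"
    using V unfolding exponential_lyapunov_def by blast
  define b where "b = max b0 1"
  have b: "b > 0" "V 0 z w 0 \<le> b * ((norm z)\<^sup>2 + (norm w)\<^sup>2)" for z w
    using order_trans[OF b0 mult_right_mono[OF max.cobounded1]] by (auto simp: b_def)
  \<comment> \<open>For states within \<open>r\<close> the remainder costs at most half of the decay rate \<open>c\<close>.\<close>
  define r where "r = min (min d 1) (c * sqrt a / (2 * (e * K + 1)))"
  have eK: "e * K + 1 > 0"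
    using c(2) K(1) by (simp add: add_nonneg_pos)
  have r: "r > 0" "r \<le> d" "r \<le> 1" "e * K * r \<le> c / 2 * sqrt a"
  proof -
    show "r > 0" "r \<le> d" "r \<le> 1"
      using K(1,2) c(1) a(1) eK by (auto simp: r_def)
    have "e * K * r \<le> (e * K + 1) * (c * sqrt a / (2 * (e * K + 1)))"
      using c(2) K(1) \<open>r > 0\<close> by (intro mult_mono) (auto simp: r_def)
    also have "\<dots> = c / 2 * sqrt a"
      using eK by (simp add: field_simps)
    finally show "e * K * r \<le> c / 2 * sqrt a" .
  qed
  \<comment> \<open>One factor \<open>K + 1\<close> converts the initial distance into \<open>(z, w)\<close>, the other one converts back.\<close>
  define C where "C = (K + 1)\<^sup>2 * sqrt (b / a)"
  have C: "C > 0"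
    using K(1) a(1) b(1) by (simp add: C_def)
  \<comment> \<open>Small enough for the initial distance and for its later bound \<open>C * h 0\<close> to lie below \<open>r\<close>.\<close>
  define \<delta> where "\<delta> = r / (C + 1)"
  have \<delta>: "\<delta> > 0" "(C + 1) * \<delta> = r"
    using r(1) C by (simp_all add: \<delta>_def)
  define \<alpha> where "\<alpha> = c / 4"
  have \<alpha>: "\<alpha> > 0"
    using c(1) by (simp add: \<alpha>_def)
  show thesis
  proof (rule that[OF \<delta>(1) C \<alpha>])
    fix R :: "real \<Rightarrow> real^3^3" and \<Omega> \<Omega>' x :: "real \<Rightarrow> real^3" and t :: real
    assume sol: "\<And>t. t \<ge> 0 \<Longrightarrow> rotation_matrix (R t) \<and>
        (R has_vector_derivative R t ** hat (\<Omega>' t)) (at t within {0..}) \<and>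
        (norm (\<Omega> t - \<Omega>0 t) \<le> 1 \<longrightarrow> \<Omega>' t = \<Omega> t) \<and>
        (\<Omega> has_vector_derivative u0 t + F t (att_err R0 R t, \<Omega> t - \<Omega>0 t, x t)) (at t within {0..}) \<and>
        (x has_vector_derivative att_err R0 R t) (at t within {0..})"
      and x0: "x 0 = 0" and init: "norm (R 0 - R0 0) + norm (\<Omega> 0 - \<Omega>0 0) < \<delta>" and t: "t \<ge> 0"
    have ref: "rotation_matrix (R0 t)" "(R0 has_vector_derivative R0 t ** hat (\<Omega>0 t)) (at t within {0..})"
      "(\<Omega>0 has_vector_derivative u0 t) (at t within {0..})" if "t \<ge> 0" for t
      using traj that by (auto simp: rigid_body_trajectory_def)
    define z where "z = att_err R0 R"
    define w where "w t = \<Omega> t - \<Omega>0 t" for t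
    define W where "W t = V t (z t) (w t) (x t)" for t
    define h where "h t = norm (R t - R0 t) + norm (w t)" for t
    have z_axial: "z t = axial (transpose (R0 t) ** R t)" for t
      by (simp add: z_def att_err_eq_axial)
    have W_lower: "a * ((norm (z t))\<^sup>2 + (norm (w t))\<^sup>2) \<le> W t" if "t \<ge> 0" for t
      using a(2)[OF that] by (simp add: W_def)
    have W_pos: "W t \<ge> 0" if "t \<ge> 0" for t
      using W_lower[OF that] a(1) by (meson add_nonneg_nonneg less_imp_le mult_nonneg_nonneg order_trans zero_le_power2)
    have zw: "sqrt a * norm (z t) \<le> sqrt (W t)" "sqrt a * norm (w t) \<le> sqrt (W t)" if "t \<ge> 0" for t
    proof -
      have "0 \<le> a * (norm (z t))\<^sup>2" "0 \<le> a * (norm (w t))\<^sup>2"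
        using a(1) by simp_all
      then have "a * (norm (z t))\<^sup>2 \<le> W t" "a * (norm (w t))\<^sup>2 \<le> W t"
        using W_lower[OF that, unfolded distrib_left] by linarith+
      then show "sqrt a * norm (z t) \<le> sqrt (W t)" "sqrt a * norm (w t) \<le> sqrt (W t)"
        by (auto intro: sqrt_mult_le_sqrt)
    qed
    have decay: "\<exists>D. (W has_real_derivative D) (at t within {0..}) \<and> D \<le> - (c / 2) * W t"
      if t: "t \<ge> 0" and ht: "h t \<le> r" for t
    proof -
      have small: "norm (w t) \<le> 1" "norm (R t - R0 t) \<le> r"
        using ht r(3) norm_ge_zero[of "R t - R0 t"] norm_ge_zero[of "w t"] unfolding h_def by linarith+
      define \<rho> where "\<rho> = axial (transpose (R0 t) ** R t ** hat (w t)) - w t"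
      have "(R has_vector_derivative R t ** hat (\<Omega> t)) (at t within {0..})"
        using sol[OF t] small(1) unfolding w_def by metis
      from att_err_derivative[OF ref(2)[OF t] this]
      have "(z has_vector_derivative z t \<times> \<Omega>0 t + w t + \<rho>) (at t within {0..})"
        by (simp add: z_def \<rho>_def w_def add.assoc)
      moreover have "(w has_vector_derivative F t (z t, w t, x t)) (at t within {0..})"
        using has_vector_derivative_diff[of \<Omega> _ _ \<Omega>0, OF _ ref(3)[OF t]] sol[OF t]
        unfolding w_def[abs_def] z_def by fastforce
      moreover have "(x has_vector_derivative z t) (at t within {0..})"
        using sol[OF t] by (simp add: z_def)
      ultimately obtain D where D: "(W has_real_derivative D) (at t within {0..})"
        "D \<le> - c * W t + e * sqrt (W t) * norm \<rho>"
        using diss t unfolding dissipation_inequality_def W_def[abs_def] by blast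
      have "norm \<rho> \<le> K * r * norm (w t)"
      proof -
        have "norm \<rho> \<le> K * norm (R t - R0 t) * norm (w t)"
          unfolding \<rho>_def using K(5) ref(1)[OF t] sol[OF t] by blast
        also have "\<dots> \<le> K * r * norm (w t)"
          using small(2) K(1) by (intro mult_right_mono mult_left_mono) auto
        finally show ?thesis .
      qed
      then have "e * sqrt (W t) * norm \<rho> \<le> e * sqrt (W t) * (K * r * norm (w t))"
        using c(2) W_pos[OF t] by (intro mult_left_mono) auto
      also have "\<dots> = (e * K * r) * (sqrt (W t) * norm (w t))"
        by (simp add: algebra_simps)
      also have "\<dots> \<le> (c / 2 * sqrt a) * (sqrt (W t) * norm (w t))"
        using r(4) W_pos[OF t] by (intro mult_right_mono) auto
      also have "\<dots> = c / 2 * sqrt (W t) * (sqrt a * norm (w t))"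
        by (simp add: algebra_simps)
      also have "\<dots> \<le> c / 2 * sqrt (W t) * sqrt (W t)"
        using zw(2)[OF t] c(1) W_pos[OF t] by (intro mult_left_mono) auto
      also have "\<dots> = c / 2 * W t"
        using W_pos[OF t] by simp
      finally show ?thesis
        using D by (intro exI[of _ D]) (auto simp: field_simps)
    qed
    have W0: "sqrt (W 0) \<le> sqrt b * ((K + 1) * h 0)"
    proof -
      have "norm (z 0) \<le> K * norm (R 0 - R0 0)"
        unfolding z_axial using K(3) ref(1)[of 0] sol[of 0] by blast
      moreover have "K * norm (R 0 - R0 0) + norm (w 0) \<le> (K + 1) * h 0"
        using K(1) by (simp add: h_def algebra_simps)
      ultimately have zw0: "norm (z 0) + norm (w 0) \<le> (K + 1) * h 0"
        by linarith
      have "W 0 \<le> b * ((norm (z 0))\<^sup>2 + (norm (w 0))\<^sup>2)"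
        using b(2) by (simp add: W_def x0)
      also have "\<dots> \<le> b * (norm (z 0) + norm (w 0))\<^sup>2"
        using b(1) by (intro mult_left_mono) (auto simp: power2_sum)
      also have "\<dots> \<le> b * ((K + 1) * h 0)\<^sup>2"
        using b(1) zw0 by (intro mult_left_mono power_mono) auto
      finally have "sqrt (W 0) \<le> sqrt (b * ((K + 1) * h 0)\<^sup>2)"
        by simp
      also have "\<dots> = sqrt b * ((K + 1) * h 0)"
        using K(1) by (simp add: real_sqrt_mult h_def)
      finally show ?thesis .
    qed
    have bound: "h T \<le> C * exp (- \<alpha> * T) * h 0"
      if T: "T \<ge> 0" and region: "\<And>t. t \<in> {0..T} \<Longrightarrow> h t \<le> r" for T
    proof -
      have "W T \<le> W 0 * exp (- (c / 2) * T)"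
        using decay region by (intro exponential_decay[OF T]) auto
      then have "sqrt (W T) \<le> sqrt (W 0 * (exp (- \<alpha> * T))\<^sup>2)"
        by (simp add: \<alpha>_def power2_eq_square algebra_simps flip: exp_add)
      also have "\<dots> = sqrt (W 0) * exp (- \<alpha> * T)"
        by (simp add: real_sqrt_mult)
      finally have WT: "sqrt (W T) \<le> sqrt (W 0) * exp (- \<alpha> * T)" .
      have "norm (R T - R0 T) + norm (w T) \<le> r"
        using region[of T] T by (simp add: h_def)
      then have "norm (R T - R0 T) \<le> d"
        using r(2) norm_ge_zero[of "w T"] by linarith
      then have "norm (R T - R0 T) \<le> K * norm (z T)"
        unfolding z_axial using K(4) ref(1)[OF T] sol[OF T] by blast
      then have "sqrt a * h T \<le> K * (sqrt a * norm (z T)) + sqrt a * norm (w T)"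
        using a(1) mult_left_mono[of "norm (R T - R0 T)" "K * norm (z T)" "sqrt a"]
        by (simp add: h_def algebra_simps)
      also have "\<dots> \<le> K * sqrt (W T) + sqrt (W T)"
        using zw[OF T] K(1) by (intro add_mono mult_left_mono) auto
      also have "\<dots> = (K + 1) * sqrt (W T)"
        by (simp add: algebra_simps)
      also have "\<dots> \<le> (K + 1) * ((sqrt b * ((K + 1) * h 0)) * exp (- \<alpha> * T))"
        using K(1) order_trans[OF WT mult_right_mono[OF W0]] by (intro mult_left_mono) auto
      also have "\<dots> = sqrt a * (C * exp (- \<alpha> * T) * h 0)"
        using a(1) b(1) by (simp add: C_def real_sqrt_divide power2_eq_square)
      finally show ?thesis
        using a(1) by simp
    qed
    have h0: "h 0 \<ge> 0" "h 0 < \<delta>"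
      using init by (simp_all add: h_def w_def)
    have "C * h 0 + h 0 < r"
      using mult_strict_left_mono[OF h0(2), of "C + 1"] C \<delta>(2) by (simp add: algebra_simps)
    then have init_r: "C * h 0 < r" "h 0 < r"
      using h0(1) C mult_nonneg_nonneg[of C "h 0"] by linarith+
    have cont: "continuous_on {0..} h"
    proof -
      have "continuous_on {0..} R" "continuous_on {0..} R0" "continuous_on {0..} \<Omega>" "continuous_on {0..} \<Omega>0"
        using sol ref unfolding continuous_on_eq_continuous_within
        by (meson atLeast_iff has_vector_derivative_continuous)+
      then show ?thesis
        unfolding h_def w_def by (intro continuous_intros)
    qed
    have h_less: "h t < r" if "t \<ge> 0" for t
    proof (rule trapped_below[OF cont init_r(2) _ that])
      fix T :: real assume T: "0 \<le> T" and region: "\<And>t. t \<in> {0..T} \<Longrightarrow> h t \<le> r"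
      have "C * exp (- \<alpha> * T) * h 0 \<le> C * 1 * h 0"
        using C h0(1) \<alpha> T by (intro mult_right_mono mult_left_mono) auto
      then show "h T < r"
        using bound[OF T region] init_r(1) by simp
    qed
    have "h t \<le> C * exp (- \<alpha> * t) * h 0"
      using h_less by (intro bound[OF t]) (auto intro: less_imp_le)
    moreover have "norm (w t) \<le> 1"
      using h_less[OF t] r(3) norm_ge_zero[of "R t - R0 t"] unfolding h_def by linarith
    ultimately show "norm (R t - R0 t) + norm (\<Omega> t - \<Omega>0 t)
        \<le> C * exp (- \<alpha> * t) * (norm (R 0 - R0 0) + norm (\<Omega> 0 - \<Omega>0 0)) \<and> norm (\<Omega> t - \<Omega>0 t) \<le> 1"
      by (simp add: h_def w_def)
  qed
qed

text \<open>
  The truncated closed loop has a global solution; as its rate error stays below \<open>1\<close> and \<open>\<Omega>0\<close> is bounded by \<open>B\<close>,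
  truncation at \<open>B + 1\<close> does not alter it, and it solves the original equations.
\<close>

theorem lyapunov_tracking_criterion:
  assumes traj: "rigid_body_trajectory R0 \<Omega>0 u0"
    and bounded: "bounded (\<Omega>0 ` {0..})" "bounded (u0 ` {0..})"
    and u0: "continuous_on {0..} u0"
    and F: "bounded_linear_family F"
    and V: "exponential_lyapunov \<Omega>0 F V"
  shows "tracks_exponentially R0 \<Omega>0 u0
    (\<lambda>R \<Omega> t. F t (att_err R0 R t, \<Omega> t - \<Omega>0 t, integral {0..t} (att_err R0 R)))"
proof -
  obtain \<delta> C \<alpha> :: real where pos: "\<delta> > 0" "C > 0" "\<alpha> > 0" and est:
    "\<And>R \<Omega> \<Omega>' x t. (\<And>t. t \<ge> 0 \<Longrightarrow> rotation_matrix (R t) \<and>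
        (R has_vector_derivative R t ** hat (\<Omega>' t)) (at t within {0..}) \<and>
        (norm (\<Omega> t - \<Omega>0 t) \<le> 1 \<longrightarrow> \<Omega>' t = \<Omega> t) \<and>
        (\<Omega> has_vector_derivative u0 t + F t (att_err R0 R t, \<Omega> t - \<Omega>0 t, x t)) (at t within {0..}) \<and>
        (x has_vector_derivative att_err R0 R t) (at t within {0..})) \<Longrightarrow> x 0 = 0 \<Longrightarrow>
      norm (R 0 - R0 0) + norm (\<Omega> 0 - \<Omega>0 0) < \<delta> \<Longrightarrow> t \<ge> 0 \<Longrightarrow>
      norm (R t - R0 t) + norm (\<Omega> t - \<Omega>0 t)
        \<le> C * exp (- \<alpha> * t) * (norm (R 0 - R0 0) + norm (\<Omega> 0 - \<Omega>0 0)) \<and>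
      norm (\<Omega> t - \<Omega>0 t) \<le> 1"
    by (rule local_exponential_estimate[OF traj V]) blast
  obtain B1 B2 where B12: "\<And>t. t \<ge> 0 \<Longrightarrow> norm (\<Omega>0 t) \<le> B1" "\<And>t. t \<ge> 0 \<Longrightarrow> norm (u0 t) \<le> B2"
    using bounded by (auto simp: bounded_iff)
  define B where "B = max B1 B2"
  have B: "\<And>t. t \<ge> 0 \<Longrightarrow> norm (\<Omega>0 t) \<le> B" "\<And>t. t \<ge> 0 \<Longrightarrow> norm (u0 t) \<le> B"
    unfolding B_def by (auto intro: max.coboundedI1 max.coboundedI2 B12)
  have B0: "B \<ge> 0"
    using order_trans[OF norm_ge_zero B(1)[of 0]] by simp
  show ?thesis
    unfolding tracks_exponentially_def
  proof (rule exI[of _ \<delta>], rule conjI[OF pos(1)], rule exI[of _ C], rule conjI[OF pos(2)],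
      rule exI[of _ \<alpha>], rule conjI[OF pos(3)], intro allI impI conjI)
    fix R1 \<Omega>1 assume start_near: "rotation_matrix R1 \<and> norm (R1 - R0 0) + norm (\<Omega>1 - \<Omega>0 0) < \<delta>"
    then have R1: "rotation_matrix R1" and init: "norm (R1 - R0 0) + norm (\<Omega>1 - \<Omega>0 0) < \<delta>"
      by auto
    show "\<exists>R \<Omega>. rigid_body_trajectory R \<Omega>
        (\<lambda>t. u0 t + F t (att_err R0 R t, \<Omega> t - \<Omega>0 t, integral {0..t} (att_err R0 R))) \<and> R 0 = R1 \<and> \<Omega> 0 = \<Omega>1"
    proof -
      obtain R \<Omega> x where start: "R 0 = R1" "\<Omega> 0 = \<Omega>1" "x 0 = 0" and sol: "\<And>t. t \<ge> 0 \<Longrightarrow> rotation_matrix (R t) \<and>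
        (R has_vector_derivative R t ** hat (truncate (B + 1) (\<Omega> t))) (at t within {0..}) \<and>
        (\<Omega> has_vector_derivative u0 t + F t (att_err R0 R t, \<Omega> t - \<Omega>0 t, x t)) (at t within {0..}) \<and>
        (x has_vector_derivative att_err R0 R t) (at t within {0..})"
        using truncated_closed_loop_solution[OF traj B u0 F _ R1, of "B + 1" \<Omega>1] B0 by auto
      have trunc: "truncate (B + 1) (\<Omega> t) = \<Omega> t" if "norm (\<Omega> t - \<Omega>0 t) \<le> 1" "t \<ge> 0" for t
        using norm_triangle_ineq[of "\<Omega>0 t" "\<Omega> t - \<Omega>0 t"] B(1)[OF that(2)] that(1) B0
        by (intro truncate_eq_self) auto
      have "norm (\<Omega> t - \<Omega>0 t) \<le> 1" if "t \<ge> 0" for t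
      proof -
        have "norm (R t - R0 t) + norm (\<Omega> t - \<Omega>0 t)
            \<le> C * exp (- \<alpha> * t) * (norm (R 0 - R0 0) + norm (\<Omega> 0 - \<Omega>0 0)) \<and> norm (\<Omega> t - \<Omega>0 t) \<le> 1"
        proof (rule est[of R "\<lambda>t. truncate (B + 1) (\<Omega> t)" \<Omega> x t])
          show "rotation_matrix (R s) \<and>
              (R has_vector_derivative R s ** hat (truncate (B + 1) (\<Omega> s))) (at s within {0..}) \<and>
              (norm (\<Omega> s - \<Omega>0 s) \<le> 1 \<longrightarrow> truncate (B + 1) (\<Omega> s) = \<Omega> s) \<and>
              (\<Omega> has_vector_derivative u0 s + F s (att_err R0 R s, \<Omega> s - \<Omega>0 s, x s)) (at s within {0..}) \<and>
              (x has_vector_derivative att_err R0 R s) (at s within {0..})" if "0 \<le> s" for s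
            using sol[OF that] trunc[OF _ that] by blast
        qed (use start init that in simp_all)
        then show ?thesis
          by blast
      qed
      moreover have "x t = integral {0..t} (att_err R0 R)" if t: "t \<ge> 0" for t
      proof -
        have "(att_err R0 R has_integral x t - x 0) {0..t}"
        proof (rule fundamental_theorem_of_calculus[OF t])
          fix s assume "s \<in> {0..t}"
          then have "(x has_vector_derivative att_err R0 R s) (at s within {0..})"
            using sol[of s] by simp
          then show "(x has_vector_derivative att_err R0 R s) (at s within {0..t})"
            by (rule has_vector_derivative_within_subset) auto
        qed
        then show ?thesis
          using integral_unique start(3) by force
      qed
      ultimately have "rigid_body_trajectory R \<Omega>
          (\<lambda>t. u0 t + F t (att_err R0 R t, \<Omega> t - \<Omega>0 t, integral {0..t} (att_err R0 R)))"
        using sol trunc unfolding rigid_body_trajectory_def by metis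
      then show ?thesis
        using start by blast
    qed
    fix R \<Omega> and t :: real
    assume "rigid_body_trajectory R \<Omega>
        (\<lambda>t. u0 t + F t (att_err R0 R t, \<Omega> t - \<Omega>0 t, integral {0..t} (att_err R0 R))) \<and> R 0 = R1 \<and> \<Omega> 0 = \<Omega>1"
      and t: "0 \<le> t"
    then have sol: "rigid_body_trajectory R \<Omega>
        (\<lambda>t. u0 t + F t (att_err R0 R t, \<Omega> t - \<Omega>0 t, integral {0..t} (att_err R0 R)))"
      and start: "R 0 = R1" "\<Omega> 0 = \<Omega>1"
      by auto
    define x where "x t = integral {0..t} (att_err R0 R)" for t
    have "continuous_on {0..} (att_err R0 R)"
      unfolding continuous_on_eq_continuous_within
      using att_err_derivative traj sol unfolding rigid_body_trajectory_def
      by (meson atLeast_iff has_vector_derivative_continuous)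
    then have att: "continuous_on {0..t} (att_err R0 R)" for t
      by (rule continuous_on_subset) auto
    have x: "(x has_vector_derivative att_err R0 R t) (at t within {0..})" if "t \<ge> 0" for t
      using integral_has_vector_derivative[OF att, of t "t + 1"] at_within_atLeastAtMost_eq[of t "t + 1"] that
      by (simp add: x_def[abs_def])
    show "norm (R t - R0 t) + norm (\<Omega> t - \<Omega>0 t)
        \<le> C * exp (- \<alpha> * t) * (norm (R1 - R0 0) + norm (\<Omega>1 - \<Omega>0 0))"
    proof -
      have "norm (R t - R0 t) + norm (\<Omega> t - \<Omega>0 t)
          \<le> C * exp (- \<alpha> * t) * (norm (R 0 - R0 0) + norm (\<Omega> 0 - \<Omega>0 0)) \<and> norm (\<Omega> t - \<Omega>0 t) \<le> 1"
      proof (rule est[of R \<Omega> \<Omega> x t])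
        show "rotation_matrix (R s) \<and> (R has_vector_derivative R s ** hat (\<Omega> s)) (at s within {0..}) \<and>
            (norm (\<Omega> s - \<Omega>0 s) \<le> 1 \<longrightarrow> \<Omega> s = \<Omega> s) \<and>
            (\<Omega> has_vector_derivative u0 s + F s (att_err R0 R s, \<Omega> s - \<Omega>0 s, x s)) (at s within {0..}) \<and>
            (x has_vector_derivative att_err R0 R s) (at s within {0..})" if "0 \<le> s" for s
          using sol x[OF that] that unfolding rigid_body_trajectory_def x_def by blast
      qed (use start init t in \<open>simp_all add: x_def\<close>)
      then show ?thesis
        by (simp add: start)
    qed
  qed
qed

section \<open>Quadratic Lyapunov functions of Hurwitz operators\<close>

text \<open>
  The operator \<open>p(g)\<close> applied to \<open>x\<close>.
\<close>

definition poly_op :: "('a \<Rightarrow> 'a) \<Rightarrow> real poly \<Rightarrow> 'a \<Rightarrow> 'a::real_vector"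
  where "poly_op g p x = (\<Sum>i\<le>degree p. coeff p i *\<^sub>R (g ^^ i) x)"

lemma poly_op_eq:
  assumes "degree p \<le> n"
  shows "poly_op g p x = (\<Sum>i\<le>n. coeff p i *\<^sub>R (g ^^ i) x)"
  unfolding poly_op_def
  by (rule sum.mono_neutral_left) (use assms in \<open>auto simp: coeff_eq_0\<close>)

lemma poly_op_add: "poly_op g (p + q) x = poly_op g p x + poly_op g q x"
proof -
  define n where "n = max (degree p) (degree q)"
  have "degree p \<le> n" "degree q \<le> n" "degree (p + q) \<le> n"
    by (auto simp: n_def intro: degree_add_le)
  then show ?thesis
    by (simp add: poly_op_eq scaleR_left_distrib sum.distrib)
qed

lemma poly_op_smult: "poly_op g (smult c p) x = c *\<^sub>R poly_op g p x"
  using poly_op_eq[OF degree_smult_le, of g c p x]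
  by (simp add: poly_op_def scaleR_sum_right)

lemma poly_op_pCons_0:
  assumes "linear g"
  shows "poly_op g (pCons 0 p) x = g (poly_op g p x)"
proof -
  have "poly_op g (pCons 0 p) x = (\<Sum>i\<le>Suc (degree p). coeff (pCons 0 p) i *\<^sub>R (g ^^ i) x)"
    by (rule poly_op_eq) (rule degree_pCons_le)
  also have "\<dots> = (\<Sum>i\<le>degree p. coeff p i *\<^sub>R (g ^^ Suc i) x)"
    by (subst sum.atMost_Suc_shift) simp
  also have "\<dots> = g (poly_op g p x)"
    using assms by (simp add: poly_op_def linear_sum linear_cmul)
  finally show ?thesis .
qed

lemma annihilating_poly_exists:
  fixes g :: "'a::euclidean_space \<Rightarrow> 'a"
  shows "\<exists>p. p \<noteq> 0 \<and> poly_op g p x = 0"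
proof -
  define w where "w i = (g ^^ i) x" for i
  define n where "n = DIM('a)"
  have *: "poly_op g (\<Sum>i\<le>n. monom (c i) i) x = (\<Sum>i\<le>n. c i *\<^sub>R w i)"
    "i \<le> n \<Longrightarrow> coeff (\<Sum>i\<le>n. monom (c i) i) i = c i" for c i
  proof -
    have co: "coeff (\<Sum>i\<le>n. monom (c i) i) j = (if j \<le> n then c j else 0)" for j
      by (simp add: coeff_sum)
    have "degree (\<Sum>i\<le>n. monom (c i) i) \<le> n"
      by (rule degree_le) (simp add: co)
    then show "poly_op g (\<Sum>i\<le>n. monom (c i) i) x = (\<Sum>i\<le>n. c i *\<^sub>R w i)"
      by (subst poly_op_eq[where n = n]) (auto simp: co w_def)
    show "i \<le> n \<Longrightarrow> coeff (\<Sum>i\<le>n. monom (c i) i) i = c i"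
      by (simp add: co)
  qed
  have "\<exists>c. (\<exists>i\<le>n. c i \<noteq> 0) \<and> (\<Sum>i\<le>n. c i *\<^sub>R w i) = 0"
  proof (cases "inj_on w {..n}")
    case True
    then have "card (w ` {..n}) > DIM('a)"
      by (simp add: card_image n_def)
    then have "dependent (w ` {..n})"
      by (intro dependent_biggerset) auto
    then obtain u v where "v \<in> w ` {..n}" "u v \<noteq> 0" "(\<Sum>v\<in>w ` {..n}. u v *\<^sub>R v) = 0"
      using dependent_finite[of "w ` {..n}"] by auto
    then show ?thesis
      by (intro exI[of _ "\<lambda>i. u (w i)"]) (auto simp: sum.reindex[OF True] o_def)
  next
    case False
    then obtain i j where ij: "i \<le> n" "j \<le> n" "w i = w j" "i \<noteq> j"
      by (auto simp: inj_on_def)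
    define c :: "nat \<Rightarrow> real" where "c k = (if k = i then 1 else 0) - (if k = j then 1 else 0)" for k
    have "(\<Sum>k\<le>n. c k *\<^sub>R w k) = (\<Sum>k\<le>n. (if k = i then w k else 0) - (if k = j then w k else 0))"
      by (rule sum.cong) (auto simp: c_def)
    also have "\<dots> = 0"
      using ij by (simp add: sum_subtractf)
    finally show ?thesis
      using ij by (intro exI[of _ c]) (auto simp: c_def intro!: exI[of _ i])
  qed
  then obtain c i where c: "i \<le> n" "c i \<noteq> 0" "(\<Sum>i\<le>n. c i *\<^sub>R w i) = 0"
    by blast
  have "(\<Sum>i\<le>n. monom (c i) i) \<noteq> 0"
    using *(2)[OF c(1), of c] c(2) by force
  then show ?thesis
    using *(1)[of c] c(3) by auto
qed

lemma map_poly_of_real_add: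
  "map_poly of_real (p + q) = map_poly of_real p + (map_poly of_real q :: complex poly)"
  by (rule poly_eqI) (simp add: coeff_map_poly)

lemma map_poly_of_real_mult:
  "map_poly of_real (p * q) = map_poly of_real p * (map_poly of_real q :: complex poly)"
  by (rule poly_eqI) (simp add: coeff_map_poly coeff_mult)

lemma poly_map_poly_of_real:
  "poly (map_poly of_real p) (of_real x) = (of_real (poly p x) :: complex)"
  by (induction p) (auto simp: map_poly_pCons)

lemma real_poly_factor:
  fixes p :: "real poly"
  assumes "degree p > 0"
  shows "\<exists>a b k q. (k = [:a\<^sup>2 + b\<^sup>2, - 2 * a, 1:] \<or> (b = 0 \<and> k = [:- a, 1:])) \<and> p = k * q"
proof -
  let ?c = "map_poly complex_of_real"
  have "degree (?c p) > 0"
    using assms by (simp add: degree_map_poly)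
  then have "\<not> constant (poly (?c p))"
    by (simp add: constant_degree)
  then obtain z where z: "poly (?c p) z = 0"
    using fundamental_theorem_of_algebra by blast
  define a b where "a = Re z" and "b = Im z"
  have zab: "z = Complex a b"
    by (simp add: a_def b_def)
  show ?thesis
  proof (cases "b = 0")
    case True
    then have "z = of_real a"
      by (simp add: zab complex_eq_iff)
    then have "poly p a = 0"
      using z by (simp only: poly_map_poly_of_real of_real_eq_0_iff)
    then show ?thesis
      using True by (metis dvd_def poly_eq_0_iff_dvd)
  next
    case False
    define k where "k = [:a\<^sup>2 + b\<^sup>2, - 2 * a, 1:]"
    have k: "poly (?c k) z = 0"
      by (simp add: k_def zab complex_eq_iff power2_eq_square algebra_simps map_poly_pCons)
    define r where "r = p mod k"
    have "?c p = ?c k * ?c (p div k) + ?c r"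
      by (metis map_poly_of_real_add map_poly_of_real_mult mult_div_mod_eq r_def)
    then have rz: "poly (?c r) z = 0"
      using z k by simp
    have "degree r < 2"
      using degree_mod_less[of k p] by (auto simp: k_def r_def)
    then obtain c d where cd: "r = [:c, d:]"
      by (metis degree1_coeffs degree_eq_zeroE less_2_cases pCons_0_0 One_nat_def)
    have "d * b = 0" "c + d * a = 0"
      using rz by (simp_all add: cd map_poly_pCons zab complex_eq_iff mult.commute)
    then have "r = 0"
      using False by (simp add: cd)
    then have "p = k * (p div k)"
      by (simp add: r_def mod_eq_0_iff_dvd)
    then show ?thesis
      using k_def by blast
  qed
qed

lemma poly_op_quadratic_mult:
  assumes "linear g"
  shows "poly_op g ([:c, d, 1:] * q) x
    = g (g (poly_op g q x)) + d *\<^sub>R g (poly_op g q x) + c *\<^sub>R poly_op g q x"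
  using assms by (simp add: poly_op_add poly_op_smult poly_op_pCons_0 linear_add linear_cmul algebra_simps)

lemma poly_op_linear_mult:
  assumes "linear g"
  shows "poly_op g ([:c, 1:] * q) x = g (poly_op g q x) + c *\<^sub>R poly_op g q x"
  using assms by (simp add: poly_op_add poly_op_smult poly_op_pCons_0 algebra_simps)

text \<open>
  An operator on the nonzero quotient by \<open>M\<close> has a complex eigenvalue \<open>a + b i\<close>, stated over the reals through the
  quadratic polynomial with roots \<open>a \<plusminus> b i\<close>. Take \<open>p\<close> of least degree with \<open>p(g) x \<in> M\<close> for some \<open>x \<notin> M\<close>
  fixed in advance; a real factor \<open>k\<close> of \<open>p = k q\<close> of degree one or two annihilates \<open>y = q(g) x\<close> modulo \<open>M\<close>.
\<close>

lemma quotient_eigenpair_exists: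
  fixes g :: "'a::euclidean_space \<Rightarrow> 'a"
  assumes g: "linear g" and M: "subspace M" "\<And>x. x \<in> M \<Longrightarrow> g x \<in> M" and "M \<noteq> UNIV"
  shows "\<exists>y a b. y \<notin> M \<and> g (g y) - (2 * a) *\<^sub>R g y + (a\<^sup>2 + b\<^sup>2) *\<^sub>R y \<in> M"
proof -
  obtain x where x: "x \<notin> M"
    using assms by blast
  define A where "A = {p. p \<noteq> 0 \<and> poly_op g p x \<in> M}"
  obtain p0 where "p0 \<in> A"
    using annihilating_poly_exists[of g x] subspace_0[OF M(1)] by (force simp: A_def)
  then obtain p where p: "p \<in> A" and min: "\<And>q. degree q < degree p \<Longrightarrow> q \<notin> A"
    using exists_least_iff[of "\<lambda>n. \<exists>p\<in>A. degree p = n"] by metis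
  have "degree p > 0"
  proof (rule ccontr)
    assume "\<not> degree p > 0"
    then obtain c where c: "p = [:c:]"
      using degree_eq_zeroE by blast
    then have "c \<noteq> 0" "c *\<^sub>R x \<in> M"
      using p by (auto simp: A_def poly_op_def)
    then show False
      using x M(1) by (metis subspace_scale scaleR_scaleR left_inverse scaleR_one)
  qed
  then obtain a b k q where k: "k = [:a\<^sup>2 + b\<^sup>2, - 2 * a, 1:] \<or> (b = 0 \<and> k = [:- a, 1:])" and pq: "p = k * q"
    using real_poly_factor by blast
  have q0: "q \<noteq> 0" and dk: "degree k > 0" and k0: "k \<noteq> 0"
    using p pq k by (auto simp: A_def)
  then have "degree q < degree p"
    by (simp add: pq degree_mult_eq)
  then have y: "poly_op g q x \<notin> M" (is "?y \<notin> M")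
    using min q0 by (auto simp: A_def)
  have pM: "poly_op g (k * q) x \<in> M"
    using p pq by (simp add: A_def)
  from k show ?thesis
  proof
    assume "k = [:a\<^sup>2 + b\<^sup>2, - 2 * a, 1:]"
    then have "g (g ?y) - (2 * a) *\<^sub>R g ?y + (a\<^sup>2 + b\<^sup>2) *\<^sub>R ?y \<in> M"
      using pM by (simp only: poly_op_quadratic_mult[OF g]) simp
    then show ?thesis
      using y by blast
  next
    assume b: "b = 0 \<and> k = [:- a, 1:]"
    \<comment> \<open>For a linear factor, applying \<open>g - a\<close> once more yields the quadratic form of the claim.\<close>
    define d where "d = g ?y - a *\<^sub>R ?y"
    have "d \<in> M"
      using pM b poly_op_linear_mult[OF g, of "-a" q x] by (simp add: d_def)
    then have "g d - a *\<^sub>R d \<in> M"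
      using M by (simp add: subspace_diff subspace_scale)
    moreover have "g d - a *\<^sub>R d = g (g ?y) - (2 * a) *\<^sub>R g ?y + (a\<^sup>2 + 0\<^sup>2) *\<^sub>R ?y"
    proof -
      have "(2 * a) *\<^sub>R v = a *\<^sub>R v + a *\<^sub>R v" for v :: 'a
        by (simp flip: scaleR_left_distrib)
      moreover have "g d = g (g ?y) - a *\<^sub>R g ?y"
        by (simp add: d_def linear_diff[OF g] linear_cmul[OF g])
      ultimately show ?thesis
        by (simp add: d_def scaleR_diff_right power2_eq_square)
    qed
    ultimately show ?thesis
      using y by metis
  qed
qed

text \<open>
  A positive semidefinite Lyapunov form for \<open>f\<close> that controls the functionals \<open>n \<bullet> x\<close> with \<open>n \<in> M\<close>. Enlarging \<open>M\<close>
  from \<open>{0}\<close> to the whole space turns it into a positive definite one.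
\<close>

definition lyapunov_form_on :: "'a set \<Rightarrow> ('a \<Rightarrow> 'a) \<Rightarrow> ('a \<Rightarrow> 'a::euclidean_space) \<Rightarrow> bool"
  where "lyapunov_form_on M f P \<longleftrightarrow> linear P \<and> (\<forall>x y. x \<bullet> P y = P x \<bullet> y) \<and> (\<forall>x. 0 \<le> x \<bullet> P x) \<and>
    (\<forall>n\<in>M. \<exists>C. \<forall>x. (n \<bullet> x)\<^sup>2 \<le> C * (x \<bullet> P x)) \<and>
    (\<exists>c>0. \<forall>x. x \<bullet> P (f x) \<le> - c * (x \<bullet> P x))"

text \<open>
  The pair \<open>(u, v)\<close> stands for the complex eigenvector \<open>u + i v\<close> of the eigenvalue \<open>a + i b\<close>.
\<close>

definition hurwitz_operator :: "('a::real_vector \<Rightarrow> 'a) \<Rightarrow> bool"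
  where "hurwitz_operator f \<longleftrightarrow> (\<forall>a b u v.
    f u = a *\<^sub>R u - b *\<^sub>R v \<and> f v = b *\<^sub>R u + a *\<^sub>R v \<and> (u \<noteq> 0 \<or> v \<noteq> 0) \<longrightarrow> a < 0)"

lemma hurwitz_operator_quadratic:
  assumes f: "linear f" and H: "hurwitz_operator f"
    and x: "x \<noteq> 0" "f (f x) - (2 * a) *\<^sub>R f x + (a\<^sup>2 + b\<^sup>2) *\<^sub>R x = 0"
  shows "a < 0"
proof -
  define y where "y = f x - a *\<^sub>R x"
  have fx: "f x = a *\<^sub>R x + y"
    by (simp add: y_def)
  have two: "(2 * a) *\<^sub>R v = a *\<^sub>R v + a *\<^sub>R v" for v :: 'a
    by (simp flip: scaleR_left_distrib)
  have "f y = f (f x) - a *\<^sub>R f x"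
    by (simp add: y_def linear_diff[OF f] linear_cmul[OF f])
  also have "f (f x) = (a *\<^sub>R f x + a *\<^sub>R f x) - (a\<^sup>2 + b\<^sup>2) *\<^sub>R x"
    using x(2) unfolding two by (metis add_diff_cancel diff_add_cancel diff_0 uminus_add_conv_diff add.commute)
  also have "a *\<^sub>R f x + a *\<^sub>R f x - (a\<^sup>2 + b\<^sup>2) *\<^sub>R x - a *\<^sub>R f x = a *\<^sub>R f x - (a\<^sup>2 + b\<^sup>2) *\<^sub>R x"
    by simp
  also have "\<dots> = a *\<^sub>R y - b\<^sup>2 *\<^sub>R x"
    by (simp add: fx algebra_simps power2_eq_square)
  finally have fy: "f y = a *\<^sub>R y - b\<^sup>2 *\<^sub>R x" .
  show ?thesis
  proof (cases "b = 0")
    case True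
    show ?thesis
    proof (cases "y = 0")
      case True
      then show ?thesis
        using H x(1) fx unfolding hurwitz_operator_def
        by (metis add.right_neutral diff_zero scaleR_zero_left scaleR_zero_right linear_0[OF f])
    next
      case False
      then show ?thesis
        using H fy \<open>b = 0\<close> unfolding hurwitz_operator_def
        by (metis add.right_neutral diff_zero scaleR_zero_left scaleR_zero_right linear_0[OF f] zero_power2)
    qed
  next
    case False
    define v where "v = - (1 / b) *\<^sub>R y"
    have "f x = a *\<^sub>R x - b *\<^sub>R v"
      using False by (simp add: fx v_def)
    moreover have "f v = b *\<^sub>R x + a *\<^sub>R v"
      using False by (simp add: v_def linear_cmul[OF f] fy linear_neg[OF f] algebra_simps power2_eq_square)
    ultimately show ?thesis
      using H x(1) unfolding hurwitz_operator_def by blast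
  qed
qed

text \<open>
  Eigenvalues of the adjoint on a quotient are eigenvalues of \<open>f\<close>: the quadratic polynomial \<open>h\<close> of the adjoint maps
  the span of \<open>M\<close> and \<open>y\<close> into \<open>M\<close>, hence is not injective; a vector orthogonal to its range lies in the kernel
  of the same polynomial of \<open>f\<close>.
\<close>

lemma invariant_quotient_spectrum:
  fixes f :: "'a::euclidean_space \<Rightarrow> 'a"
  assumes f: "linear f" and M: "subspace M" "\<And>x. x \<in> M \<Longrightarrow> adjoint f x \<in> M"
    and y: "y \<notin> M" "adjoint f (adjoint f y) - (2 * a) *\<^sub>R adjoint f y + (a\<^sup>2 + b\<^sup>2) *\<^sub>R y \<in> M"
  shows "\<exists>x. x \<noteq> 0 \<and> f (f x) - (2 * a) *\<^sub>R f x + (a\<^sup>2 + b\<^sup>2) *\<^sub>R x = 0"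
proof -
  let ?g = "adjoint f"
  define h where "h x = ?g (?g x) - (2 * a) *\<^sub>R ?g x + (a\<^sup>2 + b\<^sup>2) *\<^sub>R x" for x
  have g: "linear ?g"
    by (rule adjoint_linear[OF f])
  have h: "linear h"
    unfolding h_def
    by (rule linearI) (simp_all add: linear_add[OF g] linear_cmul[OF g] algebra_simps)
  have hM: "h ` M \<subseteq> M"
    using M by (auto simp: h_def intro!: subspace_add subspace_diff subspace_scale)
  have "\<not> inj h"
  proof
    assume inj: "inj h"
    have "dim (h ` M) = dim M"
      using dim_image_eq[OF h] inj by (simp add: inj_on_subset)
    then have "h ` M = M"
      using subspace_dim_equal[OF linear_subspace_image[OF h M(1)] M(1) hM] by simp
    then obtain m where "m \<in> M" "h m = h y"
      using y(2) by (metis h_def imageE)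
    then show False
      using inj y(1) by (metis injD)
  qed
  then have "\<not> surj h"
    using linear_surjective_imp_injective[OF h] by blast
  moreover have sub: "subspace (range h)"
    using linear_subspace_image[OF h subspace_UNIV] .
  ultimately have "dim (range h) < DIM('a)"
    by (metis dim_UNIV dim_eq_full dim_subset_UNIV le_neq_implies_less span_eq_iff)
  then obtain x where x: "x \<noteq> 0" "\<And>z. z \<in> span (range h) \<Longrightarrow> orthogonal x z"
    using orthogonal_to_subspace_exists by blast
  have "f (f x) - (2 * a) *\<^sub>R f x + (a\<^sup>2 + b\<^sup>2) *\<^sub>R x = 0" (is "?l = 0")
  proof -
    have "z \<bullet> ?l = 0" for z
    proof -
      have "z \<bullet> ?l = h z \<bullet> x"
        by (simp add: h_def inner_add_left inner_diff_left inner_add_right inner_diff_right adjoint_clauses[OF f])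
      also have "\<dots> = 0"
        using x(2)[of "h z"] by (simp add: orthogonal_def inner_commute span_base)
      finally show ?thesis .
    qed
    then show ?thesis
      by (metis inner_eq_zero_iff)
  qed
  then show ?thesis
    using x(1) by blast
qed

text \<open>
  One step of a triangularization of the adjoint. Modulo \<open>M\<close> the functionals \<open>p = y \<bullet> x\<close> and \<open>r = u \<bullet> x\<close> with
  \<open>u = f\<^sup>* y - a y\<close> obey \<open>p' = a p + r\<close>, \<open>r' = a r - b\<^sup>2 p\<close> along \<open>x' = f x\<close>. For \<open>a < 0\<close> the form
  \<open>r\<^sup>2 + (a\<^sup>2 + b\<^sup>2) p\<^sup>2\<close> decays under this system, also in the degenerate case \<open>b = 0\<close>, where the block need not be
  diagonalizable. The coupling to \<open>M\<close> is absorbed by a large multiple \<open>K\<close> of the given form.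
\<close>

lemma lyapunov_form_extend:
  fixes f P :: "'a::euclidean_space \<Rightarrow> 'a"
  assumes f: "linear f" and H: "hurwitz_operator f"
    and M: "subspace M" "\<And>x. x \<in> M \<Longrightarrow> adjoint f x \<in> M" "M \<noteq> UNIV"
    and P: "lyapunov_form_on M f P"
  shows "\<exists>M' P'. subspace M' \<and> (\<forall>x\<in>M'. adjoint f x \<in> M') \<and> M \<subset> M' \<and> lyapunov_form_on M' f P'"
proof -
  let ?g = "adjoint f"
  have g: "linear ?g"
    by (rule adjoint_linear[OF f])
  obtain y a b where y: "y \<notin> M" "?g (?g y) - (2 * a) *\<^sub>R ?g y + (a\<^sup>2 + b\<^sup>2) *\<^sub>R y \<in> M" (is "?m \<in> M")
    using quotient_eigenpair_exists[OF g M] by blast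
  define m where "m = ?m"
  have a: "a < 0"
    using invariant_quotient_spectrum[OF f M(1,2) y] hurwitz_operator_quadratic[OF f H] by blast
  define u where "u = ?g y - a *\<^sub>R y"
  define s where "s = a\<^sup>2 + b\<^sup>2"
  have s: "s > 0" "s \<ge> a\<^sup>2"
    using a by (simp_all add: s_def add_pos_nonneg)
  have gy: "?g y = u + a *\<^sub>R y"
    by (simp add: u_def)
  have two: "(2 * a) *\<^sub>R v = a *\<^sub>R v + a *\<^sub>R v" for v :: 'a
    by (simp flip: scaleR_left_distrib)
  have "?g u = ?g (?g y) - a *\<^sub>R ?g y"
    by (simp add: u_def linear_diff[OF g] linear_cmul[OF g])
  also have "\<dots> = m + a *\<^sub>R ?g y - s *\<^sub>R y"
    by (simp add: m_def s_def two)
  also have "\<dots> = m + a *\<^sub>R u - b\<^sup>2 *\<^sub>R y"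
    by (simp add: gy s_def algebra_simps power2_eq_square)
  finally have gu: "?g u = m + a *\<^sub>R u - b\<^sup>2 *\<^sub>R y" .
  have linP: "linear P" and symP: "\<And>x y. x \<bullet> P y = P x \<bullet> y" and posP: "\<And>x. 0 \<le> x \<bullet> P x"
    and bdP: "\<And>n. n \<in> M \<Longrightarrow> \<exists>C. \<forall>x. (n \<bullet> x)\<^sup>2 \<le> C * (x \<bullet> P x)"
    using P by (auto simp: lyapunov_form_on_def)
  obtain c where c: "c > 0" "\<And>x. x \<bullet> P (f x) \<le> - c * (x \<bullet> P x)"
    using P by (auto simp: lyapunov_form_on_def)
  obtain C0 where C0: "\<And>x. (m \<bullet> x)\<^sup>2 \<le> C0 * (x \<bullet> P x)"
    using bdP[of m] y(2) by (auto simp: m_def)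
  define C where "C = max C0 0"
  have C: "(m \<bullet> x)\<^sup>2 \<le> C * (x \<bullet> P x)" "C \<ge> 0" for x
    using order_trans[OF C0[of x] mult_right_mono[OF max.cobounded1 posP[of x]]] by (simp_all add: C_def)
  define \<kappa> where "\<kappa> = C / (- a)"
  have \<kappa>: "\<kappa> \<ge> 0"
    using C(2) a by (simp add: \<kappa>_def divide_nonneg_neg)
  define K where "K = 2 * \<kappa> / c + 1"
  have K: "K > 0" "C / (- a) \<le> c / 2 * K"
  proof -
    show "K > 0"
      using \<kappa> c(1) by (simp add: K_def add_nonneg_pos)
    have "c / 2 * K = \<kappa> + c / 2"
      using c(1) by (simp add: K_def field_simps)
    then show "C / (- a) \<le> c / 2 * K"
      using c(1) by (simp add: \<kappa>_def)
  qed
  define P' where "P' x = K *\<^sub>R P x + (u \<bullet> x) *\<^sub>R u + (s * (y \<bullet> x)) *\<^sub>R y" for x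
  define M' where "M' = span (insert y (insert u M))"
  have mem: "n \<in> M' \<longleftrightarrow> (\<exists>k l. n - k *\<^sub>R y - l *\<^sub>R u \<in> M)" for n
    unfolding M'_def span_breakdown_eq using M(1) by (simp add: span_eq_iff[THEN iffD2])
  have Q: "x \<bullet> P' x = K * (x \<bullet> P x) + (u \<bullet> x)\<^sup>2 + s * (y \<bullet> x)\<^sup>2" for x
    by (simp add: P'_def inner_add_right inner_commute[of x] power2_eq_square)
  have "lyapunov_form_on M' f P'"
    unfolding lyapunov_form_on_def
  proof (intro conjI allI ballI)
    show "linear P'"
      unfolding P'_def
      by (rule linearI) (simp_all add: linear_add[OF linP] linear_cmul[OF linP] inner_add_right algebra_simps)
    show "x \<bullet> P' z = P' x \<bullet> z" for x z
      by (simp add: P'_def inner_add_right inner_add_left symP[of x z] inner_commute[of x u] inner_commute[of x y])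
    show "0 \<le> x \<bullet> P' x" for x
      unfolding Q using posP[of x] K(1) s(1) by simp
    show "\<exists>C. \<forall>x. (n \<bullet> x)\<^sup>2 \<le> C * (x \<bullet> P' x)" if "n \<in> M'" for n
    proof -
      obtain k l where kl: "n - k *\<^sub>R y - l *\<^sub>R u \<in> M"
        using \<open>n \<in> M'\<close> mem by blast
      define q where "q = n - k *\<^sub>R y - l *\<^sub>R u"
      obtain D0 where D0: "\<And>x. (q \<bullet> x)\<^sup>2 \<le> D0 * (x \<bullet> P x)"
        using bdP kl unfolding q_def by blast
      define D where "D = max D0 0 / K"
      have D: "(q \<bullet> x)\<^sup>2 \<le> D * (x \<bullet> P' x)" for x
      proof -
        have "(q \<bullet> x)\<^sup>2 \<le> max D0 0 * (x \<bullet> P x)"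
          using D0[of x] posP[of x] by (meson max.cobounded1 mult_right_mono order_trans)
        also have "\<dots> = D * (K * (x \<bullet> P x))"
          using K(1) by (simp add: D_def)
        also have "\<dots> \<le> D * (x \<bullet> P' x)"
          using K(1) s(1) by (intro mult_left_mono) (auto simp: Q D_def)
        finally show ?thesis .
      qed
      have "(n \<bullet> x)\<^sup>2 \<le> (3 * (D + k\<^sup>2 / s + l\<^sup>2)) * (x \<bullet> P' x)" for x
      proof -
        have n: "n \<bullet> x = q \<bullet> x + k * (y \<bullet> x) + l * (u \<bullet> x)"
          by (simp add: q_def inner_diff_left)
        have 3: "(\<alpha> + \<beta> + \<gamma>)\<^sup>2 \<le> 3 * (\<alpha>\<^sup>2 + \<beta>\<^sup>2 + \<gamma>\<^sup>2)" for \<alpha> \<beta> \<gamma> :: real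
          using sum_squares_ge_zero[of "\<alpha> - \<beta>" "\<beta> - \<gamma>"] zero_le_power2[of "\<alpha> - \<gamma>"]
          by (simp add: power2_eq_square algebra_simps)
        have "(y \<bullet> x)\<^sup>2 \<le> (x \<bullet> P' x) / s" "(u \<bullet> x)\<^sup>2 \<le> x \<bullet> P' x"
          using posP[of x] K(1) s(1) by (simp_all add: Q field_simps)
        then have "k\<^sup>2 * (y \<bullet> x)\<^sup>2 \<le> k\<^sup>2 * ((x \<bullet> P' x) / s)" "l\<^sup>2 * (u \<bullet> x)\<^sup>2 \<le> l\<^sup>2 * (x \<bullet> P' x)"
          by (auto intro!: mult_left_mono simp del: times_divide_eq_right)
        then show ?thesis
          using 3[of "q \<bullet> x" "k * (y \<bullet> x)" "l * (u \<bullet> x)"] D[of x]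
          unfolding n by (simp add: power_mult_distrib algebra_simps)
      qed
      then show ?thesis
        by blast
    qed
    define e where "e = min (c / 2) (- a / 4)"
    have "x \<bullet> P' (f x) \<le> - e * (x \<bullet> P' x)" for x
    proof -
      define p r w where "p = y \<bullet> x" and "r = u \<bullet> x" and "w = m \<bullet> x"
      have pf: "y \<bullet> f x = r + a * p"
        using adjoint_works[OF f, of x y]
        by (simp add: gy inner_add_right p_def r_def inner_commute[of x] inner_commute[of y "f x"])
      have rf: "u \<bullet> f x = w + a * r - b\<^sup>2 * p"
        using adjoint_works[OF f, of x u]
        by (simp add: gu inner_add_right inner_diff_right p_def r_def w_def inner_commute[of x] inner_commute[of u "f x"])
      have "x \<bullet> P' (f x) = K * (x \<bullet> P (f x)) + r * (w + a * r - b\<^sup>2 * p) + s * p * (r + a * p)"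
        by (simp add: P'_def inner_add_right pf rf r_def p_def inner_commute algebra_simps)
      also have "\<dots> = K * (x \<bullet> P (f x)) + a * r\<^sup>2 + a\<^sup>2 * (p * r) + s * a * p\<^sup>2 + r * w"
        by (simp add: s_def algebra_simps power2_eq_square)
      also have "\<dots> \<le> - c * K * (x \<bullet> P x) + a / 4 * r\<^sup>2 + a / 2 * (s * p\<^sup>2) + w\<^sup>2 / (- a)"
      proof -
        have 1: "K * (x \<bullet> P (f x)) \<le> - c * K * (x \<bullet> P x)"
          using mult_left_mono[OF c(2)[of x], of K] K(1) by (simp add: algebra_simps)
        have "a\<^sup>2 * (p * r) \<le> (- a / 2) * (r\<^sup>2 + a\<^sup>2 * p\<^sup>2)"
        proof -
          have "0 \<le> (- a / 2) * (r + a * p)\<^sup>2"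
            using a by (intro mult_nonneg_nonneg) auto
          then show ?thesis
            by (simp add: power2_eq_square algebra_simps)
        qed
        also have "\<dots> \<le> (- a / 2) * (r\<^sup>2 + s * p\<^sup>2)"
          using a s(2) by (intro mult_left_mono add_left_mono mult_right_mono) auto
        finally have 2: "a\<^sup>2 * (p * r) \<le> (- a / 2) * (r\<^sup>2 + s * p\<^sup>2)" .
        have 3: "r * w \<le> (- a / 4) * r\<^sup>2 + w\<^sup>2 / (- a)"
        proof -
          have "0 \<le> (1 / (- 4 * a)) * (a * r + 2 * w)\<^sup>2"
            using a by (intro mult_nonneg_nonneg) auto
          also have "\<dots> = (- a / 4) * r\<^sup>2 + w\<^sup>2 / (- a) - r * w"
            using a by (simp add: power2_eq_square field_simps)
          finally show ?thesis by simp
        qed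
        show ?thesis
          using 1 2 3 by (simp add: algebra_simps)
      qed
      also have "w\<^sup>2 / (- a) \<le> c / 2 * K * (x \<bullet> P x)"
      proof -
        have "w\<^sup>2 / (- a) \<le> (C * (x \<bullet> P x)) / (- a)"
          using C(1)[of x] a by (intro divide_right_mono) (auto simp: w_def)
        also have "\<dots> = (C / (- a)) * (x \<bullet> P x)"
          by simp
        also have "\<dots> \<le> c / 2 * K * (x \<bullet> P x)"
          using K(2) posP[of x] by (rule mult_right_mono)
        finally show ?thesis .
      qed
      also have "- c * K * (x \<bullet> P x) + a / 4 * r\<^sup>2 + a / 2 * (s * p\<^sup>2) + c / 2 * K * (x \<bullet> P x)
          \<le> - e * (x \<bullet> P' x)"
      proof -
        have "e * (K * (x \<bullet> P x)) \<le> c / 2 * (K * (x \<bullet> P x))"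
          using posP[of x] K(1) by (intro mult_right_mono) (auto simp: e_def)
        moreover have "e * r\<^sup>2 \<le> - a / 4 * r\<^sup>2"
          by (intro mult_right_mono) (auto simp: e_def)
        moreover have "e * (s * p\<^sup>2) \<le> - a / 2 * (s * p\<^sup>2)"
          using a s(1) by (intro mult_right_mono) (auto simp: e_def)
        ultimately show ?thesis
          unfolding Q p_def[symmetric] r_def[symmetric] by (simp add: algebra_simps)
      qed
      finally show ?thesis by simp
    qed
    moreover have "e > 0"
      using a c(1) by (simp add: e_def)
    ultimately show "\<exists>c>0. \<forall>x. x \<bullet> P' (f x) \<le> - c * (x \<bullet> P' x)"
      by blast
  qed
  moreover have "subspace M'"
    by (simp add: M'_def)
  moreover have "M \<subset> M'"
    using y(1) by (auto simp: M'_def span_base)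
  moreover have "?g x \<in> M'" if "x \<in> M'" for x
  proof -
    obtain k l where kl: "x - k *\<^sub>R y - l *\<^sub>R u \<in> M"
      using \<open>x \<in> M'\<close> mem by blast
    have "y \<in> M'" "u \<in> M'" "m \<in> M'" "?g (x - k *\<^sub>R y - l *\<^sub>R u) \<in> M'"
      using y(2) M(2)[OF kl] by (simp_all add: M'_def span_base m_def)
    moreover have "?g x = ?g (x - k *\<^sub>R y - l *\<^sub>R u) + k *\<^sub>R (u + a *\<^sub>R y) + l *\<^sub>R (m + a *\<^sub>R u - b\<^sup>2 *\<^sub>R y)"
      by (simp add: linear_diff[OF g] linear_cmul[OF g] gy gu)
    ultimately show ?thesis
      using \<open>subspace M'\<close> by (simp add: subspace_add subspace_diff subspace_scale)
  qed
  ultimately show ?thesis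
    by blast
qed

lemma lyapunov_form_UNIV:
  fixes f P :: "'a::euclidean_space \<Rightarrow> 'a"
  assumes f: "linear f" and H: "hurwitz_operator f"
    and M: "subspace M" "\<And>x. x \<in> M \<Longrightarrow> adjoint f x \<in> M"
    and P: "lyapunov_form_on M f P"
  shows "\<exists>P. lyapunov_form_on UNIV f P"
  using M P
proof (induction "DIM('a) - dim M" arbitrary: M P rule: less_induct)
  case less
  show ?case
  proof (cases "M = UNIV")
    case False
    then obtain M' P' where M': "subspace M'" "\<forall>x\<in>M'. adjoint f x \<in> M'" "M \<subset> M'" "lyapunov_form_on M' f P'"
      using lyapunov_form_extend[OF f H less.prems(1,2) _ less.prems(3)] by blast
    have "dim M < dim M'"
      using M'(1,3) less.prems(1) by (metis dim_psubset span_eq_iff)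
    moreover have "dim M' \<le> DIM('a)"
      by (rule dim_subset_UNIV)
    ultimately show ?thesis
      using M' by (intro less.hyps[of M' P']) auto
  qed (use less.prems in blast)
qed

text \<open>
  A solution of the Lyapunov inequality, obtained by building up the form along a flag of subspaces invariant
  under the adjoint.
\<close>

theorem lyapunov_form_exists:
  fixes f :: "'a::euclidean_space \<Rightarrow> 'a"
  assumes f: "linear f" and H: "hurwitz_operator f"
  shows "\<exists>P c. linear P \<and> (\<forall>x y. x \<bullet> P y = P x \<bullet> y) \<and> c > 0 \<and>
    (\<forall>x. c * (norm x)\<^sup>2 \<le> x \<bullet> P x \<and> x \<bullet> P (f x) \<le> - c * (x \<bullet> P x))"
proof -
  have "lyapunov_form_on {0} f (\<lambda>x. 0)"
    by (auto simp: lyapunov_form_on_def linear_zero intro: exI[of _ "1::real"])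
  then obtain P where P: "lyapunov_form_on UNIV f P"
    using lyapunov_form_UNIV[OF f H subspace_single_0, of "\<lambda>x. 0"]
    by (auto simp: linear_0[OF adjoint_linear[OF f]])
  have pos: "0 \<le> x \<bullet> P x" for x
    using P unfolding lyapunov_form_on_def by blast
  have "\<forall>n. \<exists>C. \<forall>x. (n \<bullet> x)\<^sup>2 \<le> C * (x \<bullet> P x)"
    using P unfolding lyapunov_form_on_def by blast
  then obtain C where C: "\<And>n x. (n \<bullet> x)\<^sup>2 \<le> C n * (x \<bullet> P x)"
    by metis
  define D where "D = (\<Sum>i\<in>Basis. \<bar>C i\<bar>) + 1"
  have D: "D > 0"
    by (simp add: D_def add_nonneg_pos sum_nonneg)
  have "(norm x)\<^sup>2 \<le> D * (x \<bullet> P x)" for x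
  proof -
    have "(norm x)\<^sup>2 = (\<Sum>i\<in>Basis. (i \<bullet> x)\<^sup>2)"
      unfolding power2_norm_eq_inner by (subst euclidean_inner) (simp add: power2_eq_square inner_commute)
    also have "\<dots> \<le> (\<Sum>i\<in>Basis. \<bar>C i\<bar> * (x \<bullet> P x))"
      using C pos by (intro sum_mono) (meson abs_ge_self mult_right_mono order_trans)
    also have "\<dots> \<le> D * (x \<bullet> P x)"
      using pos[of x] by (simp add: D_def sum_distrib_right[symmetric] algebra_simps)
    finally show ?thesis .
  qed
  then have lower: "1 / D * (norm x)\<^sup>2 \<le> x \<bullet> P x" for x
    using D by (simp add: field_simps)
  obtain c where c: "c > 0" "\<And>x. x \<bullet> P (f x) \<le> - c * (x \<bullet> P x)"
    using P unfolding lyapunov_form_on_def by blast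
  define d where "d = min c (1 / D)"
  have "d > 0"
    using D c by (simp add: d_def)
  moreover have "d * (norm x)\<^sup>2 \<le> x \<bullet> P x" for x
    using order_trans[OF mult_right_mono[OF min.cobounded2] lower] by (simp add: d_def)
  moreover have "x \<bullet> P (f x) \<le> - d * (x \<bullet> P x)" for x
  proof -
    have "d * (x \<bullet> P x) \<le> c * (x \<bullet> P x)"
      using pos[of x] by (intro mult_right_mono) (auto simp: d_def)
    then show ?thesis
      using c(2)[of x] by simp
  qed
  moreover have "linear P" "\<forall>x y. x \<bullet> P y = P x \<bullet> y"
    using P unfolding lyapunov_form_on_def by blast+
  ultimately show ?thesis
    by blast
qed

section \<open>Hurwitz operators from matrices and matrix pencils\<close>

text \<open>
  An eigenvector of the operator, split into real and imaginary part, is an eigenvector of the complex block matrix.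
\<close>

lemma hurwitz_operator_second_order:
  fixes K\<^sub>P K\<^sub>D :: "real^'n^'n"
  assumes H: "hurwitz_matrix (block_matrix 0 (mat 1) (- K\<^sub>P) (- K\<^sub>D))"
  shows "hurwitz_operator (\<lambda>s. (snd s, - (K\<^sub>P *v fst s) - K\<^sub>D *v snd s))"
  unfolding hurwitz_operator_def
proof (intro allI impI, elim conjE)
  let ?A = "map_matrix complex_of_real (block_matrix 0 (mat 1) (- K\<^sub>P) (- K\<^sub>D))"
  fix a b :: real and u v :: "(real^'n) \<times> (real^'n)"
  assume u: "(snd u, - (K\<^sub>P *v fst u) - K\<^sub>D *v snd u) = a *\<^sub>R u - b *\<^sub>R v"
    and v: "(snd v, - (K\<^sub>P *v fst v) - K\<^sub>D *v snd v) = b *\<^sub>R u + a *\<^sub>R v" and nz: "u \<noteq> 0 \<or> v \<noteq> 0"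
  define c :: "complex^('n + 'n)"
    where "c = (\<chi> i. case i of Inl k \<Rightarrow> Complex (fst u $ k) (fst v $ k) | Inr k \<Rightarrow> Complex (snd u $ k) (snd v $ k))"
  have comp: "snd u $ k = a * fst u $ k - b * fst v $ k" "snd v $ k = b * fst u $ k + a * fst v $ k"
    "- (K\<^sub>P *v fst u) $ k - (K\<^sub>D *v snd u) $ k = a * snd u $ k - b * snd v $ k"
    "- (K\<^sub>P *v fst v) $ k - (K\<^sub>D *v snd v) $ k = b * snd u $ k + a * snd v $ k" for k
    using arg_cong[OF u, of "\<lambda>s. fst s $ k"] arg_cong[OF v, of "\<lambda>s. fst s $ k"]
      arg_cong[OF u, of "\<lambda>s. snd s $ k"] arg_cong[OF v, of "\<lambda>s. snd s $ k"] by simp_all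
  have sum_split: "(\<Sum>j\<in>UNIV. g j) = (\<Sum>j\<in>UNIV. g (Inl j)) + (\<Sum>j\<in>UNIV. g (Inr j))"
    for g :: "'n + 'n \<Rightarrow> complex"
    using sum.Plus[of "UNIV :: 'n set" "UNIV :: 'n set" g] by (simp add: o_def)
  have "?A *v c = Complex a b *s c"
  proof (rule vec_eq_iff[THEN iffD2], rule allI)
    fix i :: "'n + 'n"
    show "(?A *v c) $ i = (Complex a b *s c) $ i"
    proof (cases i)
      case (Inl k)
      have "(?A *v c) $ i = c $ Inr k"
        by (simp add: Inl matrix_vector_mult_def sum_split map_matrix_def block_matrix_def mat_def
            if_distrib[of complex_of_real] if_distribR sum.delta' if_distrib[of "\<lambda>z. z * _"] cong: if_cong)
      then show ?thesis
        using comp(1,2)[of k] by (simp add: Inl c_def complex_eq_iff algebra_simps)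
    next
      case (Inr k)
      have "(?A *v c) $ i = (\<Sum>j\<in>UNIV. of_real (- K\<^sub>P $ k $ j) * Complex (fst u $ j) (fst v $ j))
          + (\<Sum>j\<in>UNIV. of_real (- K\<^sub>D $ k $ j) * Complex (snd u $ j) (snd v $ j))"
        by (simp add: Inr matrix_vector_mult_def sum_split map_matrix_def block_matrix_def c_def)
      also have "\<dots> = Complex (- (K\<^sub>P *v fst u) $ k - (K\<^sub>D *v snd u) $ k) (- (K\<^sub>P *v fst v) $ k - (K\<^sub>D *v snd v) $ k)"
        by (simp add: complex_eq_iff matrix_vector_mult_def sum_negf)
      also have "\<dots> = (Complex a b *s c) $ i"
        unfolding comp(3,4) by (simp add: Inr c_def complex_eq_iff algebra_simps)
      finally show ?thesis .
    qed
  qed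
  moreover have "c \<noteq> 0"
  proof
    assume "c = 0"
    then have "c $ Inl k = 0" "c $ Inr k = 0" for k
      by simp_all
    then have "u = 0" "v = 0"
      by (simp_all add: c_def prod_eq_iff vec_eq_iff complex_eq_iff)
    then show False
      using nz by simp
  qed
  ultimately have "eigenvalue ?A (Complex a b)"
    by (auto simp: eigenvalue_def)
  then show "a < 0"
    using H by (force simp: hurwitz_matrix_def)
qed

lemma poly_det_3:
  fixes X :: "real poly^3^3"
  shows "poly (map_poly complex_of_real (det X)) z = det (\<chi> i j. poly (map_poly complex_of_real (X $ i $ j)) z)"
proof -
  have minus: "map_poly complex_of_real (p - q) = map_poly complex_of_real p - map_poly complex_of_real q" for p q
    by (rule poly_eqI) (simp add: coeff_map_poly)
  show ?thesis
    by (simp add: det_3 map_poly_of_real_add map_poly_of_real_mult minus)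
qed

lemma det_zero_if_kernel:
  fixes M :: "complex^'n^'n"
  assumes "M *v c = 0" "c \<noteq> 0"
  shows "det M = 0"
proof (rule ccontr)
  assume "det M \<noteq> 0"
  then obtain N where "N ** M = mat 1"
    using invertible_det_nz[of M] by (auto simp: invertible_def)
  then have "c = N *v (M *v c)"
    by (simp add: matrix_vector_mul_assoc)
  then show False
    using assms by simp
qed

text \<open>
  An eigenvector for \<open>l\<close> has the form \<open>(c, l c, l\<^sup>2 c)\<close> with \<open>c\<close> in the kernel of the matrix pencil at \<open>l\<close>, so \<open>l\<close> is a
  root of the determinant.
\<close>

lemma hurwitz_operator_third_order:
  fixes K\<^sub>P K\<^sub>D K\<^sub>I :: "real^3^3"
  assumes H: "hurwitz_poly (cubic_pencil_poly K\<^sub>D K\<^sub>P K\<^sub>I)"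
  shows "hurwitz_operator (\<lambda>s. (fst (snd s), snd (snd s),
    - (K\<^sub>I *v fst s) - K\<^sub>P *v fst (snd s) - K\<^sub>D *v snd (snd s)))"
  unfolding hurwitz_operator_def
proof (intro allI impI, elim conjE)
  fix a b :: real and u v :: "(real^3) \<times> (real^3) \<times> (real^3)"
  assume u: "(fst (snd u), snd (snd u), - (K\<^sub>I *v fst u) - K\<^sub>P *v fst (snd u) - K\<^sub>D *v snd (snd u)) = a *\<^sub>R u - b *\<^sub>R v"
    and v: "(fst (snd v), snd (snd v), - (K\<^sub>I *v fst v) - K\<^sub>P *v fst (snd v) - K\<^sub>D *v snd (snd v)) = b *\<^sub>R u + a *\<^sub>R v"
    and nz: "u \<noteq> 0 \<or> v \<noteq> 0"
  obtain u1 u2 u3 where u': "u = (u1, u2, u3)" by (cases u)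
  obtain v1 v2 v3 where v': "v = (v1, v2, v3)" by (cases v)
  define l where "l = Complex a b"
  have comp: "u2 = a *\<^sub>R u1 - b *\<^sub>R v1" "v2 = b *\<^sub>R u1 + a *\<^sub>R v1" "u3 = a *\<^sub>R u2 - b *\<^sub>R v2" "v3 = b *\<^sub>R u2 + a *\<^sub>R v2"
    "- (K\<^sub>I *v u1) - K\<^sub>P *v u2 - K\<^sub>D *v u3 = a *\<^sub>R u3 - b *\<^sub>R v3"
    "- (K\<^sub>I *v v1) - K\<^sub>P *v v2 - K\<^sub>D *v v3 = b *\<^sub>R u3 + a *\<^sub>R v3"
    using u[unfolded u' v' fst_conv snd_conv scaleR_Pair diff_Pair prod.inject]
      v[unfolded u' v' fst_conv snd_conv scaleR_Pair add_Pair prod.inject] by blast+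
  define z where "z x y = (\<chi> k. Complex (x $ k) (y $ k))" for x y :: "real^3"
  have lz: "l * z x y $ k = z (a *\<^sub>R x - b *\<^sub>R y) (b *\<^sub>R x + a *\<^sub>R y) $ k" for x y k
    by (simp add: z_def l_def complex_eq_iff algebra_simps)
  have Kz: "(\<Sum>j\<in>UNIV. of_real (K $ i $ j) * z x y $ j) = z (K *v x) (K *v y) $ i" for K :: "real^3^3" and x y i
    by (simp add: z_def complex_eq_iff matrix_vector_mult_def)
  define c where "c = z u1 v1"
  have c2: "l * c $ k = z u2 v2 $ k" and c3: "l * (l * c $ k) = z u3 v3 $ k" for k
    unfolding c_def lz comp(1-4) by simp_all
  define M :: "complex^3^3" where "M = (\<chi> i j. of_real (mat 1 $ i $ j) * l^3 + of_real (K\<^sub>D $ i $ j) * l\<^sup>2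
    + of_real (K\<^sub>P $ i $ j) * l + of_real (K\<^sub>I $ i $ j))"
  have "(M *v c) $ i = 0" for i
  proof -
    have "(M *v c) $ i = (\<Sum>j\<in>UNIV. of_real (mat 1 $ i $ j) * (l * z u3 v3 $ j)) + (\<Sum>j\<in>UNIV. of_real (K\<^sub>D $ i $ j) * z u3 v3 $ j)
        + (\<Sum>j\<in>UNIV. of_real (K\<^sub>P $ i $ j) * z u2 v2 $ j) + (\<Sum>j\<in>UNIV. of_real (K\<^sub>I $ i $ j) * z u1 v1 $ j)"
      unfolding c2[symmetric] c3[symmetric] c_def[symmetric]
      by (simp add: M_def matrix_vector_mult_def sum.distrib[symmetric] power2_eq_square power3_eq_cube algebra_simps)
    also have "(\<Sum>j\<in>UNIV. of_real (mat 1 $ i $ j) * (l * z u3 v3 $ j)) = l * z u3 v3 $ i"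
      using exhaust_3[of i] by (auto simp: sum_3 mat_def)
    also have "l * z u3 v3 $ i = z (- (K\<^sub>I *v u1) - K\<^sub>P *v u2 - K\<^sub>D *v u3) (- (K\<^sub>I *v v1) - K\<^sub>P *v v2 - K\<^sub>D *v v3) $ i"
      unfolding lz comp(5,6) ..
    finally show ?thesis
      unfolding Kz by (simp add: z_def complex_eq_iff)
  qed
  then have "M *v c = 0"
    by (simp add: vec_eq_iff)
  moreover have "c \<noteq> 0"
  proof
    assume "c = 0"
    then have "u1 = 0" "v1 = 0"
      by (simp_all add: c_def z_def vec_eq_iff complex_eq_iff)
    then show False
      using nz comp(1-4) by (simp add: u' v' zero_prod_def)
  qed
  ultimately have "det M = 0"
    by (rule det_zero_if_kernel)
  moreover have "poly (map_poly complex_of_real (cubic_pencil_poly K\<^sub>D K\<^sub>P K\<^sub>I)) l = det M"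
    unfolding cubic_pencil_poly_def poly_det_3 M_def
    by (simp add: map_poly_of_real_add map_poly_monom poly_monom)
  ultimately have "Re l < 0"
    using H by (simp add: hurwitz_poly_def)
  then show "a < 0"
    by (simp add: l_def)
qed

section \<open>Lyapunov functions for feedback in transported coordinates\<close>

text \<open>
  If some coordinates \<open>T\<close> transform the error system into \<open>s' = f s + e\<close> with \<open>f\<close> Hurwitz and \<open>e\<close> bounded by the
  deviation \<open>\<rho>\<close>, then the Lyapunov form of \<open>f\<close> in these coordinates satisfies the dissipation inequality.
\<close>

lemma hurwitz_exponential_lyapunov:
  fixes f :: "'e::euclidean_space \<Rightarrow> 'e" and T :: "real \<Rightarrow> real^3 \<Rightarrow> real^3 \<Rightarrow> real^3 \<Rightarrow> 'e"
  assumes f: "linear f" "hurwitz_operator f"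
    and dyn: "\<And>z w x t \<rho>. t \<ge> 0 \<Longrightarrow>
      (z has_vector_derivative z t \<times> \<Omega>0 t + w t + \<rho>) (at t within {0..}) \<Longrightarrow>
      (w has_vector_derivative F t (z t, w t, x t)) (at t within {0..}) \<Longrightarrow>
      (x has_vector_derivative z t) (at t within {0..}) \<Longrightarrow>
      \<exists>e. ((\<lambda>t. T t (z t) (w t) (x t)) has_vector_derivative f (T t (z t) (w t) (x t)) + e) (at t within {0..}) \<and>
        norm e \<le> C * norm \<rho>"
    and lower: "a > 0" "\<And>t z w x. t \<ge> 0 \<Longrightarrow> a * ((norm z)\<^sup>2 + (norm w)\<^sup>2) \<le> (norm (T t z w x))\<^sup>2"
    and upper: "\<And>z w. (norm (T 0 z w 0))\<^sup>2 \<le> b * ((norm z)\<^sup>2 + (norm w)\<^sup>2)"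
  shows "\<exists>V. exponential_lyapunov \<Omega>0 F V"
proof -
  from lyapunov_form_exists[OF f] obtain P c where Pc: "linear P \<and> (\<forall>x y. x \<bullet> P y = P x \<bullet> y) \<and> c > 0 \<and>
      (\<forall>x. c * (norm x)\<^sup>2 \<le> x \<bullet> P x \<and> x \<bullet> P (f x) \<le> - c * (x \<bullet> P x))"
    by (elim exE) (rule that)
  have P: "linear P" "\<And>x y. x \<bullet> P y = P x \<bullet> y"
    and c: "c > 0" "\<And>x. c * (norm x)\<^sup>2 \<le> x \<bullet> P x" "\<And>x. x \<bullet> P (f x) \<le> - c * (x \<bullet> P x)"
    using Pc by blast+
  obtain p where p: "p > 0" "\<And>x. norm (P x) \<le> p * norm x"
    using linear_bounded_pos[OF P(1)] by blast
  have C: "\<bar>C\<bar> \<ge> 0" by simp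
  define V where "V t z w x = T t z w x \<bullet> P (T t z w x)" for t z w x
  define E where "E = 2 * p * \<bar>C\<bar> / sqrt c"
  have E: "E \<ge> 0"
    using p c(1) by (simp add: E_def)
  have decrease: "\<exists>D. ((\<lambda>t. V t (z t) (w t) (x t)) has_real_derivative D) (at t within {0..}) \<and>
        D \<le> - (2 * c) * V t (z t) (w t) (x t) + E * sqrt (V t (z t) (w t) (x t)) * norm \<rho>"
    if t: "t \<ge> 0" and der: "(z has_vector_derivative z t \<times> \<Omega>0 t + w t + \<rho>) (at t within {0..})"
      "(w has_vector_derivative F t (z t, w t, x t)) (at t within {0..})"
      "(x has_vector_derivative z t) (at t within {0..})" for z w x t \<rho>
  proof -
    define s where "s t = T t (z t) (w t) (x t)" for t
    obtain e where e: "(s has_vector_derivative f (s t) + e) (at t within {0..})" "norm e \<le> C * norm \<rho>"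
      using dyn[OF t der] unfolding s_def[abs_def] by blast
    have "((\<lambda>t. P (s t)) has_vector_derivative P (f (s t) + e)) (at t within {0..})"
      by (rule bounded_linear.has_vector_derivative[OF linear_conv_bounded_linear[THEN iffD1, OF P(1)] e(1)])
    then have "((\<lambda>t. s t \<bullet> P (s t)) has_vector_derivative
        s t \<bullet> P (f (s t) + e) + (f (s t) + e) \<bullet> P (s t)) (at t within {0..})"
      by (rule bounded_bilinear.has_vector_derivative[OF bounded_bilinear_inner e(1)])
    moreover have "s t \<bullet> P (f (s t) + e) + (f (s t) + e) \<bullet> P (s t) = 2 * (s t \<bullet> P (f (s t)) + P (s t) \<bullet> e)"
      by (simp add: linear_add[OF P(1)] inner_add_left inner_add_right P(2)[of "s t"] inner_commute[of _ "P (s t)"])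
    moreover have "s t \<bullet> P (s t) = V t (z t) (w t) (x t)" for t
      by (simp add: V_def s_def)
    ultimately have D: "((\<lambda>t. V t (z t) (w t) (x t)) has_real_derivative
        2 * (s t \<bullet> P (f (s t)) + P (s t) \<bullet> e)) (at t within {0..})"
      by (simp add: has_real_derivative_iff_has_vector_derivative)
    have "norm (s t) \<le> sqrt (V t (z t) (w t) (x t)) / sqrt c"
    proof -
      have "sqrt c * norm (s t) \<le> sqrt (V t (z t) (w t) (x t))"
        using c(2)[of "s t"] by (intro sqrt_mult_le_sqrt) (simp_all add: V_def s_def)
      then show ?thesis
        using c(1) by (simp only: pos_le_divide_eq real_sqrt_gt_zero mult.commute)
    qed
    then have Ps: "norm (P (s t)) \<le> p * (sqrt (V t (z t) (w t) (x t)) / sqrt c)"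
      using p(1) by (intro order_trans[OF p(2)] mult_left_mono) auto
    have "C * norm \<rho> \<le> \<bar>C\<bar> * norm \<rho>"
      by (intro mult_right_mono) auto
    then have "norm e \<le> \<bar>C\<bar> * norm \<rho>"
      using e(2) by linarith
    then have "norm (P (s t)) * norm e \<le> (p * (sqrt (V t (z t) (w t) (x t)) / sqrt c)) * (\<bar>C\<bar> * norm \<rho>)"
      using Ps by (intro mult_mono) (auto intro: order_trans[OF norm_ge_zero])
    then have "P (s t) \<bullet> e \<le> (p * (sqrt (V t (z t) (w t) (x t)) / sqrt c)) * (\<bar>C\<bar> * norm \<rho>)"
      using norm_cauchy_schwarz[of "P (s t)" e] by linarith
    moreover have "s t \<bullet> P (f (s t)) \<le> - c * V t (z t) (w t) (x t)"
      using c(3)[of "s t"] by (simp add: V_def s_def)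
    ultimately have "2 * (s t \<bullet> P (f (s t)) + P (s t) \<bullet> e)
        \<le> 2 * (- c * V t (z t) (w t) (x t) + (p * (sqrt (V t (z t) (w t) (x t)) / sqrt c)) * (\<bar>C\<bar> * norm \<rho>))"
      by simp
    also have "\<dots> = - (2 * c) * V t (z t) (w t) (x t) + E * sqrt (V t (z t) (w t) (x t)) * norm \<rho>"
      by (simp add: E_def algebra_simps)
    finally show ?thesis
      using D by blast
  qed
  have "exponential_lyapunov \<Omega>0 F V"
    unfolding exponential_lyapunov_def
  proof (intro conjI)
    have "(c * a) * ((norm z)\<^sup>2 + (norm w)\<^sup>2) \<le> V t z w x" if "t \<ge> 0" for t z w x
      using order_trans[OF mult_left_mono[OF lower(2)[OF that]] c(2)] c(1)
      by (simp add: V_def mult.assoc)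
    moreover have "c * a > 0"
      using c(1) lower(1) by simp
    ultimately show "\<exists>a>0. \<forall>t\<ge>0. \<forall>z w x. a * ((norm z)\<^sup>2 + (norm w)\<^sup>2) \<le> V t z w x"
      by blast
    have "V 0 z w 0 \<le> (p * b) * ((norm z)\<^sup>2 + (norm w)\<^sup>2)" for z w
    proof -
      have "V 0 z w 0 \<le> norm (T 0 z w 0) * norm (P (T 0 z w 0))"
        unfolding V_def by (rule norm_cauchy_schwarz)
      also have "\<dots> \<le> norm (T 0 z w 0) * (p * norm (T 0 z w 0))"
        by (intro mult_left_mono p) auto
      also have "\<dots> = p * (norm (T 0 z w 0))\<^sup>2"
        by (simp add: power2_eq_square)
      also have "\<dots> \<le> p * (b * ((norm z)\<^sup>2 + (norm w)\<^sup>2))"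
        using p(1) by (intro mult_left_mono upper) auto
      finally show ?thesis
        by (simp add: mult.assoc)
    qed
    then show "\<exists>b. \<forall>z w. V 0 z w 0 \<le> b * ((norm z)\<^sup>2 + (norm w)\<^sup>2)"
      by blast
    have "2 * c > 0"
      using c(1) by simp
    moreover have "dissipation_inequality \<Omega>0 F V (2 * c) E"
      unfolding dissipation_inequality_def by (intro allI impI decrease)
    ultimately show "\<exists>c>0. \<exists>e\<ge>0. dissipation_inequality \<Omega>0 F V c e"
      using E by blast
  qed
  then show ?thesis
    by blast
qed

text \<open>
  The correction terms in the controllers (i) and (ii) cancel exactly the derivative of \<open>z \<times> \<omega>\<close>, so that the
  transported rate \<open>z \<times> \<omega> + w\<close> is driven by \<open>H\<close> alone.
\<close>

lemma transported_rate_derivative: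
  assumes z: "(z has_vector_derivative z t \<times> \<omega> t + w t + \<rho>) (at t within {0..})"
    and w: "(w has_vector_derivative H - (z t \<times> \<omega> t + w t) \<times> \<omega> t - z t \<times> v t) (at t within {0..})"
    and \<omega>: "(\<omega> has_vector_derivative v t) (at t within {0..})"
  shows "((\<lambda>t. z t \<times> \<omega> t + w t) has_vector_derivative H + \<rho> \<times> \<omega> t) (at t within {0..})"
proof -
  have "((\<lambda>t. z t \<times> \<omega> t + w t) has_vector_derivative
      (z t \<times> v t + (z t \<times> \<omega> t + w t + \<rho>) \<times> \<omega> t) + (H - (z t \<times> \<omega> t + w t) \<times> \<omega> t - z t \<times> v t))
      (at t within {0..})"
    by (rule has_vector_derivative_add[OF bounded_bilinear.has_vector_derivative[OF bounded_bilinear_cross3 z \<omega>] w])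
  also have "(z t \<times> v t + (z t \<times> \<omega> t + w t + \<rho>) \<times> \<omega> t) + (H - (z t \<times> \<omega> t + w t) \<times> \<omega> t - z t \<times> v t)
      = H + \<rho> \<times> \<omega> t"
    by (simp add: cross_add_left)
  finally show ?thesis .
qed

lemma transported_rate_bounds:
  fixes \<Omega>0 :: "real \<Rightarrow> real^3"
  assumes "bounded (\<Omega>0 ` {0..})"
  obtains C where "C > 0" "\<And>t p. t \<ge> 0 \<Longrightarrow> norm (p \<times> \<Omega>0 t) \<le> C * norm p"
    "\<And>t z w. t \<ge> 0 \<Longrightarrow> (norm z)\<^sup>2 + (norm w)\<^sup>2 \<le> C * ((norm z)\<^sup>2 + (norm (z \<times> \<Omega>0 t + w))\<^sup>2)"
    "\<And>t z w. t \<ge> 0 \<Longrightarrow> (norm z)\<^sup>2 + (norm (z \<times> \<Omega>0 t + w))\<^sup>2 \<le> C * ((norm z)\<^sup>2 + (norm w)\<^sup>2)"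
proof -
  obtain B where B: "\<And>t. t \<ge> 0 \<Longrightarrow> norm (\<Omega>0 t) \<le> B"
    using assms by (auto simp: bounded_iff)
  obtain k where k: "k > 0" "\<And>x y. norm (x \<times> y) \<le> norm x * norm y * k"
    using bounded_bilinear.pos_bounded[OF bounded_bilinear_cross3] by blast
  have B0: "B \<ge> 0"
    using order_trans[OF norm_ge_zero B[of 0]] by simp
  define m where "m = B * k"
  have m: "m \<ge> 0" "norm (p \<times> \<Omega>0 t) \<le> m * norm p" if "t \<ge> 0" for t p
  proof -
    show "m \<ge> 0"
      using B0 k(1) by (simp add: m_def)
    have "norm p * norm (\<Omega>0 t) * k \<le> norm p * B * k"
      using B[OF that] k(1) by (intro mult_right_mono mult_left_mono) auto
    then show "norm (p \<times> \<Omega>0 t) \<le> m * norm p"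
      using k(2)[of p "\<Omega>0 t"] by (simp add: m_def algebra_simps)
  qed
  have sum_sq: "(norm (p + q))\<^sup>2 \<le> 2 * (norm p)\<^sup>2 + 2 * (norm q)\<^sup>2" for p q :: "real^3"
  proof -
    have "(norm (p + q))\<^sup>2 \<le> (norm p + norm q)\<^sup>2"
      by (intro power_mono norm_triangle_ineq) auto
    also have "\<dots> \<le> 2 * (norm p)\<^sup>2 + 2 * (norm q)\<^sup>2"
      using sum_squares_bound[of "norm p" "norm q"] by (simp add: power2_sum)
    finally show ?thesis .
  qed
  define C where "C = 2 * m\<^sup>2 + m + 3"
  have C: "C > 0" "m \<le> C" "1 + 2 * m\<^sup>2 \<le> C" "2 \<le> C"
    using m(1)[of 0] by (auto simp: C_def add_nonneg_pos)
  have pC: "norm (p \<times> \<Omega>0 t) \<le> C * norm p" if "t \<ge> 0" for t p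
    using m(2)[OF that, of p] mult_right_mono[OF C(2), of "norm p"] by simp
  have sq: "(norm (p \<times> \<Omega>0 t))\<^sup>2 \<le> m\<^sup>2 * (norm p)\<^sup>2" if "t \<ge> 0" for t p
    using power_mono[OF m(2)[OF that], of p 2] by (simp add: power_mult_distrib)
  have fin: "(norm z)\<^sup>2 + (norm (z \<times> \<Omega>0 t + w))\<^sup>2 \<le> C * ((norm z)\<^sup>2 + (norm w)\<^sup>2)"
    if "t \<ge> 0" for t z w
  proof -
    have "(norm z)\<^sup>2 + (norm (z \<times> \<Omega>0 t + w))\<^sup>2 \<le> (1 + 2 * m\<^sup>2) * (norm z)\<^sup>2 + 2 * (norm w)\<^sup>2"
      using sum_sq[of "z \<times> \<Omega>0 t" w] sq[OF that, of z] by (simp add: algebra_simps)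
    also have "\<dots> \<le> C * (norm z)\<^sup>2 + C * (norm w)\<^sup>2"
      using C by (intro add_mono mult_right_mono) auto
    finally show ?thesis
      by (simp add: distrib_left)
  qed
  have "(norm z)\<^sup>2 + (norm w)\<^sup>2 \<le> C * ((norm z)\<^sup>2 + (norm (z \<times> \<Omega>0 t + w))\<^sup>2)" if "t \<ge> 0" for t z w
    using fin[OF that, of "- z" "z \<times> \<Omega>0 t + w"] by (simp add: cross_minus_left)
  then show thesis
    using that[of C] C(1) pC fin by blast
qed

section \<open>Extreme eigenvalues of symmetric matrices\<close>

lemma semidefinite_cauchy_schwarz:
  fixes P :: "'a::real_inner \<Rightarrow> 'a"
  assumes P: "linear P" and sym: "\<And>x y. x \<bullet> P y = P x \<bullet> y" and psd: "\<And>x. 0 \<le> x \<bullet> P x"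
  shows "(x \<bullet> P y)\<^sup>2 \<le> (x \<bullet> P x) * (y \<bullet> P y)"
proof -
  define A B C where "A = x \<bullet> P x" and "B = x \<bullet> P y" and "C = y \<bullet> P y"
  have q: "0 \<le> A + 2 * t * B + t\<^sup>2 * C" for t
  proof -
    have "y \<bullet> P x = B"
      by (simp add: B_def sym[of y x] inner_commute)
    then have "(x + t *\<^sub>R y) \<bullet> P (x + t *\<^sub>R y) = A + 2 * t * B + t\<^sup>2 * C"
      by (simp add: linear_add[OF P] linear_cmul[OF P] inner_add_left inner_add_right A_def B_def C_def
          power2_eq_square algebra_simps)
    then show ?thesis
      using psd[of "x + t *\<^sub>R y"] by simp
  qed
  have "B\<^sup>2 \<le> A * C"
  proof (cases "C = 0")
    case True
    have "B = 0"
    proof (rule ccontr)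
      assume "B \<noteq> 0"
      then show False
        using q[of "- (A + 1) / (2 * B)"] True by (simp add: field_simps)
    qed
    then show ?thesis
      using True by simp
  next
    case False
    then have C: "C > 0"
      using psd[of y] by (simp add: C_def)
    have "0 \<le> C * (A + 2 * (- B / C) * B + (- B / C)\<^sup>2 * C)"
      using q[of "- B / C"] C by (intro mult_nonneg_nonneg) auto
    also have "\<dots> = A * C - B\<^sup>2"
      using C by (simp add: field_simps power2_eq_square)
    finally show ?thesis by simp
  qed
  then show ?thesis
    by (simp add: A_def B_def C_def)
qed

lemma symmetric_matrix_inner:
  fixes K :: "real^'n^'n"
  assumes "transpose K = K"
  shows "x \<bullet> (K *v y) = (K *v x) \<bullet> y"
  using dot_lmul_matrix[of x K y] assms by (metis transpose_matrix_vector)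

text \<open>
  The maximum of the Rayleigh quotient on the unit sphere is an eigenvalue: for its maximizer \<open>v\<close> the positive
  semidefinite form \<open>P = l - K\<close> vanishes at \<open>v\<close>, and then \<open>P v = 0\<close> by the Cauchy--Schwarz inequality for \<open>P\<close>.
\<close>

lemma symmetric_matrix_max_eigenvalue:
  fixes K :: "real^'n^'n"
  assumes K: "transpose K = K"
  shows "\<exists>l. eigenvalue K l \<and> (\<forall>x. x \<bullet> (K *v x) \<le> l * (x \<bullet> x))"
proof -
  let ?q = "\<lambda>x. x \<bullet> (K *v x)"
  have "continuous_on (sphere 0 1) ?q"
    by (intro continuous_intros linear_continuous_on matrix_vector_mul_bounded_linear)
  then obtain v where v: "v \<in> sphere 0 1" "\<And>x. x \<in> sphere 0 1 \<Longrightarrow> ?q x \<le> ?q v"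
    using continuous_attains_sup[of "sphere 0 1 :: (real^'n) set" ?q] by auto
  define l where "l = ?q v"
  have le: "?q x \<le> l * (x \<bullet> x)" for x
  proof (cases "x = 0")
    case False
    define y where "y = (1 / norm x) *\<^sub>R x"
    have "x = norm x *\<^sub>R y" and y: "y \<in> sphere 0 1"
      using False by (simp_all add: y_def)
    then have "?q x = (norm x)\<^sup>2 * ?q y"
      by (metis inner_scaleR_left inner_scaleR_right matrix_vector_mult_scaleR mult.assoc power2_eq_square)
    also have "\<dots> \<le> (norm x)\<^sup>2 * l"
      using v(2)[OF y] by (intro mult_left_mono) (auto simp: l_def)
    finally show ?thesis
      by (simp add: power2_norm_eq_inner mult.commute)
  qed simp
  define P where "P x = l *\<^sub>R x - K *v x" for x
  have P: "linear P"
    unfolding P_def by (rule linearI) (simp_all add: matrix_vector_right_distrib matrix_vector_mult_scaleR algebra_simps)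
  have sym: "x \<bullet> P y = P x \<bullet> y" for x y
    by (simp add: P_def inner_diff_left inner_diff_right symmetric_matrix_inner[OF K])
  have psd: "0 \<le> x \<bullet> P x" for x
    using le[of x] by (simp add: P_def inner_diff_right)
  have "v \<bullet> P v = 0"
    using v(1) by (simp add: P_def inner_diff_right l_def power2_norm_eq_inner[symmetric])
  then have "(P v \<bullet> P v)\<^sup>2 \<le> 0"
    using semidefinite_cauchy_schwarz[OF P sym psd, of "P v" v] by simp
  then have "K *v v = l *s v"
    by (simp add: P_def scalar_mult_eq_scaleR)
  moreover have "v \<noteq> 0"
    using v(1) by auto
  ultimately show ?thesis
    using le by (auto simp: eigenvalue_def)
qed

lemma symmetric_matrix_min_eigenvalue:
  fixes K :: "real^'n^'n"
  assumes K: "transpose K = K"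
  shows "\<exists>l. eigenvalue K l \<and> (\<forall>x. l * (x \<bullet> x) \<le> x \<bullet> (K *v x))"
proof -
  have minus: "(- K) *v x = - (K *v x)" for x
    by (simp add: matrix_vector_mult_def vec_eq_iff sum_negf)
  have "transpose (- K) = - K"
    using K by (simp add: transpose_def vec_eq_iff)
  then obtain l where "eigenvalue (- K) l" "\<forall>x. x \<bullet> ((- K) *v x) \<le> l * (x \<bullet> x)"
    using symmetric_matrix_max_eigenvalue by blast
  then obtain v where "v \<noteq> 0" "- (K *v v) = l *\<^sub>R v" and le: "\<And>x. - (x \<bullet> (K *v x)) \<le> l * (x \<bullet> x)"
    by (auto simp: eigenvalue_def minus scalar_mult_eq_scaleR)
  then have "K *v v = (- l) *s v"
    by (simp add: scalar_mult_eq_scaleR minus_equation_iff[of "K *v v"])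
  then have "eigenvalue K (- l)"
    using \<open>v \<noteq> 0\<close> by (auto simp: eigenvalue_def)
  moreover have "- l * (x \<bullet> x) \<le> x \<bullet> (K *v x)" for x
    using le[of x] by simp
  ultimately show ?thesis by blast
qed

text \<open>
  Needed to relate the extrema \<open>Min\<close> and \<open>Max\<close> in \<open>lambda_min\<close> and \<open>lambda_max\<close> to actual eigenvalues.
\<close>

lemma finite_symmetric_eigenvalues:
  fixes K :: "real^'n^'n"
  assumes K: "transpose K = K"
  shows "finite {l. eigenvalue K l}"
proof -
  have "\<forall>l. \<exists>v. eigenvalue K l \<longrightarrow> v \<noteq> 0 \<and> K *v v = l *s v"
    unfolding eigenvalue_def by blast
  then obtain v where v: "\<And>l. eigenvalue K l \<Longrightarrow> v l \<noteq> 0 \<and> K *v v l = l *s v l"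
    by metis
  let ?E = "{l. eigenvalue K l}"
  have orth: "v l \<bullet> v m = 0" if "eigenvalue K l" "eigenvalue K m" "l \<noteq> m" for l m
  proof -
    have "l * (v l \<bullet> v m) = m * (v l \<bullet> v m)"
      using symmetric_matrix_inner[OF K, of "v l" "v m"] v[OF that(1)] v[OF that(2)]
      by (auto simp: scalar_mult_eq_scaleR)
    then show ?thesis
      using that(3) by simp
  qed
  have "inj_on v ?E"
    using orth v by (metis (mono_tags) inj_onI inner_eq_zero_iff mem_Collect_eq)
  moreover have "independent (v ` ?E)"
  proof (rule pairwise_orthogonal_independent)
    show "pairwise orthogonal (v ` ?E)"
      using orth by (auto simp: pairwise_def orthogonal_def)
    show "0 \<notin> v ` ?E"
      using v by auto
  qed
  then have "finite (v ` ?E)"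
    by (rule independent_imp_finite)
  ultimately show ?thesis
    using finite_imageD by blast
qed

lemma lambda_min_le_form:
  fixes K :: "real^'n^'n"
  assumes "transpose K = K"
  shows "lambda_min K * (x \<bullet> x) \<le> x \<bullet> (K *v x)"
proof -
  obtain l where l: "eigenvalue K l" "\<And>x. l * (x \<bullet> x) \<le> x \<bullet> (K *v x)"
    using symmetric_matrix_min_eigenvalue[OF assms] by blast
  then have "lambda_min K \<le> l"
    unfolding lambda_min_def using finite_symmetric_eigenvalues[OF assms] by (intro Min_le) auto
  then show ?thesis
    using l(2)[of x] by (meson inner_ge_zero mult_right_mono order_trans)
qed

lemma form_le_lambda_max:
  fixes K :: "real^'n^'n"
  assumes "transpose K = K"
  shows "x \<bullet> (K *v x) \<le> lambda_max K * (x \<bullet> x)"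
proof -
  obtain l where l: "eigenvalue K l" "\<And>x. x \<bullet> (K *v x) \<le> l * (x \<bullet> x)"
    using symmetric_matrix_max_eigenvalue[OF assms] by blast
  then have "l \<le> lambda_max K"
    unfolding lambda_max_def using finite_symmetric_eigenvalues[OF assms] by (intro Max_ge) auto
  then show ?thesis
    using l(2)[of x] by (meson inner_ge_zero mult_right_mono order_trans)
qed

lemma sym_pos_def_lambda_min_pos:
  fixes K :: "real^'n^'n"
  assumes "sym_pos_def K"
  shows "lambda_min K > 0"
proof -
  have K: "transpose K = K" "\<And>x. x \<noteq> 0 \<Longrightarrow> 0 < x \<bullet> (K *v x)"
    using assms by (auto simp: sym_pos_def_def)
  have "{l. eigenvalue K l} \<noteq> {}"
    using symmetric_matrix_min_eigenvalue[OF K(1)] by blast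
  then have "eigenvalue K (lambda_min K)"
    unfolding lambda_min_def using Min_in[OF finite_symmetric_eigenvalues[OF K(1)]] by blast
  then obtain v where "v \<noteq> 0" "K *v v = lambda_min K *s v"
    by (auto simp: eigenvalue_def)
  then have "0 < lambda_min K * (v \<bullet> v)" "v \<bullet> v > 0"
    using K(2)[of v] by (auto simp: scalar_mult_eq_scaleR)
  then show ?thesis
    by (simp add: zero_less_mult_iff)
qed

lemma sym_pos_def_bilinear_bound:
  fixes K :: "real^'n^'n"
  assumes "sym_pos_def K"
  shows "\<bar>x \<bullet> (K *v y)\<bar> \<le> lambda_max K * norm x * norm y"
proof -
  have K: "transpose K = K" "\<And>x. 0 \<le> x \<bullet> (K *v x)"
    using assms unfolding sym_pos_def_def by (metis inner_zero_left less_imp_le order_refl)+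
  have "lambda_max K * (axis undefined 1 \<bullet> (axis undefined 1 :: real^'n)) \<ge> 0"
    using form_le_lambda_max[OF K(1)] K(2) by (rule order_trans[rotated])
  then have l0: "lambda_max K \<ge> 0"
    by (simp add: inner_axis_axis)
  have "(x \<bullet> (K *v y))\<^sup>2 \<le> (x \<bullet> (K *v x)) * (y \<bullet> (K *v y))"
    by (rule semidefinite_cauchy_schwarz) (use K symmetric_matrix_inner in auto)
  also have "\<dots> \<le> (lambda_max K * (norm x)\<^sup>2) * (lambda_max K * (norm y)\<^sup>2)"
    using form_le_lambda_max[OF K(1)] K(2) l0 unfolding power2_norm_eq_inner
    by (intro mult_mono) auto
  also have "\<dots> = (lambda_max K * norm x * norm y)\<^sup>2"
    by (simp add: power2_eq_square algebra_simps)
  finally have "\<bar>x \<bullet> (K *v y)\<bar> \<le> \<bar>lambda_max K * norm x * norm y\<bar>"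
    by (simp only: abs_le_square_iff)
  then show ?thesis
    using l0 by (simp add: abs_mult)
qed

section \<open>Lyapunov functions for damped feedback\<close>

lemma nonzero_divide_mult_cancel: "y \<noteq> 0 \<Longrightarrow> x / y * y = x" for x y :: real
  by simp

text \<open>
  A quadratic form with negative discriminant is bounded below by \<open>e (p\<^sup>2 + q\<^sup>2)\<close>; the constant is chosen such that
  the discriminant of the form minus \<open>e (p\<^sup>2 + q\<^sup>2)\<close> is still at most \<open>0\<close>.
\<close>

lemma binary_form_pos:
  fixes A B M :: real
  assumes "A > 0" "B > 0" "M\<^sup>2 < 4 * A * B"
  shows "\<exists>c>0. \<forall>p q. c * (p\<^sup>2 + q\<^sup>2) \<le> A * p\<^sup>2 - M * p * q + B * q\<^sup>2"
proof -
  define e where "e = (4 * A * B - M\<^sup>2) / (4 * (A + B))"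
  have "4 * (A + B) \<noteq> 0"
    using assms(1,2) by simp
  then have "e * (4 * (A + B)) = 4 * A * B - M\<^sup>2"
    unfolding e_def by (rule nonzero_divide_mult_cancel)
  then have e: "4 * (e * (A + B)) = 4 * A * B - M\<^sup>2" "e > 0"
    using assms by (metis mult.left_commute) (use assms in \<open>simp add: e_def\<close>)
  have "e * (A + B) \<le> A * B"
    using e(1) zero_le_power2[of M] by linarith
  also have "\<dots> < A * (A + B)"
    using assms by simp
  finally have eA: "A - e > 0"
    using assms by simp
  have det: "M\<^sup>2 \<le> 4 * (A - e) * (B - e)"
    using e(1) zero_le_power2[of e] by (simp add: power2_eq_square algebra_simps)
  have "e * (p\<^sup>2 + q\<^sup>2) \<le> A * p\<^sup>2 - M * p * q + B * q\<^sup>2" for p q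
  proof -
    have "0 \<le> (2 * (A - e) * p - M * q)\<^sup>2 + (4 * (A - e) * (B - e) - M\<^sup>2) * q\<^sup>2"
      using det by (intro add_nonneg_nonneg mult_nonneg_nonneg) auto
    also have "\<dots> = (4 * (A - e)) * ((A - e) * p\<^sup>2 - M * p * q + (B - e) * q\<^sup>2)"
      by (simp add: power2_eq_square algebra_simps)
    finally have "0 \<le> (A - e) * p\<^sup>2 - M * p * q + (B - e) * q\<^sup>2"
      using eA by (simp add: zero_le_mult_iff)
    then show ?thesis
      by (simp add: algebra_simps)
  qed
  then show ?thesis
    using e(2) by blast
qed

text \<open>
  Up to \<open>\<rho>\<close>, half the derivative of the function is at most
  \<open>- \<eta> k \<bar>z\<bar>\<^sup>2 + \<eta> \<mu> \<bar>z\<bar> \<bar>w\<bar> - (\<nu> - \<eta>) \<bar>w\<bar>\<^sup>2\<close>. The last condition in \<open>pos\<close> says that this form has negative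
  discriminant, and \<open>\<eta>\<^sup>2 < k\<close> says the same about the Lyapunov function itself.
\<close>

lemma damped_exponential_lyapunov:
  assumes pos: "k > 0" "\<eta> > 0" "\<eta>\<^sup>2 < k" "\<eta> * (4 * k + \<mu>\<^sup>2) < 4 * k * \<nu>"
    and F: "\<And>t z w x. t \<ge> 0 \<Longrightarrow> F t (z, w, x) = - (k *\<^sub>R z) - Kd w + G t z w"
    and Kd: "\<And>w. \<nu> * (norm w)\<^sup>2 \<le> w \<bullet> Kd w"
    and cross: "\<And>t z w. t \<ge> 0 \<Longrightarrow>
      w \<bullet> G t z w + \<eta> * ((z \<times> \<Omega>0 t) \<bullet> w + z \<bullet> G t z w - z \<bullet> Kd w) \<le> \<eta> * \<mu> * norm z * norm w"
  shows "exponential_lyapunov \<Omega>0 F (\<lambda>t z w x. k * (z \<bullet> z) + w \<bullet> w + 2 * \<eta> * (z \<bullet> w))"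
proof -
  let ?V = "\<lambda>z w :: real^3. k * (z \<bullet> z) + w \<bullet> w + 2 * \<eta> * (z \<bullet> w)"
  have zw: "\<bar>z \<bullet> w\<bar> \<le> norm z * norm w" for z w :: "real^3"
    by (rule Cauchy_Schwarz_ineq2)
  obtain a where a: "a > 0" "\<And>p q. a * (p\<^sup>2 + q\<^sup>2) \<le> k * p\<^sup>2 - 2 * \<eta> * p * q + 1 * q\<^sup>2"
    using binary_form_pos[of k 1 "2 * \<eta>"] pos by (auto simp: power_mult_distrib)
  have lower: "a * ((norm z)\<^sup>2 + (norm w)\<^sup>2) \<le> ?V z w" for z w
  proof -
    have "2 * \<eta> * (norm z * norm w) \<ge> 2 * \<eta> * - (z \<bullet> w)"
      using zw[of z w] pos(2) by (intro mult_left_mono) auto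
    then show ?thesis
      using a(2)[of "norm z" "norm w"] by (simp add: power2_norm_eq_inner algebra_simps)
  qed
  define b where "b = k + 1 + \<eta>"
  have b: "b > 0"
    using pos by (simp add: b_def)
  have upper: "?V z w \<le> b * ((norm z)\<^sup>2 + (norm w)\<^sup>2)" for z w
  proof -
    have "2 * (z \<bullet> w) \<le> (norm z)\<^sup>2 + (norm w)\<^sup>2"
      using zw[of z w] sum_squares_bound[of "norm z" "norm w"] by linarith
    then have "\<eta> * (2 * (z \<bullet> w)) \<le> \<eta> * ((norm z)\<^sup>2 + (norm w)\<^sup>2)"
      using pos(2) by (intro mult_left_mono) auto
    moreover have "k * p + q + \<eta> * (p + q) \<le> b * (p + q)" if "p \<ge> 0" "q \<ge> 0" for p q :: real
      using that pos(1) mult_nonneg_nonneg[of k q] by (simp add: b_def algebra_simps)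
    moreover have "?V z w = k * (norm z)\<^sup>2 + (norm w)\<^sup>2 + \<eta> * (2 * (z \<bullet> w))"
      by (simp add: power2_norm_eq_inner)
    ultimately show ?thesis
      by (smt (verit) zero_le_power2)
  qed
  have \<eta>\<nu>: "\<eta> < \<nu>"
  proof -
    have "4 * k * \<eta> \<le> \<eta> * (4 * k + \<mu>\<^sup>2)"
      using pos by (simp add: algebra_simps)
    then have "4 * k * \<eta> < 4 * k * \<nu>"
      using pos(4) by linarith
    then show ?thesis
      using pos(1) by simp
  qed
  have "(\<eta> * \<mu>)\<^sup>2 < 4 * (\<eta> * k) * (\<nu> - \<eta>)"
  proof -
    have "\<eta> * \<mu>\<^sup>2 < 4 * k * (\<nu> - \<eta>)"
      using pos(4) by (simp add: algebra_simps)
    then have "\<eta> * (\<eta> * \<mu>\<^sup>2) < \<eta> * (4 * k * (\<nu> - \<eta>))"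
      using pos(2) by simp
    then show ?thesis
      by (simp add: power2_eq_square algebra_simps)
  qed
  then obtain c where c: "c > 0" "\<And>p q. c * (p\<^sup>2 + q\<^sup>2) \<le> (\<eta> * k) * p\<^sup>2 - (\<eta> * \<mu>) * p * q + (\<nu> - \<eta>) * q\<^sup>2"
    using binary_form_pos[of "\<eta> * k" "\<nu> - \<eta>" "\<eta> * \<mu>"] pos \<eta>\<nu> by auto
  define e where "e = 2 * (k + \<eta>) / sqrt a"
  have e: "e \<ge> 0"
    using pos a(1) by (simp add: e_def)
  have decrease: "\<exists>D. ((\<lambda>t. ?V (z t) (w t)) has_real_derivative D) (at t within {0..}) \<and>
      D \<le> - (2 * c / b) * ?V (z t) (w t) + e * sqrt (?V (z t) (w t)) * norm \<rho>"
    if t: "t \<ge> 0" and z: "(z has_vector_derivative z t \<times> \<Omega>0 t + w t + \<rho>) (at t within {0..})"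
      and w: "(w has_vector_derivative F t (z t, w t, x t)) (at t within {0..})" for z w x t \<rho>
  proof -
    define z' w' where "z' = z t \<times> \<Omega>0 t + w t + \<rho>" and "w' = - (k *\<^sub>R z t) - Kd (w t) + G t (z t) (w t)"
    have dz: "(z has_derivative (\<lambda>h. h *\<^sub>R z')) (at t within {0..})"
      using z by (simp add: has_vector_derivative_def z'_def)
    have dw: "(w has_derivative (\<lambda>h. h *\<^sub>R w')) (at t within {0..})"
      using w by (simp add: has_vector_derivative_def w'_def F[OF t])
    define D where "D = 2 * (k * (z t \<bullet> z') + w t \<bullet> w' + \<eta> * (z' \<bullet> w t + z t \<bullet> w'))"
    have der: "((\<lambda>t. ?V (z t) (w t)) has_real_derivative D) (at t within {0..})"
      unfolding has_field_derivative_def D_def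
      by (rule derivative_eq_intros dz dw refl)+
        (simp add: fun_eq_iff inner_commute algebra_simps)
    have zero: "z t \<bullet> (z t \<times> \<Omega>0 t) = 0"
      by (simp add: dot_cross_self)
    have "D = 2 * (w t \<bullet> G t (z t) (w t)
        + \<eta> * ((z t \<times> \<Omega>0 t) \<bullet> w t + z t \<bullet> G t (z t) (w t) - z t \<bullet> Kd (w t))
        - w t \<bullet> Kd (w t) + \<eta> * (w t \<bullet> w t) - \<eta> * k * (z t \<bullet> z t)
        + (k * (z t \<bullet> \<rho>) + \<eta> * (w t \<bullet> \<rho>)))"
      unfolding D_def z'_def w'_def
      by (simp add: inner_add_left inner_add_right inner_diff_right zero inner_commute[of "w t" "z t"]
          inner_commute[of \<rho> "w t"] algebra_simps)
    also have "\<dots> \<le> 2 * (- c * ((norm (z t))\<^sup>2 + (norm (w t))\<^sup>2) + (k + \<eta>) * (sqrt (?V (z t) (w t)) / sqrt a) * norm \<rho>)"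
    proof -
      have sq: "norm (z t) \<le> sqrt (?V (z t) (w t)) / sqrt a" "norm (w t) \<le> sqrt (?V (z t) (w t)) / sqrt a"
      proof -
        have "0 \<le> a * (norm (z t))\<^sup>2" "0 \<le> a * (norm (w t))\<^sup>2"
          using a(1) by simp_all
        then have "a * (norm (z t))\<^sup>2 \<le> ?V (z t) (w t)" "a * (norm (w t))\<^sup>2 \<le> ?V (z t) (w t)"
          using lower[of "z t" "w t", unfolded distrib_left] by linarith+
        then have "sqrt a * norm (z t) \<le> sqrt (?V (z t) (w t))" "sqrt a * norm (w t) \<le> sqrt (?V (z t) (w t))"
          by (auto intro: sqrt_mult_le_sqrt)
        then show "norm (z t) \<le> sqrt (?V (z t) (w t)) / sqrt a" "norm (w t) \<le> sqrt (?V (z t) (w t)) / sqrt a"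
          using a(1) by (simp_all only: pos_le_divide_eq real_sqrt_gt_zero mult.commute)
      qed
      have "z t \<bullet> \<rho> \<le> sqrt (?V (z t) (w t)) / sqrt a * norm \<rho>" "w t \<bullet> \<rho> \<le> sqrt (?V (z t) (w t)) / sqrt a * norm \<rho>"
        using norm_cauchy_schwarz[of "z t" \<rho>] norm_cauchy_schwarz[of "w t" \<rho>]
          mult_right_mono[OF sq(1), of "norm \<rho>"] mult_right_mono[OF sq(2), of "norm \<rho>"] by auto
      then have 1: "k * (z t \<bullet> \<rho>) + \<eta> * (w t \<bullet> \<rho>) \<le> (k + \<eta>) * (sqrt (?V (z t) (w t)) / sqrt a * norm \<rho>)"
        using pos(1,2) unfolding distrib_right by (intro add_mono mult_left_mono) auto
      have "w t \<bullet> G t (z t) (w t)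
          + \<eta> * ((z t \<times> \<Omega>0 t) \<bullet> w t + z t \<bullet> G t (z t) (w t) - z t \<bullet> Kd (w t))
          - w t \<bullet> Kd (w t) + \<eta> * (w t \<bullet> w t) - \<eta> * k * (z t \<bullet> z t)
          + (k * (z t \<bullet> \<rho>) + \<eta> * (w t \<bullet> \<rho>))
        \<le> - (c * ((norm (z t))\<^sup>2 + (norm (w t))\<^sup>2)) + (k + \<eta>) * (sqrt (?V (z t) (w t)) / sqrt a * norm \<rho>)"
        using 1 cross[OF t, of "w t" "z t"] Kd[of "w t"] c(2)[of "norm (z t)" "norm (w t)"]
        unfolding power2_norm_eq_inner[symmetric] left_diff_distrib by linarith
      then show ?thesis
        by (simp add: mult.assoc)
    qed
    also have "\<dots> \<le> 2 * (- c * (?V (z t) (w t) / b) + (k + \<eta>) * (sqrt (?V (z t) (w t)) / sqrt a) * norm \<rho>)"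
    proof -
      have "?V (z t) (w t) / b \<le> (norm (z t))\<^sup>2 + (norm (w t))\<^sup>2"
        using upper[of "z t" "w t"] b by (simp add: pos_divide_le_eq mult.commute)
      then have "c * (?V (z t) (w t) / b) \<le> c * ((norm (z t))\<^sup>2 + (norm (w t))\<^sup>2)"
        using c(1) by (intro mult_left_mono) auto
      then show ?thesis by simp
    qed
    also have "\<dots> = - (2 * c / b) * ?V (z t) (w t) + e * sqrt (?V (z t) (w t)) * norm \<rho>"
    proof -
      have "2 * (- c * (v / b) + (k + \<eta>) * (q / sqrt a) * n) = - (2 * c / b) * v + 2 * (k + \<eta>) / sqrt a * q * n"
        for v q n :: real
        by (simp add: algebra_simps add_divide_distrib)
      then show ?thesis
        unfolding e_def .
    qed
    finally show ?thesis
      using der by blast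
  qed
  show ?thesis
    unfolding exponential_lyapunov_def
  proof (intro conjI)
    show "\<exists>a>0. \<forall>t\<ge>0. \<forall>z w x. a * ((norm z)\<^sup>2 + (norm w)\<^sup>2) \<le> ?V z w"
      using a(1) lower by blast
    show "\<exists>b. \<forall>z w. ?V z w \<le> b * ((norm z)\<^sup>2 + (norm w)\<^sup>2)"
      using upper by blast
    have "2 * c / b > 0"
      using b c(1) by simp
    moreover have "dissipation_inequality \<Omega>0 F (\<lambda>t z w x. ?V z w) (2 * c / b) e"
      unfolding dissipation_inequality_def by (intro allI impI decrease)
    ultimately show "\<exists>c>0. \<exists>e\<ge>0. dissipation_inequality \<Omega>0 F (\<lambda>t z w x. ?V z w) c e"
      using e by blast
  qed
qed

section \<open>The five controllers\<close>

locale bounded_reference =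
  fixes R0 :: "real \<Rightarrow> real^3^3" and \<Omega>0 u0 :: "real \<Rightarrow> real^3"
  assumes reference: "rigid_body_trajectory R0 \<Omega>0 u0"
    and bounded_rate: "bounded (\<Omega>0 ` {0..})" and bounded_input: "bounded (u0 ` {0..})"
    and continuous_input: "continuous_on {0..} u0"
begin

lemma rate_derivative: "t \<ge> 0 \<Longrightarrow> (\<Omega>0 has_vector_derivative u0 t) (at t within {0..})"
  using reference by (simp add: rigid_body_trajectory_def)

lemma continuous_rate: "continuous_on {0..} \<Omega>0"
  using rate_derivative by (auto simp: continuous_on_eq_continuous_within intro: has_vector_derivative_continuous)

lemmas feedback_intros = bounded_linear_family_intros bounded_linear_family_components
  continuous_rate continuous_input bounded_rate bounded_input

lemmas tracking_criterion =
  lyapunov_tracking_criterion[OF reference bounded_rate bounded_input continuous_input]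

lemma second_order_tracking:
  assumes H: "hurwitz_matrix (block_matrix 0 (mat 1) (- K\<^sub>P) (- K\<^sub>D))"
  shows "tracks_exponentially R0 \<Omega>0 u0 (\<lambda>R \<Omega> t.
    - (K\<^sub>P *v att_err R0 R t)
    - K\<^sub>D *v ((att_err R0 R t \<times> \<Omega>0 t) + (\<Omega> t - \<Omega>0 t))
    - (((att_err R0 R t \<times> \<Omega>0 t) + (\<Omega> t - \<Omega>0 t)) \<times> \<Omega>0 t)
    - (att_err R0 R t \<times> u0 t))"
proof -
  define F where "F t s = - (K\<^sub>P *v fst s) - K\<^sub>D *v (fst s \<times> \<Omega>0 t + fst (snd s))
    - (fst s \<times> \<Omega>0 t + fst (snd s)) \<times> \<Omega>0 t - fst s \<times> u0 t" for t and s :: "(real^3) \<times> (real^3) \<times> (real^3)"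
  define f where "f s = (snd s, - (K\<^sub>P *v fst s) - K\<^sub>D *v snd s)" for s
  have F: "bounded_linear_family F"
    unfolding F_def by (intro feedback_intros)
  obtain C where C: "C > 0" "\<And>t p. t \<ge> 0 \<Longrightarrow> norm (p \<times> \<Omega>0 t) \<le> C * norm p"
    "\<And>t z w. t \<ge> 0 \<Longrightarrow> (norm z)\<^sup>2 + (norm w)\<^sup>2 \<le> C * ((norm z)\<^sup>2 + (norm (z \<times> \<Omega>0 t + w))\<^sup>2)"
    "\<And>t z w. t \<ge> 0 \<Longrightarrow> (norm z)\<^sup>2 + (norm (z \<times> \<Omega>0 t + w))\<^sup>2 \<le> C * ((norm z)\<^sup>2 + (norm w)\<^sup>2)"
    using transported_rate_bounds[OF bounded_rate] by blast
  have "\<exists>V. exponential_lyapunov \<Omega>0 F V"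
  proof (rule hurwitz_exponential_lyapunov[where f = f and T = "\<lambda>t z w x. (z, z \<times> \<Omega>0 t + w)"
        and C = "1 + C" and a = "1 / C" and b = C])
    show "linear f"
      unfolding f_def
      by (rule linearI) (simp_all add: matrix_vector_right_distrib matrix_vector_mult_scaleR algebra_simps)
    show "hurwitz_operator f"
      unfolding f_def by (rule hurwitz_operator_second_order[OF H])
    show "1 / C > 0"
      using C(1) by simp
    show "1 / C * ((norm z)\<^sup>2 + (norm w)\<^sup>2) \<le> (norm (z, z \<times> \<Omega>0 t + w))\<^sup>2" if "t \<ge> 0" for t z w
      using C(1) C(3)[OF that, of z w] by (simp add: norm_Pair field_simps)
    show "(norm (z, z \<times> \<Omega>0 0 + w))\<^sup>2 \<le> C * ((norm z)\<^sup>2 + (norm w)\<^sup>2)" for z w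
      using C(4)[of 0 z w] by (simp add: norm_Pair)
  next
    fix z w x :: "real \<Rightarrow> real^3" and t :: real and \<rho> :: "real^3"
    assume t: "t \<ge> 0" and z: "(z has_vector_derivative z t \<times> \<Omega>0 t + w t + \<rho>) (at t within {0..})"
      and w: "(w has_vector_derivative F t (z t, w t, x t)) (at t within {0..})"
    let ?y = "z t \<times> \<Omega>0 t + w t"
    have "((\<lambda>t. z t \<times> \<Omega>0 t + w t) has_vector_derivative - (K\<^sub>P *v z t) - K\<^sub>D *v ?y + \<rho> \<times> \<Omega>0 t) (at t within {0..})"
      by (rule transported_rate_derivative[where z = z and w = w and \<rho> = \<rho> and \<omega> = \<Omega>0 and v = u0,
          OF z _ rate_derivative[OF t]]) (use w in \<open>simp add: F_def\<close>)
    then have "((\<lambda>t. (z t, z t \<times> \<Omega>0 t + w t)) has_vector_derivative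
        (?y + \<rho>, - (K\<^sub>P *v z t) - K\<^sub>D *v ?y + \<rho> \<times> \<Omega>0 t)) (at t within {0..})"
      by (intro has_vector_derivative_Pair z)
    moreover have "(?y + \<rho>, - (K\<^sub>P *v z t) - K\<^sub>D *v ?y + \<rho> \<times> \<Omega>0 t) = f (z t, ?y) + (\<rho>, \<rho> \<times> \<Omega>0 t)"
      by (simp add: f_def)
    moreover have "norm (\<rho>, \<rho> \<times> \<Omega>0 t) \<le> (1 + C) * norm \<rho>"
      using norm_Pair_le[of \<rho> "\<rho> \<times> \<Omega>0 t"] C(2)[OF t, of \<rho>] by (simp add: distrib_right)
    ultimately show "\<exists>e. ((\<lambda>t. (z t, z t \<times> \<Omega>0 t + w t)) has_vector_derivative f (z t, ?y) + e) (at t within {0..}) \<and>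
        norm e \<le> (1 + C) * norm \<rho>"
      by (intro exI[of _ "(\<rho>, \<rho> \<times> \<Omega>0 t)"]) simp
  qed
  then obtain V where "exponential_lyapunov \<Omega>0 F V"
    by blast
  from tracking_criterion[OF F this] show ?thesis
    by (simp add: F_def)
qed

lemma third_order_tracking:
  assumes H: "hurwitz_poly (cubic_pencil_poly K\<^sub>D K\<^sub>P K\<^sub>I)"
  shows "tracks_exponentially R0 \<Omega>0 u0 (\<lambda>R \<Omega> t.
    - (K\<^sub>P *v att_err R0 R t)
    - K\<^sub>D *v ((att_err R0 R t \<times> \<Omega>0 t) + (\<Omega> t - \<Omega>0 t))
    - K\<^sub>I *v integral {0..t} (\<lambda>\<tau>. att_err R0 R \<tau>)
    - (((att_err R0 R t \<times> \<Omega>0 t) + (\<Omega> t - \<Omega>0 t)) \<times> \<Omega>0 t)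
    - (att_err R0 R t \<times> u0 t))"
proof -
  define F where "F t s = - (K\<^sub>P *v fst s) - K\<^sub>D *v (fst s \<times> \<Omega>0 t + fst (snd s)) - K\<^sub>I *v snd (snd s)
    - (fst s \<times> \<Omega>0 t + fst (snd s)) \<times> \<Omega>0 t - fst s \<times> u0 t" for t and s :: "(real^3) \<times> (real^3) \<times> (real^3)"
  define f where "f s = (fst (snd s), snd (snd s),
    - (K\<^sub>I *v fst s) - K\<^sub>P *v fst (snd s) - K\<^sub>D *v snd (snd s))" for s
  have F: "bounded_linear_family F"
    unfolding F_def by (intro feedback_intros)
  obtain C where C: "C > 0" "\<And>t p. t \<ge> 0 \<Longrightarrow> norm (p \<times> \<Omega>0 t) \<le> C * norm p"
    "\<And>t z w. t \<ge> 0 \<Longrightarrow> (norm z)\<^sup>2 + (norm w)\<^sup>2 \<le> C * ((norm z)\<^sup>2 + (norm (z \<times> \<Omega>0 t + w))\<^sup>2)"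
    "\<And>t z w. t \<ge> 0 \<Longrightarrow> (norm z)\<^sup>2 + (norm (z \<times> \<Omega>0 t + w))\<^sup>2 \<le> C * ((norm z)\<^sup>2 + (norm w)\<^sup>2)"
    using transported_rate_bounds[OF bounded_rate] by blast
  have "\<exists>V. exponential_lyapunov \<Omega>0 F V"
  proof (rule hurwitz_exponential_lyapunov[where f = f and T = "\<lambda>t z w x. (x, z, z \<times> \<Omega>0 t + w)"
        and C = "1 + C" and a = "1 / C" and b = C])
    show "linear f"
      unfolding f_def
      by (rule linearI) (simp_all add: matrix_vector_right_distrib matrix_vector_mult_scaleR algebra_simps)
    show "hurwitz_operator f"
      unfolding f_def by (rule hurwitz_operator_third_order[OF H])
    show "1 / C > 0"
      using C(1) by simp
    show "1 / C * ((norm z)\<^sup>2 + (norm w)\<^sup>2) \<le> (norm (x, z, z \<times> \<Omega>0 t + w))\<^sup>2" if "t \<ge> 0" for t z w x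
    proof -
      have "1 / C * ((norm z)\<^sup>2 + (norm w)\<^sup>2) \<le> (norm z)\<^sup>2 + (norm (z \<times> \<Omega>0 t + w))\<^sup>2"
        using C(1) C(3)[OF that, of z w] by (simp add: field_simps)
      then show ?thesis
        by (simp add: norm_Pair add_increasing)
    qed
    show "(norm (0 :: real^3, z, z \<times> \<Omega>0 0 + w))\<^sup>2 \<le> C * ((norm z)\<^sup>2 + (norm w)\<^sup>2)" for z w
      using C(4)[of 0 z w] by (simp add: norm_Pair)
  next
    fix z w x :: "real \<Rightarrow> real^3" and t :: real and \<rho> :: "real^3"
    assume t: "t \<ge> 0" and z: "(z has_vector_derivative z t \<times> \<Omega>0 t + w t + \<rho>) (at t within {0..})"
      and w: "(w has_vector_derivative F t (z t, w t, x t)) (at t within {0..})"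
      and x: "(x has_vector_derivative z t) (at t within {0..})"
    let ?y = "z t \<times> \<Omega>0 t + w t"
    let ?h = "- (K\<^sub>I *v x t) - K\<^sub>P *v z t - K\<^sub>D *v ?y"
    have "F t (z t, w t, x t) = ?h - ?y \<times> \<Omega>0 t - z t \<times> u0 t"
      by (simp add: F_def vec_eq_iff)
    note w = w[unfolded this]
    have "((\<lambda>t. z t \<times> \<Omega>0 t + w t) has_vector_derivative ?h + \<rho> \<times> \<Omega>0 t) (at t within {0..})"
      by (rule transported_rate_derivative[where z = z and w = w and \<rho> = \<rho> and \<omega> = \<Omega>0 and v = u0,
          OF z _ rate_derivative[OF t]])
        (rule w)
    then have "((\<lambda>t. (x t, z t, z t \<times> \<Omega>0 t + w t)) has_vector_derivative (z t, ?y + \<rho>, ?h + \<rho> \<times> \<Omega>0 t)) (at t within {0..})"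
      by (intro has_vector_derivative_Pair x z)
    moreover have "(z t, ?y + \<rho>, ?h + \<rho> \<times> \<Omega>0 t) = f (x t, z t, ?y) + (0, \<rho>, \<rho> \<times> \<Omega>0 t)"
      by (simp add: f_def)
    moreover have "norm (0 :: real^3, \<rho>, \<rho> \<times> \<Omega>0 t) \<le> (1 + C) * norm \<rho>"
      using norm_Pair_le[of \<rho> "\<rho> \<times> \<Omega>0 t"] C(2)[OF t, of \<rho>] norm_Pair_le[of "0 :: real^3" "(\<rho>, \<rho> \<times> \<Omega>0 t)"]
      by (simp add: distrib_right)
    ultimately show "\<exists>e. ((\<lambda>t. (x t, z t, z t \<times> \<Omega>0 t + w t)) has_vector_derivative f (x t, z t, ?y) + e) (at t within {0..}) \<and>
        norm e \<le> (1 + C) * norm \<rho>"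
      by (intro exI[of _ "(0, \<rho>, \<rho> \<times> \<Omega>0 t)"]) simp
  qed
  then obtain V where "exponential_lyapunov \<Omega>0 F V"
    by blast
  from tracking_criterion[OF F this] show ?thesis
    by (simp add: F_def)
qed

text \<open>
  The feedback \<open>G\<close> and the transport term \<open>z \<times> \<Omega>0\<close> are estimated together: what cancels between them does not
  count towards \<open>\<mu>\<close>.
\<close>

lemma damped_tracking:
  fixes K :: "real^3^3"
  assumes pos: "k > 0" "\<eta> > 0" "\<eta>\<^sup>2 < k" "\<eta> * (4 * k + \<mu>\<^sup>2) < 4 * k * \<nu>"
    and K: "\<And>w. \<nu> * (norm w)\<^sup>2 \<le> w \<bullet> (K *v w)"
    and G: "bounded_linear_family (\<lambda>t (s :: (real^3) \<times> (real^3) \<times> (real^3)). G t (fst s) (fst (snd s)) :: real^3)"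
    and cross: "\<And>t z w. t \<ge> 0 \<Longrightarrow>
      w \<bullet> G t z w + \<eta> * ((z \<times> \<Omega>0 t) \<bullet> w + z \<bullet> G t z w - z \<bullet> (K *v w)) \<le> \<eta> * \<mu> * norm z * norm w"
  shows "tracks_exponentially R0 \<Omega>0 u0 (\<lambda>R \<Omega> t.
    - (k *\<^sub>R att_err R0 R t) - K *v (\<Omega> t - \<Omega>0 t) + G t (att_err R0 R t) (\<Omega> t - \<Omega>0 t))"
proof -
  define F where "F t s = - (k *\<^sub>R fst s) - K *v fst (snd s) + G t (fst s) (fst (snd s))"
    for t and s :: "(real^3) \<times> (real^3) \<times> (real^3)"
  have F: "bounded_linear_family F"
    unfolding F_def by (intro feedback_intros G)
  have "exponential_lyapunov \<Omega>0 F (\<lambda>t z w x. k * (z \<bullet> z) + w \<bullet> w + 2 * \<eta> * (z \<bullet> w))"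
    by (rule damped_exponential_lyapunov[OF pos _ K cross]) (simp add: F_def)
  from tracking_criterion[OF F this] show ?thesis
    by (simp add: F_def)
qed

lemma small_damping_exists:
  fixes k \<mu> \<nu> :: real
  assumes "k > 0" "\<nu> > 0"
  shows "\<exists>\<eta>>0. \<eta>\<^sup>2 < k \<and> \<eta> * (4 * k + \<mu>\<^sup>2) < 4 * k * \<nu>"
proof -
  define d where "d = 4 * k + \<mu>\<^sup>2"
  have d: "d > 0"
    using assms(1) by (simp add: d_def add_pos_nonneg)
  define \<eta> where "\<eta> = min (sqrt k / 2) (2 * k * \<nu> / d)"
  have "\<eta> > 0"
    using assms d by (simp add: \<eta>_def)
  moreover have "\<eta>\<^sup>2 < k"
  proof -
    have "\<eta>\<^sup>2 \<le> (sqrt k / 2)\<^sup>2"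
      using \<open>\<eta> > 0\<close> by (intro power_mono) (auto simp: \<eta>_def)
    also have "\<dots> < k"
      using assms(1) by (simp add: power_divide)
    finally show ?thesis .
  qed
  moreover have "\<eta> * d < 4 * k * \<nu>"
  proof -
    have "\<eta> * d \<le> (2 * k * \<nu> / d) * d"
      using d by (intro mult_right_mono) (auto simp: \<eta>_def)
    also have "\<dots> < 4 * k * \<nu>"
      using d assms by simp
    finally show ?thesis .
  qed
  ultimately show ?thesis
    unfolding d_def by blast
qed

lemma pd_tracking:
  fixes K\<^sub>D :: "real^3^3"
  assumes k: "k\<^sub>P > 0" and K: "sym_pos_def K\<^sub>D"
  shows "tracks_exponentially R0 \<Omega>0 u0 (\<lambda>R \<Omega> t. - (k\<^sub>P *\<^sub>R att_err R0 R t) - K\<^sub>D *v (\<Omega> t - \<Omega>0 t))"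
proof -
  have sym: "transpose K\<^sub>D = K\<^sub>D"
    using K by (simp add: sym_pos_def_def)
  obtain C where C: "\<And>t p. t \<ge> 0 \<Longrightarrow> norm (p \<times> \<Omega>0 t) \<le> C * norm p"
    using transported_rate_bounds[OF bounded_rate] by metis
  define \<mu> where "\<mu> = C + lambda_max K\<^sub>D"
  obtain \<eta> where \<eta>: "\<eta> > 0" "\<eta>\<^sup>2 < k\<^sub>P" "\<eta> * (4 * k\<^sub>P + \<mu>\<^sup>2) < 4 * k\<^sub>P * lambda_min K\<^sub>D"
    using small_damping_exists[OF k sym_pos_def_lambda_min_pos[OF K]] by blast
  have "tracks_exponentially R0 \<Omega>0 u0 (\<lambda>R \<Omega> t. - (k\<^sub>P *\<^sub>R att_err R0 R t) - K\<^sub>D *v (\<Omega> t - \<Omega>0 t) + 0)"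
  proof (rule damped_tracking[OF k \<eta>])
    show "lambda_min K\<^sub>D * (norm w)\<^sup>2 \<le> w \<bullet> (K\<^sub>D *v w)" for w
      using lambda_min_le_form[OF sym] by (simp add: power2_norm_eq_inner)
    show "bounded_linear_family (\<lambda>t s. 0)"
      by (rule bounded_linear_family_const[OF bounded_linear_zero])
    fix t z w assume t: "(t::real) \<ge> 0"
    have "(z \<times> \<Omega>0 t) \<bullet> w \<le> C * norm z * norm w"
      using norm_cauchy_schwarz[of "z \<times> \<Omega>0 t" w] mult_right_mono[OF C[OF t, of z], of "norm w"] by simp
    moreover have "- (z \<bullet> (K\<^sub>D *v w)) \<le> lambda_max K\<^sub>D * norm z * norm w"
      using sym_pos_def_bilinear_bound[OF K, of z w] by linarith
    ultimately have "(z \<times> \<Omega>0 t) \<bullet> w - z \<bullet> (K\<^sub>D *v w) \<le> \<mu> * norm z * norm w"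
      by (simp add: \<mu>_def algebra_simps)
    then have "\<eta> * ((z \<times> \<Omega>0 t) \<bullet> w - z \<bullet> (K\<^sub>D *v w)) \<le> \<eta> * (\<mu> * norm z * norm w)"
      using \<eta>(1) by (intro mult_left_mono) auto
    then show "w \<bullet> 0 + \<eta> * ((z \<times> \<Omega>0 t) \<bullet> w + z \<bullet> 0 - z \<bullet> (K\<^sub>D *v w)) \<le> \<eta> * \<mu> * norm z * norm w"
      by (simp add: mult.assoc)
  qed
  then show ?thesis by simp
qed

text \<open>
  For \<open>\<eta> = \<epsilon>\<close> the compensation \<open>- \<epsilon> (z \<times> \<Omega>0)\<close> cancels the transport term in the derivative of \<open>2 \<epsilon> (z \<bullet> w)\<close>.
  Only \<open>K\<^sub>D\<close> is left in the cross terms, with \<open>\<mu> = lambda_max K\<^sub>D\<close>, and the two bounds on \<open>\<epsilon>\<close> are the conditions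
  on \<open>\<eta>\<close> in \<open>damped_tracking\<close>.
\<close>

lemma compensated_pd_tracking:
  fixes K\<^sub>D :: "real^3^3"
  assumes k: "k\<^sub>P > 0" and K: "sym_pos_def K\<^sub>D" and \<epsilon>: "0 < \<epsilon>"
    "\<epsilon> < min (sqrt k\<^sub>P) (4 * k\<^sub>P * lambda_min K\<^sub>D / (4 * k\<^sub>P + (lambda_max K\<^sub>D)\<^sup>2))"
  shows "tracks_exponentially R0 \<Omega>0 u0 (\<lambda>R \<Omega> t. - (k\<^sub>P *\<^sub>R att_err R0 R t) - K\<^sub>D *v (\<Omega> t - \<Omega>0 t)
    - \<epsilon> *\<^sub>R (att_err R0 R t \<times> \<Omega>0 t))"
proof -
  have sym: "transpose K\<^sub>D = K\<^sub>D"
    using K by (simp add: sym_pos_def_def)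
  have "4 * k\<^sub>P + (lambda_max K\<^sub>D)\<^sup>2 > 0"
    using k by (simp add: add_pos_nonneg)
  then have gap: "\<epsilon> * (4 * k\<^sub>P + (lambda_max K\<^sub>D)\<^sup>2) < 4 * k\<^sub>P * lambda_min K\<^sub>D"
    using \<epsilon>(2) by (simp add: pos_less_divide_eq)
  have "\<epsilon>\<^sup>2 < (sqrt k\<^sub>P)\<^sup>2"
    using \<epsilon> by (intro power_strict_mono) auto
  then have \<epsilon>k: "\<epsilon>\<^sup>2 < k\<^sub>P"
    using k by simp
  have "tracks_exponentially R0 \<Omega>0 u0 (\<lambda>R \<Omega> t. - (k\<^sub>P *\<^sub>R att_err R0 R t) - K\<^sub>D *v (\<Omega> t - \<Omega>0 t)
    + - (\<epsilon> *\<^sub>R (att_err R0 R t \<times> \<Omega>0 t)))"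
  proof (rule damped_tracking[OF k \<epsilon>(1) \<epsilon>k gap])
    show "lambda_min K\<^sub>D * (norm w)\<^sup>2 \<le> w \<bullet> (K\<^sub>D *v w)" for w
      using lambda_min_le_form[OF sym] by (simp add: power2_norm_eq_inner)
    show "bounded_linear_family (\<lambda>t s. - (\<epsilon> *\<^sub>R (fst s \<times> \<Omega>0 t)))"
      by (intro feedback_intros)
    fix t z w
    have "\<epsilon> * - (z \<bullet> (K\<^sub>D *v w)) \<le> \<epsilon> * (lambda_max K\<^sub>D * norm z * norm w)"
      using sym_pos_def_bilinear_bound[OF K, of z w] \<epsilon>(1) by (intro mult_left_mono) auto
    then show "w \<bullet> - (\<epsilon> *\<^sub>R (z \<times> \<Omega>0 t)) + \<epsilon> * ((z \<times> \<Omega>0 t) \<bullet> w + z \<bullet> - (\<epsilon> *\<^sub>R (z \<times> \<Omega>0 t)) - z \<bullet> (K\<^sub>D *v w))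
        \<le> \<epsilon> * lambda_max K\<^sub>D * norm z * norm w"
      by (simp add: dot_cross_self inner_commute[of w] algebra_simps)
  qed
  then show ?thesis by simp
qed

text \<open>
  The term \<open>w \<times> \<Omega>0\<close> makes both \<open>z\<close> and \<open>w\<close> rotate with \<open>\<Omega>0\<close>, so that \<open>z \<bullet> w\<close> is not affected by \<open>\<Omega>0\<close>.
\<close>

lemma rotating_frame_tracking:
  assumes k: "k\<^sub>R > 0" "k\<^sub>\<Omega> > 0"
  shows "tracks_exponentially R0 \<Omega>0 u0 (\<lambda>R \<Omega> t. - (k\<^sub>R *\<^sub>R att_err R0 R t) - k\<^sub>\<Omega> *\<^sub>R (\<Omega> t - \<Omega>0 t)
    + ((\<Omega> t - \<Omega>0 t) \<times> \<Omega>0 t))"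
proof -
  obtain \<eta> where \<eta>: "\<eta> > 0" "\<eta>\<^sup>2 < k\<^sub>R" "\<eta> * (4 * k\<^sub>R + k\<^sub>\<Omega>\<^sup>2) < 4 * k\<^sub>R * k\<^sub>\<Omega>"
    using small_damping_exists[OF k] by blast
  define K :: "real^3^3" where "K = k\<^sub>\<Omega> *\<^sub>R mat 1"
  have K: "K *v w = k\<^sub>\<Omega> *\<^sub>R w" for w
    by (simp add: K_def scaleR_matrix_vector_assoc[symmetric])
  have "tracks_exponentially R0 \<Omega>0 u0 (\<lambda>R \<Omega> t. - (k\<^sub>R *\<^sub>R att_err R0 R t) - K *v (\<Omega> t - \<Omega>0 t)
    + ((\<Omega> t - \<Omega>0 t) \<times> \<Omega>0 t))"
  proof (rule damped_tracking[OF k(1) \<eta>])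
    show "k\<^sub>\<Omega> * (norm w)\<^sup>2 \<le> w \<bullet> (K *v w)" for w
      by (simp add: K power2_norm_eq_inner)
    show "bounded_linear_family (\<lambda>t s. fst (snd s) \<times> \<Omega>0 t)"
      by (intro feedback_intros)
    fix t z w
    have "(z \<times> \<Omega>0 t) \<bullet> w + z \<bullet> (w \<times> \<Omega>0 t) = 0"
      by (simp add: cross3_def inner_vec_def sum_3 algebra_simps)
    moreover have "\<eta> * - (k\<^sub>\<Omega> * (z \<bullet> w)) \<le> \<eta> * (k\<^sub>\<Omega> * (norm z * norm w))"
    proof -
      have "k\<^sub>\<Omega> * - (z \<bullet> w) \<le> k\<^sub>\<Omega> * (norm z * norm w)"
        using Cauchy_Schwarz_ineq2[of z w] k(2) by (intro mult_left_mono) auto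
      then show ?thesis
        using \<eta>(1) by (intro mult_left_mono) auto
    qed
    ultimately show "w \<bullet> (w \<times> \<Omega>0 t) + \<eta> * ((z \<times> \<Omega>0 t) \<bullet> w + z \<bullet> (w \<times> \<Omega>0 t) - z \<bullet> (K *v w))
        \<le> \<eta> * k\<^sub>\<Omega> * norm z * norm w"
      by (simp add: K dot_cross_self mult.assoc)
  qed
  then show ?thesis
    by (simp add: K)
qed

end

lemma smooth_curve_on_continuous:
  assumes "smooth_curve_on S f"
  shows "continuous_on S f"
proof -
  obtain D where "D 0 = f" "\<forall>t\<in>S. (D 0 has_vector_derivative D (Suc 0) t) (at t within S)"
    using assms unfolding smooth_curve_on_def by blast
  then show ?thesis
    by (auto simp: continuous_on_eq_continuous_within intro: has_vector_derivative_continuous)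
qed

theorem theorem5:
  fixes R0 :: "real \<Rightarrow> real^3^3" and \<Omega>0 u0 :: "real \<Rightarrow> real^3"
  assumes "smooth_curve_on {0..} R0" and "smooth_curve_on {0..} \<Omega>0" and "smooth_curve_on {0..} u0"
    and "rigid_body_trajectory R0 \<Omega>0 u0"
    and "bounded (\<Omega>0 ` {0..})" and "bounded (u0 ` {0..})"
  shows
    "(\<forall>K\<^sub>P K\<^sub>D :: real^3^3.
        hurwitz_matrix (block_matrix 0 (mat 1) (- K\<^sub>P) (- K\<^sub>D)) \<longrightarrow>
        tracks_exponentially R0 \<Omega>0 u0 (\<lambda>R \<Omega> t.
          - (K\<^sub>P *v att_err R0 R t)
          - K\<^sub>D *v ((att_err R0 R t \<times> \<Omega>0 t) + (\<Omega> t - \<Omega>0 t))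
          - (((att_err R0 R t \<times> \<Omega>0 t) + (\<Omega> t - \<Omega>0 t)) \<times> \<Omega>0 t)
          - (att_err R0 R t \<times> u0 t))) \<and>
     (\<forall>K\<^sub>P K\<^sub>D K\<^sub>I :: real^3^3.
        hurwitz_poly (cubic_pencil_poly K\<^sub>D K\<^sub>P K\<^sub>I) \<longrightarrow>
        tracks_exponentially R0 \<Omega>0 u0 (\<lambda>R \<Omega> t.
          - (K\<^sub>P *v att_err R0 R t)
          - K\<^sub>D *v ((att_err R0 R t \<times> \<Omega>0 t) + (\<Omega> t - \<Omega>0 t))
          - K\<^sub>I *v integral {0..t} (\<lambda>\<tau>. att_err R0 R \<tau>)
          - (((att_err R0 R t \<times> \<Omega>0 t) + (\<Omega> t - \<Omega>0 t)) \<times> \<Omega>0 t)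
          - (att_err R0 R t \<times> u0 t))) \<and>
     (\<forall>(k\<^sub>P :: real) (K\<^sub>D :: real^3^3).
        0 < k\<^sub>P \<and> sym_pos_def K\<^sub>D \<longrightarrow>
        tracks_exponentially R0 \<Omega>0 u0 (\<lambda>R \<Omega> t.
          - (k\<^sub>P *\<^sub>R att_err R0 R t) - K\<^sub>D *v (\<Omega> t - \<Omega>0 t))) \<and>
     (\<forall>(k\<^sub>P :: real) (K\<^sub>D :: real^3^3) (\<epsilon> :: real).
        0 < k\<^sub>P \<and> sym_pos_def K\<^sub>D \<and> 0 < \<epsilon> \<and>
        \<epsilon> < min (sqrt k\<^sub>P) (4 * k\<^sub>P * lambda_min K\<^sub>D / (4 * k\<^sub>P + (lambda_max K\<^sub>D)\<^sup>2)) \<longrightarrow>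
        tracks_exponentially R0 \<Omega>0 u0 (\<lambda>R \<Omega> t.
          - (k\<^sub>P *\<^sub>R att_err R0 R t) - K\<^sub>D *v (\<Omega> t - \<Omega>0 t)
          - \<epsilon> *\<^sub>R (att_err R0 R t \<times> \<Omega>0 t))) \<and>
     (\<forall>k\<^sub>R k\<^sub>\<Omega> :: real.
        0 < k\<^sub>R \<and> 0 < k\<^sub>\<Omega> \<longrightarrow>
        tracks_exponentially R0 \<Omega>0 u0 (\<lambda>R \<Omega> t.
          - (k\<^sub>R *\<^sub>R att_err R0 R t) - k\<^sub>\<Omega> *\<^sub>R (\<Omega> t - \<Omega>0 t)
          + ((\<Omega> t - \<Omega>0 t) \<times> \<Omega>0 t)))"
proof -
  interpret bounded_reference R0 \<Omega>0 u0
    by unfold_locales (use assms smooth_curve_on_continuous in auto)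
  show ?thesis
    by (intro conjI allI impI; (elim conjE)?)
      (rule second_order_tracking third_order_tracking pd_tracking compensated_pd_tracking
        rotating_frame_tracking; assumption)+
qed

end
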